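(* Let $\mu$ be the minimum, over all attractors of the system $\dot\phi=A\phi+Bf(\phi)$ on the manifold $\sigma$, of the maximum of $|f|$ over the attractor. Then the domain $\{\rho\ge\mu^{-1}\}$ is attractor-free, i.e., it does not contain nontrivial minimal $\omega$-limit sets of the system $$\dot\rho=-\Big|\Big\langle\frac{\partial\rho}{\partial x},B\Big\rangle\Big|,\qquad \dot\phi=A\phi+\frac1\rho\Big(Bu+\phi\Big|\Big\langle\frac{\partial\rho}{\partial x},B\Big\rangle\Big|\Big),$$ which describes, in the polar-like coordinates $x=\rho\phi$, the motion $\dot x=Ax+Bu(x)$ under the basic control $u(x)=-\mathrm{sign}\langle B,\frac{\partial\rho}{\partial x}(x)\rangle$.
   Context: Let $\omega_1,\dots,\omega_N>0$ be pairwise distinct. The state is $x=(x_1,y_1,\dots,x_N,y_N)^*\in\mathbb{R}^{2N}$, and $\dot x=Ax+Bu$ means $\dot x_i=y_i$, $\dot y_i=-\omega_i^2x_i+u$, $i=1,\dots,N$; so $A$ is block diagonal with blocks $\begin{pmatrix}0&1\\-\omega_i^2&0\end{pmatrix}$ and $B=(0,1,\dots,0,1)^*$. The control is bounded by $|u|\le1$. For $p=(\xi_1,\eta_1,\dots,\xi_N,\eta_N)\in\mathbb{R}^{2N}$ put $z_i=(\eta_i^2+\omega_i^{-2}\xi_i^2)^{1/2}$ and $$H(p)=\frac1{(2\pi)^N}\int_{(\mathbb{R}/2\pi\mathbb{Z})^N}\Big|\sum_{i=1}^N z_i\cos\varphi_i\Big|\,d\varphi_1\cdots d\varphi_N .$$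 $H$ is a norm; $\rho(x)=\max_{H(p)\le1}\langle x,p\rangle$ is the dual norm, with gradient $\frac{\partial\rho}{\partial x}$ and Hessian $\frac{\partial^2\rho}{\partial x^2}$ outside $0$. Every $x\ne0$ is written uniquely as $x=\rho\phi$ with $\rho=\rho(x)>0$ and $\rho(\phi)=1$. The function $\mathrm{sign}$ is multivalued with $\mathrm{sign}(0)=[-1,1]$, and the motion under the basic control is the motion defined by the differential inclusion $\dot x\in Ax+Bu(x)$. Let $$\sigma=\Big\{\phi\in\mathbb{R}^{2N}:\rho(\phi)=1,\ \Big\langle\frac{\partial\rho}{\partial x}(\phi),B\Big\rangle=0\Big\},\qquad f(\phi)=-\frac{\langle\frac{\partial^2\rho}{\partial x^2}(\phi)A\phi,B\rangle}{\langle\frac{\partial^2\rho}{\partial x^2}(\phi)B,B\rangle}.$$ The equation $\dot\phi=A\phi+Bf(\phi)$ defines a dynamical system on $\sigma$. "Attractor" means an $\omega$-limit set (of this system on $\sigma$, respectively of the controlled motion); nontrivial means different from the target $\{0\}$.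
   Formalization: The closed domain {ρ ≥ 1/μ} is replaced by the open domain {ρ > 1/μ}: for N=1, ω=1 one has μ=2/π, and (1,0), with ρ=π/2=1/μ, is an equilibrium with u=1 ∈ −sign(0), so the closed version is false. *)

theory Defs
  imports "HOL-Analysis.Analysis"
begin

text \<open>The phase space \<open>R\<^sup>2\<^sup>N\<close>, grouped by oscillators: component \<open>i\<close> is the pair
  \<open>(x\<^sub>i, y\<^sub>i)\<close>, or \<open>(\<xi>\<^sub>i, \<eta>\<^sub>i)\<close> for a covector. The inner product is the standard one.\<close>

type_synonym 'n state = "(real \<times> real)^'n"

definition osc_A :: "real^'n \<Rightarrow> 'n::finite state \<Rightarrow> 'n state" where
  "osc_A \<omega> x = (\<chi> i. (snd (x $ i), - (\<omega> $ i)\<^sup>2 * fst (x $ i)))"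

definition osc_B :: "'n::finite state" where
  "osc_B = (\<chi> i. (0, 1))"

definition amplitude :: "real^'n \<Rightarrow> 'n::finite state \<Rightarrow> 'n \<Rightarrow> real" where
  "amplitude \<omega> p i = sqrt ((snd (p $ i))\<^sup>2 + (fst (p $ i))\<^sup>2 / (\<omega> $ i)\<^sup>2)"

definition H_norm :: "real^'n \<Rightarrow> 'n::finite state \<Rightarrow> real" where
  "H_norm \<omega> p =
     1 / (2 * pi) ^ CARD('n) *
     integral (cbox 0 (\<chi> i. 2 * pi))
       (\<lambda>\<phi>::real^'n. \<bar>\<Sum>i\<in>UNIV. amplitude \<omega> p i * cos (\<phi> $ i)\<bar>)"

definition rho :: "real^'n \<Rightarrow> 'n::finite state \<Rightarrow> real" where
  "rho \<omega> x = (SUP p\<in>{p. H_norm \<omega> p \<le> 1}. x \<bullet> p)"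

definition grad :: "('a::real_inner \<Rightarrow> real) \<Rightarrow> 'a \<Rightarrow> 'a" where
  "grad g x = (THE D. GDERIV g x :> D)"

text \<open>The Hessian as the linear map \<open>v \<mapsto> (\<partial>\<^sup>2g/\<partial>x\<^sup>2) v\<close>.\<close>

definition hessian :: "('a::real_inner \<Rightarrow> real) \<Rightarrow> 'a \<Rightarrow> 'a \<Rightarrow> 'a" where
  "hessian g x = frechet_derivative (grad g) (at x)"

definition sigma :: "real^'n \<Rightarrow> 'n::finite state set" where
  "sigma \<omega> = {\<phi>. rho \<omega> \<phi> = 1 \<and> grad (rho \<omega>) \<phi> \<bullet> osc_B = 0}"

definition f_fun :: "real^'n \<Rightarrow> 'n::finite state \<Rightarrow> real" where
  "f_fun \<omega> \<phi> =
     - (hessian (rho \<omega>) \<phi> (osc_A \<omega> \<phi>) \<bullet> osc_B) / (hessian (rho \<omega>) \<phi> osc_B \<bullet> osc_B)"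

text \<open>Solutions on \<open>[0,\<infinity>)\<close> are understood in the Caratheodory sense, in integral form:
  \<open>g\<close> is locally absolutely continuous and \<open>g' = v\<close> almost everywhere. The control of
  a differential inclusion is only measurable in time, so classical solutions would not do; the
  same notion is used on \<^const>\<open>sigma\<close>, where it agrees with the classical one as long as
  \<^const>\<open>f_fun\<close> is continuous along the solution.\<close>

definition ac_solution :: "(real \<Rightarrow> 'a::euclidean_space) \<Rightarrow> (real \<Rightarrow> 'a) \<Rightarrow> bool" where
  "ac_solution g v \<longleftrightarrow>
     (\<forall>t\<ge>0. v absolutely_integrable_on {0..t} \<and> g t = g 0 + integral {0..t} v)"

definition omega_limit :: "(real \<Rightarrow> 'a::topological_space) \<Rightarrow> 'a set" where
  "omega_limit g =
     {y. \<exists>\<tau>::nat \<Rightarrow> real. filterlim \<tau> at_top sequentially \<and> (\<lambda>k. g (\<tau> k)) \<longlonglongrightarrow> y}"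

definition sigma_motion :: "real^'n \<Rightarrow> (real \<Rightarrow> 'n::finite state) \<Rightarrow> bool" where
  "sigma_motion \<omega> \<phi> \<longleftrightarrow>
     (\<forall>t\<ge>0. \<phi> t \<in> sigma \<omega>) \<and>
     ac_solution \<phi> (\<lambda>t. osc_A \<omega> (\<phi> t) + f_fun \<omega> (\<phi> t) *\<^sub>R osc_B)"

definition sigma_attractors :: "real^'n \<Rightarrow> 'n::finite state set set" where
  "sigma_attractors \<omega> = {omega_limit \<phi> |\<phi>. sigma_motion \<omega> \<phi>}"

text \<open>The minimum over the attractors of the maximum of \<open>|f|\<close>, taken in the extended reals,
  so that no value of the least upper bound or of \<open>inverse (mu \<omega>)\<close> is a junk value
  (in particular \<open>inverse 0 = \<infinity>\<close>).\<close>

definition mu :: "real^'n::finite \<Rightarrow> ereal" where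
  "mu \<omega> = (INF K\<in>sigma_attractors \<omega>. SUP \<phi>\<in>K. ereal \<bar>f_fun \<omega> \<phi>\<bar>)"

definition sign_set :: "real \<Rightarrow> real set" where
  "sign_set s = (if s = 0 then {-1..1} else {sgn s})"

text \<open>Values of \<open>u(x) = - sign \<langle>B, \<partial>\<rho>/\<partial>x\<rangle>\<close> for \<open>x \<noteq> 0\<close>.\<close>

definition basic_control :: "real^'n \<Rightarrow> 'n::finite state \<Rightarrow> real set" where
  "basic_control \<omega> x = uminus ` sign_set (osc_B \<bullet> grad (rho \<omega>) x)"

text \<open>The motion under the basic control in the coordinates \<open>x = r \<phi>\<close>, \<open>r > 0\<close>,
  \<open>\<rho>(\<phi>) = 1\<close>; the gradient of \<open>\<rho>\<close> is taken at the point \<open>x\<close>.\<close>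

definition polar_motion ::
  "real^'n \<Rightarrow> (real \<Rightarrow> real) \<Rightarrow> (real \<Rightarrow> 'n::finite state) \<Rightarrow> bool" where
  "polar_motion \<omega> r \<phi> \<longleftrightarrow>
     (\<forall>t\<ge>0. r t > 0 \<and> rho \<omega> (\<phi> t) = 1) \<and>
     (\<exists>u. (\<forall>t\<ge>0. u t \<in> basic_control \<omega> (r t *\<^sub>R \<phi> t)) \<and>
        ac_solution r (\<lambda>t. - \<bar>grad (rho \<omega>) (r t *\<^sub>R \<phi> t) \<bullet> osc_B\<bar>) \<and>
        ac_solution \<phi> (\<lambda>t. osc_A \<omega> (\<phi> t) +
          (1 / r t) *\<^sub>R (u t *\<^sub>R osc_B + \<bar>grad (rho \<omega>) (r t *\<^sub>R \<phi> t) \<bullet> osc_B\<bar> *\<^sub>R \<phi> t)))"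

text \<open>Limit sets are taken in the original phase space, where the target \<open>{0}\<close> lives, that
  is, for the curve \<open>x(t) = r(t) \<phi>(t)\<close>.\<close>

definition control_attractors :: "real^'n \<Rightarrow> 'n::finite state set set" where
  "control_attractors \<omega> = {omega_limit (\<lambda>t. r t *\<^sub>R \<phi> t) |r \<phi>. polar_motion \<omega> r \<phi>}"

definition minimal_attractor :: "real^'n \<Rightarrow> 'n::finite state set \<Rightarrow> bool" where
  "minimal_attractor \<omega> K \<longleftrightarrow>
     K \<in> control_attractors \<omega> \<and> (\<forall>K'\<in>control_attractors \<omega>. K' \<subseteq> K \<longrightarrow> K' = K)"

text \<open>The inequality is strict. On the boundary sphere \<open>\<rho> = 1/\<mu>\<close> an attractor on
  \<^const>\<open>sigma\<close> which realizes the minimum gives a motion with admissible control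
  \<open>u = f/\<mu>\<close>, \<open>|u| \<le> 1\<close>. For instance, for \<open>N = 1\<close> and \<open>\<omega> = 1\<close> one has
  \<open>\<rho>(x) = (\<pi>/2)|x|\<close>, \<open>\<mu> = 2/\<pi>\<close>, and the point \<open>(1, 0)\<close>, with
  \<open>\<rho> = \<pi>/2 = 1/\<mu>\<close>, is an equilibrium with \<open>u = 1 \<in> - sign(0)\<close>; so the closed
  domain \<open>\<rho> \<ge> 1/\<mu>\<close> is not attractor-free.\<close>

definition outer_domain :: "real^'n \<Rightarrow> 'n::finite state set" where
  "outer_domain \<omega> = {x. ereal (rho \<omega> x) > inverse (mu \<omega>)}"

end

theory Submission
  imports Defs "HOL-Probability.Probability" "HOL-Complex_Analysis.Great_Picard"
begin

text \<open>
  After a linear change of coordinates \<open>H\<close> becomes the average \<open>H0\<close> of \<open>|\<langle>a, E(\<theta>)\<rangle>|\<close> over the torus,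
  where \<open>E(\<theta>)\<close> has the components \<open>(cos \<theta>\<^sub>i, sin \<theta>\<^sub>i)\<close>. Its gradient \<open>Gam\<close> is the mean of
  \<open>sgn \<langle>a, E(\<theta>)\<rangle> E(\<theta>)\<close>; integrating out one phase replaces the sign by the function \<open>psi\<close>, smooth
  off \<open>\<plusminus>1\<close>, and \<open>Gam\<close> becomes injective on \<open>H0 = 1\<close>. Hence \<open>\<rho>\<close> has the continuous gradient
  \<open>phat\<close>, the inverse of \<open>Gam\<close>. The map \<open>phat\<close> is differentiable: either \<open>Psi\<close> is differentiable at
  the relevant point with positive definite derivative, or exactly one phase contributes there, the
  second variation is infinite in the other directions, and the derivative of the inverse vanishes
  in these directions. Where \<open>\<langle>\<partial>\<rho>/\<partial>x, B\<rangle> = 0\<close> the Hessian is positive on \<open>B\<close>, unless all positions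
  vanish.

  Along a controlled motion \<open>r\<close> decreases to a limit \<open>R\<close>. If \<open>R = 0\<close> the limit set is \<open>{0}\<close>. Otherwise
  the translates of \<open>\<phi>\<close> have a limit curve, on which \<open>\<langle>\<partial>\<rho>/\<partial>x, B\<rangle> = 0\<close> because the decrease of \<open>r\<close> is
  exhausted; so it lies in \<open>\<sigma>\<close>, and it solves the equation with some control bounded by \<open>1/R\<close>.
  Differentiating the constraint shows that this control is \<open>f\<close>. So \<open>|f| \<le> 1/R\<close> on an attractor in \<open>\<sigma>\<close>,
  that is \<open>\<mu> \<le> 1/R\<close>, while the limit set of the motion contains a point with \<open>\<rho> = R\<close>.
\<close>

section \<open>Independent uniform phases\<close>

text \<open>The obstacle is the smoothness of the dual norm. \<open>psi\<close> is an arcsine, so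
  its derivative blows up like the power -1/2 at the edges +1 and -1, and \<open>Psi\<close> need
  not be differentiable. If two components of the slope are nonzero, averaging over two phases makes
  the power -3/4 of the distance to the edges integrable, locally uniformly; as 3/4 = 3/2 * 1/2,
  this bounds difference quotients in L^(3/2), which justifies differentiation under the integral.
  If the slope has a single component, of length one (two equal amplitudes, all others zero), the
  second variation diverges logarithmically. The dual side is better there: infinite curvature of
  \<open>H0\<close> only makes the inverse map flat. So the inverse is differentiated at one point
  at a time, from continuity and a lower growth bound for \<open>Psi\<close>; continuity of the
  Hessian or of \<open>f_fun\<close> is never established. In the limit passage controls converge
  only through their primitives. Hence limit curves are driven by a Lipschitz function
  \<open>w\<close>, and f is recovered as its derivative except at times where all positions vanish,
  finitely many in each bounded interval.\<close>

definition unif :: "real measure" where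
  "unif = uniform_measure lborel {0..2*pi}"

definition torus :: "('n::finite \<Rightarrow> real) measure" where
  "torus = (\<Pi>\<^sub>M i\<in>UNIV. unif)"

lemma sets_unif [measurable_cong, simp]: "sets unif = sets borel"
  by (simp add: unif_def)

lemma space_unif [simp]: "space unif = UNIV"
  by (simp add: unif_def)

lemma prob_space_unif: "prob_space unif"
  unfolding unif_def by (rule prob_space_uniform_measure) auto

interpretation unif: prob_space unif
  by (rule prob_space_unif)

interpretation torus_factors: product_prob_space "\<lambda>_. unif" "UNIV :: 'n::finite set"
  by unfold_locales

lemma space_torus [simp]: "space torus = UNIV"
  by (simp add: torus_def space_PiM)

lemma sets_torus [measurable_cong]:
  "sets (torus :: ('n::finite \<Rightarrow> real) measure) = sets (\<Pi>\<^sub>M i\<in>UNIV. borel)"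
  unfolding torus_def by (rule sets_PiM_cong) auto

interpretation torus: prob_space torus
  unfolding torus_def by (rule prob_space_PiM) (rule prob_space_unif)

lemma nn_integral_unif:
  assumes "f \<in> borel_measurable borel"
  shows "(\<integral>\<^sup>+x. f x \<partial>unif) = (\<integral>\<^sup>+x. f x * indicator {0..2*pi} x \<partial>lborel) / ennreal (2*pi)"
  unfolding unif_def using assms by (subst nn_integral_uniform_measure) auto

lemma torus_component: "(\<lambda>\<theta>. \<theta> i) \<in> torus \<rightarrow>\<^sub>M borel"
  unfolding torus_def by (metis (no_types) UNIV_I measurable_component_singleton sets_unif measurable_cong_sets)

lemma measurable_resample [measurable]:
  "(\<lambda>(w, \<theta>). \<theta>(k := w) :: 'n::finite \<Rightarrow> real) \<in> unif \<Otimes>\<^sub>M torus \<rightarrow>\<^sub>M torus"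
  unfolding torus_def case_prod_beta' by (rule measurable_fun_upd[where J = UNIV]) auto

text \<open>The form of Fubini used throughout: drawing coordinate \<open>k\<close> afresh does not
  change the product law, as one checks on boxes. A phase can thus be integrated out while the index
  set stays \<open>UNIV\<close>.\<close>

lemma torus_resample:
  "distr (unif \<Otimes>\<^sub>M torus) torus (\<lambda>(w, \<theta>). \<theta>(k := w)) = (torus :: ('n::finite \<Rightarrow> real) measure)"
proof -
  have "distr (unif \<Otimes>\<^sub>M torus) torus (\<lambda>(w, \<theta>). \<theta>(k := w) :: 'n \<Rightarrow> real) = (\<Pi>\<^sub>M i\<in>UNIV. unif)"
  proof (rule torus_factors.PiM_eqI)
    show "finite (UNIV :: 'n set)" by simp
    show "sets (distr (unif \<Otimes>\<^sub>M torus) torus (\<lambda>(w, \<theta>). \<theta>(k := w) :: 'n \<Rightarrow> real)) = sets (\<Pi>\<^sub>M i\<in>UNIV. unif)"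
      by (simp add: torus_def)
  next
    fix A :: "'n \<Rightarrow> real set" assume A: "\<And>i. i \<in> UNIV \<Longrightarrow> A i \<in> sets unif"
    \<comment> \<open>Coordinate \<open>k\<close> of the old point is overwritten, so the preimage
      leaves it unconstrained.\<close>
    have "(\<lambda>(w, \<theta>). \<theta>(k := w)) -` (PiE UNIV A) \<inter> space (unif \<Otimes>\<^sub>M torus)
        = A k \<times> PiE UNIV (\<lambda>i. if i = k then UNIV else A i)" (is "?L = ?R")
      by (auto simp: space_pair_measure PiE_iff Ball_def split: if_splits)
    moreover have s: "PiE UNIV (\<lambda>i. if i = k then UNIV else A i) \<in> sets torus"
      unfolding torus_def using A by (intro sets_PiM_I_finite) auto
    moreover have s': "PiE UNIV A \<in> sets torus"
      unfolding torus_def using A by (intro sets_PiM_I_finite) auto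
    ultimately have "emeasure (distr (unif \<Otimes>\<^sub>M torus) torus (\<lambda>(w, \<theta>). \<theta>(k := w) :: 'n \<Rightarrow> real)) (PiE UNIV A)
       = emeasure (unif \<Otimes>\<^sub>M torus) (A k \<times> PiE UNIV (\<lambda>i. if i = k then UNIV else A i))"
      by (simp add: emeasure_distr[OF measurable_resample s'])
    also have "\<dots> = emeasure unif (A k) * emeasure torus (PiE UNIV (\<lambda>i. if i = k then UNIV else A i))"
      using A s by (intro torus.emeasure_pair_measure_Times) auto
    also have "emeasure torus (PiE UNIV (\<lambda>i. if i = k then UNIV else A i))
        = (\<Prod>i\<in>UNIV. emeasure unif (if i = k then UNIV else A i))"
      unfolding torus_def using A by (intro torus_factors.emeasure_PiM) auto
    also have "\<dots> = (\<Prod>i\<in>UNIV - {k}. emeasure unif (A i))"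
      using unif.emeasure_space_1 by (intro prod.mono_neutral_cong_right) auto
    also have "emeasure unif (A k) * \<dots> = (\<Prod>i\<in>UNIV. emeasure unif (A i))"
      by (simp add: prod.remove[of UNIV k])
    finally show "emeasure (distr (unif \<Otimes>\<^sub>M torus) torus (\<lambda>(w, \<theta>). \<theta>(k := w) :: 'n \<Rightarrow> real)) (PiE UNIV A)
        = (\<Prod>i\<in>UNIV. emeasure unif (A i))" .
  qed
  then show ?thesis by (simp add: torus_def)
qed

lemma nn_integral_resample:
  fixes F :: "('n::finite \<Rightarrow> real) \<Rightarrow> ennreal"
  assumes [measurable]: "F \<in> borel_measurable torus"
  shows "(\<integral>\<^sup>+\<theta>. F \<theta> \<partial>torus) = (\<integral>\<^sup>+\<theta>. (\<integral>\<^sup>+w. F (\<theta>(k := w)) \<partial>unif) \<partial>torus)"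
proof -
  interpret pair_sigma_finite unif "torus :: ('n \<Rightarrow> real) measure" ..
  have "(\<integral>\<^sup>+\<theta>. F \<theta> \<partial>torus) = (\<integral>\<^sup>+x. F ((\<lambda>(w, \<theta>). \<theta>(k := w)) x) \<partial>(unif \<Otimes>\<^sub>M torus))"
    by (subst torus_resample[of k, symmetric], subst nn_integral_distr) auto
  also have "\<dots> = (\<integral>\<^sup>+x. (\<lambda>(w, \<theta>). F (\<theta>(k := w))) x \<partial>(unif \<Otimes>\<^sub>M torus))"
    by (simp add: case_prod_beta')
  also have "\<dots> = (\<integral>\<^sup>+\<theta>. (\<integral>\<^sup>+w. F (\<theta>(k := w)) \<partial>unif) \<partial>torus)"
    by (subst nn_integral_snd[symmetric]) auto
  finally show ?thesis .
qed

lemma integral_resample: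
  fixes F :: "('n::finite \<Rightarrow> real) \<Rightarrow> 'b::{banach, second_countable_topology}"
  assumes F: "integrable torus F"
  shows "(\<integral>\<theta>. F \<theta> \<partial>torus) = (\<integral>\<theta>. (\<integral>w. F (\<theta>(k := w)) \<partial>unif) \<partial>torus)"
proof -
  interpret pair_sigma_finite unif "torus :: ('n \<Rightarrow> real) measure" ..
  have [measurable]: "F \<in> borel_measurable torus" using F by simp
  have "integrable (unif \<Otimes>\<^sub>M torus) (\<lambda>x. F ((\<lambda>(w, \<theta>). \<theta>(k := w)) x))"
    using F by (subst (asm) torus_resample[of k, symmetric], subst (asm) integrable_distr_eq) auto
  then have i: "integrable (unif \<Otimes>\<^sub>M torus) (\<lambda>(w, \<theta>). F (\<theta>(k := w)))"
    by (simp add: case_prod_beta')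
  have "(\<integral>\<theta>. F \<theta> \<partial>torus) = (\<integral>x. F ((\<lambda>(w, \<theta>). \<theta>(k := w)) x) \<partial>(unif \<Otimes>\<^sub>M torus))"
    by (subst torus_resample[of k, symmetric], subst integral_distr) auto
  also have "\<dots> = (\<integral>(w, \<theta>). F (\<theta>(k := w)) \<partial>(unif \<Otimes>\<^sub>M torus))"
    by (simp add: case_prod_beta')
  also have "\<dots> = (\<integral>\<theta>. (\<integral>w. F (\<theta>(k := w)) \<partial>unif) \<partial>torus)"
    using i by (subst integral_snd[symmetric]) auto
  finally show ?thesis .
qed

section \<open>Rotation invariance of a single phase\<close>

definition cs :: "real \<Rightarrow> real \<times> real" where
  "cs t = (cos t, sin t)"

definition rot90 :: "real \<times> real \<Rightarrow> real \<times> real" where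
  "rot90 u = (- snd u, fst u)"

lemma norm_cs [simp]: "norm (cs t) = 1"
  by (simp add: cs_def norm_prod_def)

lemma cs_measurable [measurable, simp]: "cs \<in> borel_measurable borel"
  unfolding cs_def by measurable

lemma cs_measurable_unif [measurable, simp]: "cs \<in> borel_measurable unif"
  by (simp add: measurable_cong_sets[OF sets_unif refl])

text \<open>The shift is reduced modulo the period to some \<beta> in [0, 2 pi); the part of the
  shifted window that sticks out beyond 2 pi is then moved back by one period.\<close>

lemma nn_integral_periodic_shift:
  fixes h :: "real \<Rightarrow> ennreal"
  assumes [measurable]: "h \<in> borel_measurable borel" and per: "\<And>t. h (t + 2*pi) = h t"
  shows "(\<integral>\<^sup>+t. h (t + \<alpha>) \<partial>unif) = (\<integral>\<^sup>+t. h t \<partial>unif)"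
proof -
  interpret periodic_fun_simple h "2*pi"
    by unfold_locales (rule per)
  define n where "n = \<lfloor>\<alpha> / (2*pi)\<rfloor>"
  define \<beta> where "\<beta> = \<alpha> - of_int n * (2*pi)"
  have "of_int n \<le> \<alpha> / (2*pi)" "\<alpha> / (2*pi) < of_int n + 1"
    unfolding n_def by linarith+
  then have \<beta>: "0 \<le> \<beta>" "\<beta> < 2*pi"
    unfolding \<beta>_def by (auto simp: field_simps)
  have h\<beta>: "h (t + \<alpha>) = h (t + \<beta>)" for t
    using plus_of_int[of "t + \<beta>" n] by (simp add: \<beta>_def algebra_simps)
  have shift: "(\<integral>\<^sup>+t. h (t + c) * indicator {0..2*pi} t \<partial>lborel) = (\<integral>\<^sup>+t. h t * indicator {c..c + 2*pi} t \<partial>lborel)" for c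
    using nn_integral_real_affine[of "\<lambda>t. h t * indicator {c..c + 2*pi} t" 1 c]
    by (simp add: add.commute) (auto intro!: nn_integral_cong split: split_indicator)
  have "(\<integral>\<^sup>+t. h t * indicator {\<beta>..\<beta> + 2*pi} t \<partial>lborel) =
      (\<integral>\<^sup>+t. h t * indicator {\<beta>..2*pi} t + h t * indicator {2*pi<..\<beta> + 2*pi} t \<partial>lborel)"
    using \<beta> by (intro nn_integral_cong) (auto split: split_indicator)
  also have "\<dots> = (\<integral>\<^sup>+t. h t * indicator {\<beta>..2*pi} t \<partial>lborel) + (\<integral>\<^sup>+t. h t * indicator {2*pi<..\<beta> + 2*pi} t \<partial>lborel)"
    by (rule nn_integral_add) auto
  also have "(\<integral>\<^sup>+t. h t * indicator {2*pi<..\<beta> + 2*pi} t \<partial>lborel) = (\<integral>\<^sup>+t. h t * indicator {0<..\<beta>} t \<partial>lborel)"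
    using nn_integral_real_affine[of "\<lambda>t. h t * indicator {2*pi<..\<beta> + 2*pi} t" 1 "2*pi"]
    by (simp add: add.commute per) (auto intro!: nn_integral_cong simp: per add.commute[of "2*pi"] split: split_indicator)
  also have "\<dots> = (\<integral>\<^sup>+t. h t * indicator {0..<\<beta>} t \<partial>lborel)"
    by (intro nn_integral_cong_AE AE_I[where N = "{0,\<beta>}"]) (auto simp: emeasure_lborel_countable split: split_indicator)
  also have "(\<integral>\<^sup>+t. h t * indicator {\<beta>..2*pi} t \<partial>lborel) + \<dots> =
      (\<integral>\<^sup>+t. h t * indicator {\<beta>..2*pi} t + h t * indicator {0..<\<beta>} t \<partial>lborel)"
    by (rule nn_integral_add[symmetric]) auto
  also have "\<dots> = (\<integral>\<^sup>+t. h t * indicator {0..2*pi} t \<partial>lborel)"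
    using \<beta> by (intro nn_integral_cong) (auto split: split_indicator)
  finally show ?thesis
    by (simp add: h\<beta> nn_integral_unif shift)
qed

lemma cs_add: "cs (t + \<alpha>) = cos t *\<^sub>R cs \<alpha> + sin t *\<^sub>R rot90 (cs \<alpha>)"
  by (simp add: cs_def rot90_def cos_add sin_add algebra_simps)

lemma unit_eq_cs: "norm u = 1 \<Longrightarrow> \<exists>\<alpha>. u = cs \<alpha> \<and> 0 \<le> \<alpha> \<and> \<alpha> < 2*pi"
proof -
  assume "norm u = 1"
  then have "(fst u)\<^sup>2 + (snd u)\<^sup>2 = 1" by (simp add: norm_prod_def)
  then obtain t where "fst u = cos t" "snd u = sin t" "0 \<le> t" "t < 2*pi" by (rule sincos_total_2pi)
  then show ?thesis by (metis cs_def prod.collapse)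
qed

text \<open>With \<open>u = cs \<alpha>\<close> the rotated vector is
  \<open>cs (t + \<alpha>)\<close>, and shifting the angle preserves means of periodic
  functions.\<close>

lemma distr_unif_rotate:
  assumes "norm u = 1"
  shows "distr unif borel (\<lambda>t. cos t *\<^sub>R u + sin t *\<^sub>R rot90 u) = distr unif borel cs"
proof -
  obtain \<alpha> where \<alpha>: "u = cs \<alpha>" using unit_eq_cs[OF assms] by auto
  have eq: "(\<lambda>t. cos t *\<^sub>R u + sin t *\<^sub>R rot90 u) = (\<lambda>t. cs (t + \<alpha>))"
    by (simp add: \<alpha> cs_add)
  show ?thesis unfolding eq
  proof (rule measure_eqI)
    fix A assume "A \<in> sets (distr unif borel (\<lambda>t. cs (t + \<alpha>)))"
    then have [measurable]: "A \<in> sets borel" by simp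
    have m: "(\<lambda>t. cs (t + \<alpha>)) \<in> borel_measurable unif" by measurable
    have "emeasure (distr unif borel (\<lambda>t. cs (t + \<alpha>))) A = (\<integral>\<^sup>+t. indicator A (cs (t + \<alpha>)) \<partial>unif)"
      using nn_integral_distr[OF m, of "indicator A"] by simp
    also have "\<dots> = (\<integral>\<^sup>+t. indicator A (cs t) \<partial>unif)"
      by (rule nn_integral_periodic_shift) (auto simp: cs_def)
    also have "\<dots> = emeasure (distr unif borel cs) A"
      using nn_integral_distr[OF cs_measurable_unif, of "indicator A"] by simp
    finally show "emeasure (distr unif borel (\<lambda>t. cs (t + \<alpha>))) A = emeasure (distr unif borel cs) A" .
  qed simp
qed

lemma nn_integral_rotate:
  assumes "norm u = 1" and [measurable]: "f \<in> borel_measurable borel"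
  shows "(\<integral>\<^sup>+t. f (cs t) \<partial>unif) = (\<integral>\<^sup>+t. f (cos t *\<^sub>R u + sin t *\<^sub>R rot90 u) \<partial>unif)"
proof -
  have "(\<integral>\<^sup>+t. f (cs t) \<partial>unif) = (\<integral>\<^sup>+x. f x \<partial>distr unif borel cs)"
    by (subst nn_integral_distr) auto
  also have "\<dots> = (\<integral>\<^sup>+t. f (cos t *\<^sub>R u + sin t *\<^sub>R rot90 u) \<partial>unif)"
    by (subst distr_unif_rotate[OF assms(1), symmetric], subst nn_integral_distr) auto
  finally show ?thesis .
qed

lemma integral_rotate:
  fixes f :: "real \<times> real \<Rightarrow> 'b::{banach, second_countable_topology}"
  assumes "norm u = 1" and [measurable]: "f \<in> borel_measurable borel"
  shows "(\<integral>t. f (cs t) \<partial>unif) = (\<integral>t. f (cos t *\<^sub>R u + sin t *\<^sub>R rot90 u) \<partial>unif)"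
proof -
  have "(\<integral>t. f (cs t) \<partial>unif) = (\<integral>x. f x \<partial>distr unif borel cs)"
    by (subst integral_distr) auto
  also have "\<dots> = (\<integral>t. f (cos t *\<^sub>R u + sin t *\<^sub>R rot90 u) \<partial>unif)"
    by (subst distr_unif_rotate[OF assms(1), symmetric], subst integral_distr) auto
  finally show ?thesis .
qed

section \<open>Averages of a sign over one phase\<close>

definition clip :: "real \<Rightarrow> real" where
  "clip s = max (-1) (min 1 s)"

text \<open>The mean of \<open>sgn (cos t + s)\<close> over a uniform phase, that is (2/pi) arcsin
  s, continued by constants beyond the edges +1 and -1.\<close>

definition psi :: "real \<Rightarrow> real" where
  "psi s = 1 - 2 / pi * arccos (clip s)"

text \<open>The value 0 at the two edges is a convention; \<open>AE_edge\<close> shows that they are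
  avoided almost surely.\<close>

definition dpsi :: "real \<Rightarrow> real" where
  "dpsi s = (if \<bar>s\<bar> < 1 then 2 / (pi * sqrt (1 - s\<^sup>2)) else 0)"

text \<open>The mean of \<open>sgn (cos t + s) * cos t\<close> over a uniform phase.\<close>

definition kap :: "real \<Rightarrow> real" where
  "kap s = 2 / pi * sqrt (1 - (clip s)\<^sup>2)"

lemma clip_range: "-1 \<le> clip s" "clip s \<le> 1"
  by (auto simp: clip_def)

lemma integral_unif:
  fixes f :: "real \<Rightarrow> real"
  assumes [measurable]: "f \<in> borel_measurable borel" and bd: "\<And>t. \<bar>f t\<bar> \<le> C"
  shows "(\<integral>t. f t \<partial>unif) = integral {0..2*pi} f / (2*pi)"
proof -
  have e: "unif = density lborel (\<lambda>x. ennreal (indicator {0..2*pi} x / (2*pi)))"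
    unfolding unif_def uniform_measure_def
    by (intro arg_cong2[where f = density] refl ext) (auto simp: divide_ennreal[symmetric] split: split_indicator)
  have "(\<integral>t. f t \<partial>unif) = (\<integral>t. (indicator {0..2*pi} t / (2*pi)) *\<^sub>R f t \<partial>lborel)"
    unfolding e by (subst integral_density) auto
  also have "\<dots> = (\<integral>t. (indicator {0..2*pi} t *\<^sub>R f t) / (2*pi) \<partial>lborel)"
    by simp
  also have "\<dots> = (\<integral>t. indicator {0..2*pi} t *\<^sub>R f t \<partial>lborel) / (2*pi)"
    by (rule integral_divide_zero)
  also have "set_integrable lborel {0..2*pi} f"
    unfolding set_integrable_def
    by (rule integrableI_bounded_set_indicator[where B = C]) (auto simp: bd)
  then have "(\<integral>t. indicator {0..2*pi} t *\<^sub>R f t \<partial>lborel) = integral {0..2*pi} f"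
    using set_borel_integral_eq_integral(2) unfolding set_lebesgue_integral_def by blast
  finally show ?thesis .
qed

text \<open>The sign changes at \<beta> and 2 pi - \<beta>, where the cosine equals
  \<open>- clip s\<close>; the fundamental theorem is applied on the three pieces, some of them
  degenerate if |s| is at least 1. One evaluation serves h = 1, cos and sin.\<close>

lemma integral_sgn_cos:
  fixes h :: "real \<Rightarrow> real" and Hh :: "real \<Rightarrow> real"
  assumes deriv: "\<And>t. (Hh has_real_derivative h t) (at t)" and h: "continuous_on UNIV h"
    and bd: "\<And>t. \<bar>h t\<bar> \<le> C" and \<beta>: "\<beta> = pi - arccos (clip s)"
  shows "(\<integral>t. sgn (cos t + s) * h t \<partial>unif)
    = (2 * Hh \<beta> - Hh 0 - 2 * Hh (2*pi - \<beta>) + Hh (2*pi)) / (2*pi)"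
proof -
  have \<beta>01: "0 \<le> \<beta>" "\<beta> \<le> pi" and cb: "cos \<beta> = - clip s"
    using arccos_bounded[OF clip_range] clip_range[of s] by (auto simp: \<beta> cos_arccos)
  have h_int: "(h has_integral Hh b - Hh a) {a..b}" if "a \<le> b" for a b
    using that deriv
    by (intro fundamental_theorem_of_calculus)
       (auto simp: has_real_derivative_iff_has_vector_derivative[symmetric] intro: has_field_derivative_at_within)
  have pos: "cos t + s > 0" if "0 < t" "t < \<beta>" for t
  proof -
    have "cos t > cos \<beta>" using that \<beta>01 by (intro cos_monotone_0_pi) auto
    \<comment> \<open>For s < -1 the interval (0, \<beta>) is empty, so a point in it excludes this
      case; for s > 1 positivity is trivial.\<close>
    moreover have "s \<ge> -1" "s \<le> 1 \<longrightarrow> s = clip s" 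
      using that \<beta>01 cb clip_range[of s] by (auto simp: clip_def \<beta> max_def min_def split: if_splits)
    ultimately show ?thesis using cb cos_ge_minus_one[of t] clip_range[of s] by (cases "s \<le> 1") auto
  qed
  have pos': "cos t + s > 0" if "2*pi - \<beta> < t" "t < 2*pi" for t
    using pos[of "2*pi - t"] that by (simp add: cos_diff)
  have neg0: "cos t + s < 0" if "\<beta> < t" "t \<le> pi" for t
  proof -
    have "cos t < cos \<beta>" using that \<beta>01 by (intro cos_monotone_0_pi) auto
    moreover have "s \<le> clip s"
      using that \<beta>01 by (auto simp: clip_def \<beta> max_def min_def split: if_splits)
    ultimately show ?thesis using cb by linarith
  qed
  have neg: "cos t + s < 0" if "\<beta> < t" "t < 2*pi - \<beta>" for t
    using neg0[of t] neg0[of "2*pi - t"] that by (cases "t \<le> pi") (auto simp: cos_diff)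
  let ?f = "\<lambda>t. sgn (cos t + s) * h t"
  have spike: "(?f has_integral y) {a..b}"
    if "(g has_integral y) {a..b}" "\<And>t. a < t \<Longrightarrow> t < b \<Longrightarrow> ?f t = g t" for a b y and g :: "real \<Rightarrow> real"
    using has_integral_spike_interior[of g y a b ?f] that by (simp add: greaterThanLessThan_def)
  have i1: "(?f has_integral Hh \<beta> - Hh 0) {0..\<beta>}"
    by (rule spike[OF h_int]) (use \<beta>01 pos in auto)
  have i2: "(?f has_integral -(Hh (2*pi - \<beta>) - Hh \<beta>)) {\<beta>..2*pi - \<beta>}"
    by (rule spike[OF has_integral_neg[OF h_int]]) (use \<beta>01 neg in auto)
  have i3: "(?f has_integral Hh (2*pi) - Hh (2*pi - \<beta>)) {2*pi - \<beta>..2*pi}"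
    by (rule spike[OF h_int]) (use \<beta>01 pos' in auto)
  have "(?f has_integral (Hh \<beta> - Hh 0) + -(Hh (2*pi - \<beta>) - Hh \<beta>)) {0..2*pi - \<beta>}"
    by (rule has_integral_combine[OF _ _ i1 i2]) (use \<beta>01 in auto)
  then have "(?f has_integral ((Hh \<beta> - Hh 0) + -(Hh (2*pi - \<beta>) - Hh \<beta>)) + (Hh (2*pi) - Hh (2*pi - \<beta>))) {0..2*pi}"
    by (rule has_integral_combine[OF _ _ _ i3, rotated 2]) (use \<beta>01 in auto)
  then have "integral {0..2*pi} ?f = 2 * Hh \<beta> - Hh 0 - 2 * Hh (2*pi - \<beta>) + Hh (2*pi)"
    by (simp add: integral_unique)
  moreover have "\<bar>?f t\<bar> \<le> C" for t
    using bd[of t] abs_ge_zero[of "h t"] by (auto simp: abs_mult sgn_if)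
  moreover have "?f \<in> borel_measurable borel"
    using borel_measurable_continuous_onI[OF h] by measurable
  ultimately show ?thesis by (subst integral_unif[of _ C]) auto
qed

lemma integral_sgn_psi: "(\<integral>t. sgn (cos t + s) \<partial>unif) = psi s"
  using integral_sgn_cos[of "\<lambda>t. t" "\<lambda>_. 1" 1 _ s, OF _ _ _ refl]
  by (simp add: psi_def field_simps)

lemma integral_sgn_kap: "(\<integral>t. sgn (cos t + s) * cos t \<partial>unif) = kap s"
proof -
  have "(\<integral>t. sgn (cos t + s) * cos t \<partial>unif) = 4 * sin (arccos (clip s)) / (2 * pi)"
    by (subst integral_sgn_cos[of sin cos 1 _ s, OF DERIV_sin _ _ refl])
       (auto simp: sin_diff intro: continuous_intros)
  then show ?thesis
    using clip_range[of s] by (simp add: kap_def sin_arccos)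
qed

lemma integral_sgn_sin: "(\<integral>t. sgn (cos t + s) * sin t \<partial>unif) = 0"
proof -
  have "((\<lambda>t. - cos t) has_real_derivative sin t) (at t)" for t :: real
    by (auto intro!: derivative_eq_intros)
  then show ?thesis
    by (subst integral_sgn_cos[of "\<lambda>t. - cos t" sin 1 _ s, OF _ _ _ refl])
       (auto simp: cos_diff intro: continuous_intros)
qed

lemma kap_nonneg: "0 \<le> kap s"
  using clip_range[of s] by (auto simp: kap_def abs_square_le_1)

lemma kap_pos: "\<bar>s\<bar> < 1 \<Longrightarrow> 0 < kap s"
  by (auto simp: kap_def clip_def abs_square_less_1)

lemma kap_le: "kap s \<le> 1"
proof -
  have "2 / pi \<le> 1" using pi_ge_two by simp
  moreover have "sqrt (1 - (clip s)\<^sup>2) \<le> 1" by simp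
  moreover have "0 \<le> sqrt (1 - (clip s)\<^sup>2)" using clip_range[of s] by (simp add: abs_square_le_1)
  ultimately show ?thesis unfolding kap_def by (intro mult_le_one) auto
qed

lemma psi_mono: "a \<le> b \<Longrightarrow> psi a \<le> psi b"
  unfolding psi_def by (auto simp: clip_def intro!: divide_right_mono mult_left_mono arccos_le_arccos)

lemma psi_bound: "\<bar>psi s\<bar> \<le> 1"
  using arccos_bounded[OF clip_range, of s] by (auto simp: psi_def abs_le_iff field_simps)

text \<open>One point in the open interval suffices, since clipping cannot identify it with the
  other one.\<close>

lemma psi_less: "a < b \<Longrightarrow> \<bar>a\<bar> < 1 \<or> \<bar>b\<bar> < 1 \<Longrightarrow> psi a < psi b"
  unfolding psi_def by (auto simp: clip_def intro!: divide_strict_right_mono mult_strict_left_mono arccos_less_arccos)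

lemma clip_continuous: "continuous_on UNIV clip"
  unfolding clip_def by (intro continuous_intros)

lemma psi_continuous: "continuous_on A psi"
  unfolding psi_def
  by (rule continuous_on_subset[of UNIV]) (auto intro!: continuous_intros clip_continuous clip_range)

lemma psi_measurable [measurable]: "psi \<in> borel_measurable borel"
  by (rule borel_measurable_continuous_onI[OF psi_continuous])

lemma dpsi_measurable [measurable]: "dpsi \<in> borel_measurable borel"
  unfolding dpsi_def by measurable

lemma kap_continuous: "continuous_on A kap"
  unfolding kap_def
  by (rule continuous_on_subset[of UNIV]) (auto intro!: continuous_intros clip_continuous)

lemma dpsi_nonneg: "0 \<le> dpsi s"
  by (auto simp: dpsi_def abs_square_le_1 intro!: divide_nonneg_nonneg mult_nonneg_nonneg)

lemma psi_deriv:
  assumes "\<bar>s\<bar> \<noteq> 1"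
  shows "(psi has_real_derivative dpsi s) (at s)"
proof (cases "\<bar>s\<bar> < 1")
  case True
  then have "((\<lambda>s. 1 - 2 / pi * arccos s) has_real_derivative dpsi s) (at s)"
    by (auto intro!: derivative_eq_intros simp: dpsi_def field_simps)
  then show ?thesis
    by (rule DERIV_cong_ev[THEN iffD1, rotated -1, OF _ refl _ refl])
       (use True in \<open>auto simp: psi_def clip_def eventually_nhds intro!: exI[of _ "{-1<..<1}"]\<close>)
next
  case False
  then have "s > 1 \<or> s < -1" using assms by auto
  then show ?thesis
  proof
    assume "s > 1"
    have "((\<lambda>s. 1) has_real_derivative dpsi s) (at s)" using False by (auto simp: dpsi_def)
    then show ?thesis
      by (rule DERIV_cong_ev[THEN iffD1, rotated -1, OF _ refl _ refl])
         (use \<open>s > 1\<close> in \<open>auto simp: psi_def clip_def eventually_nhds intro!: exI[of _ "{1<..}"]\<close>)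
  next
    assume "s < -1"
    have "((\<lambda>s. -1) has_real_derivative dpsi s) (at s)" using False by (auto simp: dpsi_def)
    then show ?thesis
      by (rule DERIV_cong_ev[THEN iffD1, rotated -1, OF _ refl _ refl])
         (use \<open>s < -1\<close> in \<open>auto simp: psi_def clip_def eventually_nhds intro!: exI[of _ "{..<-1}"]\<close>)
  qed
qed

text \<open>A weak Jordan inequality: by the double angle formula and the mean value theorem,
  \<open>sin x\<close> is x times two cosines, each at least cos(pi/4), so their product is at least
  1/2.\<close>

lemma sin_ge_half:
  fixes x :: real
  assumes "0 \<le> x" "x \<le> pi / 2"
  shows "x / 2 \<le> sin x"
proof (cases "x = 0")
  case False
  then have x: "0 < x / 2" using assms by simp
  have "\<exists>z>0. z < x / 2 \<and> sin (x/2) - sin 0 = (x/2 - 0) * cos z"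
    by (rule MVT2[OF x]) (auto intro: DERIV_sin)
  then obtain z where z: "0 < z" "z < x / 2" "sin (x/2) = x/2 * cos z" by auto
  have c: "cos (pi/4) \<le> cos t" if "0 \<le> t" "t \<le> pi/4" for t
    using that by (intro cos_monotone_0_pi_le) auto
  have "x / 2 = 2 * (x/2 * cos (pi/4)) * cos (pi/4)"
    by (simp add: cos_45)
  also have "\<dots> \<le> 2 * (x/2 * cos z) * cos (x/2)"
    using c[of z] c[of "x/2"] z assms x cos_gt_zero_pi[of "pi/4"] pi_gt_zero
    by (intro mult_mono mult_left_mono mult_nonneg_nonneg) auto
  also have "\<dots> = sin x" using sin_double[of "x/2"] z(3) by simp
  finally show ?thesis .
qed simp

text \<open>In the angles \<alpha>, \<beta>: \<open>cos \<beta> - cos \<alpha>\<close> is twice the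
  product of the sines of the half sum and the half difference. The half difference is controlled by
  \<open>sin_ge_half\<close>, and sin \<alpha> + sin \<beta> is at most twice the sine of the half
  sum.\<close>

lemma arccos_diff_le:
  assumes "-1 \<le> a" "a \<le> b" "b \<le> 1"
  shows "(arccos a - arccos b) * (sqrt (1 - a\<^sup>2) + sqrt (1 - b\<^sup>2)) \<le> 4 * (b - a)"
proof -
  define \<alpha> \<beta> where ab: "\<alpha> = arccos a" "\<beta> = arccos b"
  have r: "0 \<le> \<beta>" "\<beta> \<le> \<alpha>" "\<alpha> \<le> pi" "cos \<alpha> = a" "cos \<beta> = b"
    "sin \<alpha> = sqrt (1 - a\<^sup>2)" "sin \<beta> = sqrt (1 - b\<^sup>2)"
    using assms arccos_bounded[of a] arccos_bounded[of b] arccos_le_arccos[of a b]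
    by (auto simp: ab cos_arccos sin_arccos)
  have s2: "0 \<le> sin ((\<alpha> + \<beta>) / 2)" using r by (intro sin_ge_zero) auto
  have "sin \<alpha> + sin \<beta> = 2 * sin ((\<alpha> + \<beta>) / 2) * cos ((\<alpha> - \<beta>) / 2)"
    by (rule sin_plus_sin)
  also have "\<dots> \<le> 2 * sin ((\<alpha> + \<beta>) / 2)"
    using mult_left_mono[OF cos_le_one s2, of "(\<alpha> - \<beta>) / 2"] by simp
  finally have 1: "sin \<alpha> + sin \<beta> \<le> 2 * sin ((\<alpha> + \<beta>) / 2)" .
  have 2: "(\<alpha> - \<beta>) / 2 / 2 \<le> sin ((\<alpha> - \<beta>) / 2)"
    using r by (intro sin_ge_half) auto
  have "(\<alpha> - \<beta>) * (sin \<alpha> + sin \<beta>) \<le> (4 * sin ((\<alpha> - \<beta>) / 2)) * (2 * sin ((\<alpha> + \<beta>) / 2))"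
  proof (rule mult_mono)
    show "\<alpha> - \<beta> \<le> 4 * sin ((\<alpha> - \<beta>) / 2)" using 2 by simp
    then show "0 \<le> 4 * sin ((\<alpha> - \<beta>) / 2)" by (rule order_trans[rotated]) (use r(2) in simp)
    have "0 \<le> sin \<alpha>" "0 \<le> sin \<beta>" using r(1-3) by (auto intro: sin_ge_zero)
    then show "0 \<le> sin \<alpha> + sin \<beta>" by simp
  qed (rule 1)
  also have "\<dots> = 4 * (cos \<beta> - cos \<alpha>)"
    by (simp add: cos_diff_cos add.commute)
  finally have "(\<alpha> - \<beta>) * (sin \<alpha> + sin \<beta>) \<le> 4 * (cos \<beta> - cos \<alpha>)" .
  then show ?thesis by (simp only: r(4-7) ab[symmetric])
qed

text \<open>Dominates difference quotients of \<open>psi\<close> even when the two points lie on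
  different sides of an edge. With one point c inside, it is \<open>arccos_diff_le\<close> after
  clipping, because 1 - c^2 is at least 1 - |c|.\<close>

lemma psi_diff_le:
  assumes "\<bar>a\<bar> \<noteq> 1" "\<bar>b\<bar> \<noteq> 1"
  shows "\<bar>psi a - psi b\<bar> \<le> 4 * \<bar>a - b\<bar> * (1 / sqrt \<bar>1 - \<bar>a\<bar>\<bar> + 1 / sqrt \<bar>1 - \<bar>b\<bar>\<bar>)"
proof -
  have main: "\<bar>psi a - psi b\<bar> \<le> 4 * \<bar>a - b\<bar> * (1 / sqrt \<bar>1 - \<bar>a\<bar>\<bar> + 1 / sqrt \<bar>1 - \<bar>b\<bar>\<bar>)"
    if "a < b" "\<bar>a\<bar> \<noteq> 1" "\<bar>b\<bar> \<noteq> 1" for a b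
  proof -
    let ?r = "\<lambda>a. 1 / sqrt \<bar>1 - \<bar>a\<bar>\<bar>"
    define D where "D = arccos (clip a) - arccos (clip b)"
    have cl: "clip a \<le> clip b" "clip b - clip a \<le> b - a"
      using that by (auto simp: clip_def)
    have D0: "0 \<le> D" unfolding D_def using clip_range cl by (auto intro: arccos_le_arccos)
    have e: "\<bar>psi a - psi b\<bar> = 2 / pi * D"
      using D0 by (simp add: psi_def D_def abs_if field_simps)
    have pi2: "2 / pi \<le> 1" using pi_ge_two by simp
    have sq: "sqrt \<bar>1 - \<bar>c\<bar>\<bar> \<le> sqrt (1 - (clip c)\<^sup>2)" if "\<bar>c\<bar> < 1" for c
    proof -
      have "\<bar>c\<bar> * \<bar>c\<bar> \<le> \<bar>c\<bar> * 1" using that by (intro mult_left_mono) auto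
      then show ?thesis using that by (auto simp: clip_def power2_eq_square)
    qed
    have key: "D * sqrt \<bar>1 - \<bar>c\<bar>\<bar> \<le> 4 * (b - a)" if "\<bar>c\<bar> < 1" "c \<in> {a, b}" for c
    proof -
      have "D * sqrt \<bar>1 - \<bar>c\<bar>\<bar> \<le> D * (sqrt (1 - (clip a)\<^sup>2) + sqrt (1 - (clip b)\<^sup>2))"
      proof (rule mult_left_mono[OF _ D0])
        have "0 \<le> sqrt (1 - (clip d)\<^sup>2)" for d
          using clip_range[of d] by (simp add: abs_square_le_1)
        from this[of a] this[of b] show "sqrt \<bar>1 - \<bar>c\<bar>\<bar> \<le> sqrt (1 - (clip a)\<^sup>2) + sqrt (1 - (clip b)\<^sup>2)"
          using that(2) sq[OF that(1)] by (elim insertE emptyE; hypsubst) linarith+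
      qed
      also have "\<dots> \<le> 4 * (clip b - clip a)"
        unfolding D_def using clip_range cl by (intro arccos_diff_le) auto
      finally have "D * sqrt \<bar>1 - \<bar>c\<bar>\<bar> \<le> 4 * (clip b - clip a)" .
      then show ?thesis by (rule order_trans) (use cl in simp)
    qed
    have D_le: "D \<le> 4 * (b - a) * (?r a + ?r b)"
    proof (cases "\<bar>a\<bar> < 1 \<or> \<bar>b\<bar> < 1")
      case True
      then obtain c where c: "\<bar>c\<bar> < 1" "c \<in> {a, b}" by blast
      then have "D \<le> 4 * (b - a) * ?r c"
        using key[OF c] that by (simp add: pos_le_divide_eq)
      also have "\<dots> \<le> 4 * (b - a) * (?r a + ?r b)"
        using c that by (intro mult_left_mono) auto
      finally show ?thesis .
    next
      case False
      then have ab: "\<bar>a\<bar> > 1" "\<bar>b\<bar> > 1" using that by auto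
      show ?thesis
      \<comment> \<open>Both points are outside. On the same side \<open>clip\<close> agrees and D =
        0. On opposite sides b - a exceeds 1 and -1 - a, hence also the root of the latter, while D
        is at most pi < 4.\<close>
      proof (cases "a < -1 \<and> b > 1")
        case True
        have "D \<le> 4" unfolding D_def using arccos_bounded[OF clip_range, of a] arccos_bounded[OF clip_range, of b] pi_less_4 by linarith
        moreover have "1 \<le> (b - a) * ?r a"
        proof -
          have "(b - a) * 1 \<le> (b - a) * (b - a)" using True by (intro mult_left_mono) auto
          moreover have "- 1 - a \<le> (b - a) * 1" using True by simp
          ultimately have "- 1 - a \<le> (b - a)\<^sup>2" unfolding power2_eq_square by (rule order_trans[rotated])
          then have "sqrt (- 1 - a) \<le> sqrt ((b - a)\<^sup>2)" by (intro real_sqrt_le_mono)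
          then have "sqrt \<bar>1 - \<bar>a\<bar>\<bar> \<le> b - a" using True by simp
          then show ?thesis using True by (simp add: pos_le_divide_eq)
        qed
        moreover have "(b - a) * ?r a \<le> (b - a) * (?r a + ?r b)"
          using that by (intro mult_left_mono) auto
        ultimately show ?thesis by linarith
      next
        case nab: False
        then have "clip a = clip b" using ab that by (auto simp: clip_def)
        then have "D = 0" by (simp add: D_def)
        then show ?thesis using that by simp
      qed
    qed
    have "2 / pi * D \<le> D" using mult_right_mono[OF pi2 D0] by simp
    then show ?thesis using D_le e that by simp
  qed
  consider "a < b" | "b < a" | "a = b" by linarith
  then show ?thesis
  proof cases
    case 1 then show ?thesis using main assms by blast
  next
    case 2 then show ?thesis using main[of b a] assms by (simp add: abs_minus_commute add.commute)
  qed simp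
qed

lemma dpsi_le:
  assumes "\<bar>s\<bar> \<noteq> 1"
  shows "dpsi s \<le> 1 / sqrt \<bar>1 - \<bar>s\<bar>\<bar>"
proof (cases "\<bar>s\<bar> < 1")
  case True
  have "\<bar>s\<bar> * \<bar>s\<bar> \<le> \<bar>s\<bar> * 1" using True by (intro mult_left_mono) auto
  then have "sqrt (1 - \<bar>s\<bar>) \<le> sqrt (1 - s\<^sup>2)" by (simp add: power2_eq_square)
  moreover have "0 < sqrt (1 - \<bar>s\<bar>)" using True by simp
  moreover have "2 / pi \<le> 1" using pi_ge_two by simp
  ultimately have "2 / pi * (1 / sqrt (1 - s\<^sup>2)) \<le> 1 * (1 / sqrt (1 - \<bar>s\<bar>))"
    by (intro mult_mono divide_left_mono mult_pos_pos) auto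
  then show ?thesis using True by (simp add: dpsi_def)
qed (simp add: dpsi_def)

section \<open>Negative powers averaged over the phases\<close>

text \<open>At \<open>x = 0\<close> the junk value \<open>0\<close> of \<^const>\<open>powr\<close> is replaced by \<open>\<infinity>\<close>.\<close>

definition ip :: "real \<Rightarrow> real \<Rightarrow> ennreal" where
  "ip b x = (if x = 0 then \<infinity> else ennreal (\<bar>x\<bar> powr - b))"

lemma ip_measurable [measurable]: "ip b \<in> borel_measurable borel"
  unfolding ip_def by measurable

lemma ip_abs [simp]: "ip b \<bar>x\<bar> = ip b x"
  by (simp add: ip_def)

lemma ip_minus [simp]: "ip b (- x) = ip b x"
  by (simp add: ip_def)

lemma ip_antimono: "\<bar>y\<bar> \<le> \<bar>x\<bar> \<Longrightarrow> 0 \<le> b \<Longrightarrow> ip b x \<le> ip b y"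
  by (auto simp: ip_def intro!: ennreal_leI powr_mono2')

lemma ip_nonzero: "ip b x \<noteq> 0"
  by (auto simp: ip_def)

lemma ip_mult: "ip b (x * y) = ip b x * ip b y"
  using ip_nonzero[of b x] ip_nonzero[of b y]
  by (auto simp: ip_def abs_mult powr_mult ennreal_mult ennreal_top_mult ennreal_mult_top split: if_splits)

lemma ip_square: "ip b (x\<^sup>2) = ip (2 * b) x"
proof (cases "x = 0")
  case False
  then have "x\<^sup>2 = \<bar>x\<bar> powr 2" by simp
  then have "x\<^sup>2 powr - b = \<bar>x\<bar> powr - (2 * b)" by (simp only: powr_powr) simp
  then show ?thesis using False by (simp add: ip_def)
qed (simp add: ip_def)

lemma ip_sqrt: "0 \<le> x \<Longrightarrow> ip b (sqrt x) = ip (b / 2) x"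
  using ip_square[of "b / 2" "sqrt x"] by simp

lemma ip_finite: "x \<noteq> 0 \<Longrightarrow> ip b x < \<infinity>"
  by (simp add: ip_def)

text \<open>The sine of t/2 is at least a quarter of the distance of t to the nearer of 0 and 2 pi,
  and the exponent 3/4 is below 1.\<close>

lemma nn_integral_sin_half_finite: "(\<integral>\<^sup>+t. ip (3/4) (sin (t / 2)) \<partial>unif) < \<infinity>"
proof -
  have fin: "(\<integral>\<^sup>+t. ip (3/4) t * indicator {0..2*pi} t \<partial>lborel) < \<infinity>"
  proof -
    have "((\<lambda>x. x powr (-3/4)) has_integral ((2*pi) powr (-3/4 + 1) / (-3/4 + 1))) {0..2*pi}"
      by (rule has_integral_powr_from_0) auto
    then have "(\<integral>\<^sup>+t. ennreal (t powr (-3/4)) * indicator {0..2*pi} t \<partial>lborel) = ennreal ((2*pi) powr (-3/4 + 1) / (-3/4 + 1))"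
      by (intro nn_integral_has_integral_lebesgue') auto
    \<comment> \<open>At t = 0 \<open>ip\<close> is infinite and the real power is 0; a single point
      does not matter.\<close>
    moreover have "(\<integral>\<^sup>+t. ip (3/4) t * indicator {0..2*pi} t \<partial>lborel) = (\<integral>\<^sup>+t. ennreal (t powr (-3/4)) * indicator {0..2*pi} t \<partial>lborel)"
      by (intro nn_integral_cong_AE AE_I[where N = "{0}"]) (auto simp: ip_def split: split_indicator if_splits)
    ultimately show ?thesis by (simp add: ennreal_less_top)
  qed
  have fin': "(\<integral>\<^sup>+t. ip (3/4) (2*pi - t) * indicator {0..2*pi} t \<partial>lborel) < \<infinity>"
    using nn_integral_real_affine[of "\<lambda>t. ip (3/4) t * indicator {0..2*pi} t" "-1" "2*pi"] fin
    by (simp add: indicator_def conj_commute cong: conj_cong)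
  have le: "ip (3/4) (sin (t / 2)) * indicator {0..2*pi} t
      \<le> ip (3/4) (1/4) * (ip (3/4) t * indicator {0..2*pi} t + ip (3/4) (2*pi - t) * indicator {0..2*pi} t)" for t
  proof (cases "t \<in> {0..2*pi}")
    case t: True
    have "ip (3/4) (sin (t / 2)) \<le> ip (3/4) (1/4) * (ip (3/4) t + ip (3/4) (2*pi - t))"
    proof (cases "t \<le> pi")
      case True
      have "ip (3/4) (sin (t/2)) \<le> ip (3/4) (1/4 * t)"
        using sin_ge_half[of "t/2"] True t by (intro ip_antimono) auto
      then show ?thesis unfolding ip_mult distrib_left by (rule add_increasing2[OF zero_le])
    next
      case False
      have "sin (t/2) = sin (pi - t/2)" by simp
      then have "ip (3/4) (sin (t/2)) \<le> ip (3/4) (1/4 * (2*pi - t))"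
        using sin_ge_half[of "pi - t/2"] False t by (intro ip_antimono) (auto simp del: sin_pi_minus)
      then show ?thesis unfolding ip_mult distrib_left by (rule add_increasing[OF zero_le])
    qed
    then show ?thesis using t by simp
  qed simp
  have "(\<integral>\<^sup>+t. ip (3/4) (sin (t / 2)) * indicator {0..2*pi} t \<partial>lborel)
      \<le> (\<integral>\<^sup>+t. ip (3/4) (1/4) * (ip (3/4) t * indicator {0..2*pi} t + ip (3/4) (2*pi - t) * indicator {0..2*pi} t) \<partial>lborel)"
    by (intro nn_integral_mono le)
  also have "\<dots> = ip (3/4) (1/4) * ((\<integral>\<^sup>+t. ip (3/4) t * indicator {0..2*pi} t \<partial>lborel) + (\<integral>\<^sup>+t. ip (3/4) (2*pi - t) * indicator {0..2*pi} t \<partial>lborel))"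
    by (subst nn_integral_cmult, simp, subst nn_integral_add) auto
  also have "\<dots> < \<infinity>" using fin fin' ip_finite[of "1/4" "3/4"] by (simp add: ennreal_mult_less_top)
  finally show ?thesis
    by (subst nn_integral_unif) (auto simp: less_top[symmetric] ennreal_divide_eq_top_iff)
qed

definition sin_half_const :: ennreal where
  "sin_half_const = (\<integral>\<^sup>+t. ip (3/4) (sin (t / 2)) \<partial>unif)"

text \<open>The half-angle sine only changes sign after 2 pi, which \<open>ip\<close> does not
  see.\<close>

lemma nn_integral_sin_half_shift:
  "(\<integral>\<^sup>+t. ip (3/4) (sin ((t + \<alpha>) / 2)) \<partial>unif) = sin_half_const"
proof -
  have "ip (3/4) (sin ((t + 2*pi) / 2)) = ip (3/4) (sin (t / 2))" for t
  proof -
    have "sin ((t + 2*pi) / 2) = - sin (t / 2)"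
      using sin_periodic_pi[of "t/2"] by (simp add: add_divide_distrib)
    then show ?thesis by simp
  qed
  then show ?thesis
    unfolding sin_half_const_def by (intro nn_integral_periodic_shift) auto
qed

text \<open>The difference of cosines is 2AB up to sign, with A, B the absolute half-angle sines.
  Since 2AB is at least the square of min A B, half the exponent can be afforded uniformly in
  \<phi>. Since |sin \<phi>| is at most A + B, so at most 2 max A B, the full exponent costs a power
  of sin \<phi>.\<close>

lemma ip_cos_diff_cos:
  shows "ip (3/8) (cos t - cos \<phi>) \<le> ip (3/4) (sin ((t + \<phi>) / 2)) + ip (3/4) (sin ((t - \<phi>) / 2))" (is ?weak)
    and "ip (3/4) (cos t - cos \<phi>) \<le> ip (3/4) (sin \<phi>) * (ip (3/4) (sin ((t + \<phi>) / 2)) + ip (3/4) (sin ((t - \<phi>) / 2)))" (is ?strong)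
proof -
  define A B where AB: "A = \<bar>sin ((t + \<phi>) / 2)\<bar>" "B = \<bar>sin ((t - \<phi>) / 2)\<bar>"
  have "cos t - cos \<phi> = 2 * sin ((t + \<phi>) / 2) * sin ((\<phi> - t) / 2)"
    by (rule cos_diff_cos)
  moreover have "sin ((\<phi> - t) / 2) = - sin ((t - \<phi>) / 2)"
    using sin_minus[of "(t - \<phi>) / 2"] by (simp add: diff_divide_distrib)
  ultimately have e: "\<bar>cos t - cos \<phi>\<bar> = 2 * A * B" by (simp add: AB abs_mult)
  have n: "0 \<le> A" "0 \<le> B" by (auto simp: AB)
  have "sin \<phi> = sin ((t + \<phi>) / 2 - (t - \<phi>) / 2)" by (simp add: field_simps)
  also have "\<bar>\<dots>\<bar> \<le> A + B"
    unfolding sin_diff AB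
    using mult_left_mono[OF abs_cos_le_one, of "\<bar>sin ((t + \<phi>) / 2)\<bar>" "(t - \<phi>)/2"]
      mult_right_mono[OF abs_cos_le_one, of "\<bar>sin ((t - \<phi>) / 2)\<bar>" "(t + \<phi>)/2"]
    by (simp add: abs_mult[symmetric])
  finally have s: "\<bar>sin \<phi>\<bar> \<le> A + B" .
  have m: "(min A B)\<^sup>2 \<le> 2 * A * B" "\<bar>sin \<phi>\<bar> * min A B \<le> 2 * A * B"
  proof -
    have "min A B * min A B \<le> A * B" using n by (intro mult_mono) auto
    then show "(min A B)\<^sup>2 \<le> 2 * A * B" using mult_nonneg_nonneg[OF n] by (simp add: power2_eq_square)
    have "\<bar>sin \<phi>\<bar> * min A B \<le> (2 * max A B) * min A B"
      using s n by (intro mult_right_mono) auto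
    then show "\<bar>sin \<phi>\<bar> * min A B \<le> 2 * A * B" by (auto simp: min_def max_def mult_ac split: if_splits)
  qed
  have mi: "ip (3/4) (min A B) \<le> ip (3/4) (sin ((t + \<phi>) / 2)) + ip (3/4) (sin ((t - \<phi>) / 2))"
    by (auto simp: AB min_def)
  have "ip (3/8) (cos t - cos \<phi>) \<le> ip (3/8) ((min A B)\<^sup>2)"
    using m n by (intro ip_antimono) (auto simp: e)
  then show ?weak using mi by (simp add: ip_square)
  have "ip (3/4) (cos t - cos \<phi>) \<le> ip (3/4) (\<bar>sin \<phi>\<bar> * min A B)"
    using m n by (intro ip_antimono) (auto simp: e abs_mult)
  also have "\<dots> \<le> ip (3/4) (sin \<phi>) * (ip (3/4) (sin ((t + \<phi>) / 2)) + ip (3/4) (sin ((t - \<phi>) / 2)))"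
    unfolding ip_mult using mi by (auto intro: mult_left_mono)
  finally show ?strong .
qed

text \<open>Replacing s by \<open>clip s\<close> only brings it closer to cos t, so s may be taken
  to be a cosine. The bound is uniform in s.\<close>

lemma nn_integral_ip_weak: "(\<integral>\<^sup>+t. ip (3/8) (cos t - s) \<partial>unif) \<le> 2 * sin_half_const"
proof -
  define \<phi> where "\<phi> = arccos (clip s)"
  have c: "cos \<phi> = clip s" using clip_range[of s] by (simp add: \<phi>_def cos_arccos)
  have "ip (3/8) (cos t - s) \<le> ip (3/4) (sin ((t + \<phi>) / 2)) + ip (3/4) (sin ((t + - \<phi>) / 2))" for t
  proof -
    have "ip (3/8) (cos t - s) \<le> ip (3/8) (cos t - cos \<phi>)"
      using cos_le_one[of t] cos_ge_minus_one[of t]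
      by (intro ip_antimono) (unfold c clip_def, linarith+)
    then show ?thesis using ip_cos_diff_cos(1)[of t \<phi>] by simp
  qed
  then have "(\<integral>\<^sup>+t. ip (3/8) (cos t - s) \<partial>unif) \<le> (\<integral>\<^sup>+t. ip (3/4) (sin ((t + \<phi>) / 2)) + ip (3/4) (sin ((t + - \<phi>) / 2)) \<partial>unif)"
    by (intro nn_integral_mono)
  also have "\<dots> = sin_half_const + sin_half_const"
    by (subst nn_integral_add) (auto simp: nn_integral_sin_half_shift simp del: add_uminus_conv_diff)
  finally show ?thesis by (simp add: mult_2)
qed

text \<open>A single phase gives the full exponent 3/4 only at a price that is singular at the
  edges. The price has exponent 3/8, which \<open>nn_integral_ip_weak\<close> can absorb by a second
  phase.\<close>

lemma nn_integral_ip_strong: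
  "(\<integral>\<^sup>+t. ip (3/4) (cos t - s) \<partial>unif) \<le> ip (3/8) (1 - \<bar>s\<bar>) * (2 * sin_half_const)"
proof -
  obtain \<alpha> \<beta> where le: "\<And>t. ip (3/4) (cos t - s) \<le> ip (3/8) (1 - \<bar>s\<bar>) * (ip (3/4) (sin ((t + \<alpha>) / 2)) + ip (3/4) (sin ((t + \<beta>) / 2)))"
  proof (cases "\<bar>s\<bar> \<le> 1")
    case True
    define \<phi> where "\<phi> = arccos s"
    have c: "cos \<phi> = s" "sin \<phi> = sqrt (1 - s\<^sup>2)" using True by (auto simp: \<phi>_def cos_arccos sin_arccos)
    have "\<bar>s\<bar> * \<bar>s\<bar> \<le> \<bar>s\<bar> * 1" using True by (intro mult_left_mono) auto
    then have "1 - \<bar>s\<bar> \<le> 1 - s\<^sup>2" by (simp add: power2_eq_square)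
    then have "ip (3/4) (sin \<phi>) \<le> ip (3/4) (sqrt (1 - \<bar>s\<bar>))"
      using True unfolding c by (intro ip_antimono) auto
    also have "\<dots> = ip (3/8) (1 - \<bar>s\<bar>)" using True by (simp add: ip_sqrt)
    finally have "ip (3/4) (sin \<phi>) \<le> ip (3/8) (1 - \<bar>s\<bar>)" .
    then have "ip (3/4) (cos t - s) \<le> ip (3/8) (1 - \<bar>s\<bar>) * (ip (3/4) (sin ((t + \<phi>) / 2)) + ip (3/4) (sin ((t + - \<phi>) / 2)))" for t
      using order_trans[OF ip_cos_diff_cos(2)[of t \<phi>] mult_right_mono] by (simp add: c(1))
    then show ?thesis by (rule that)
  next
    case False
    \<comment> \<open>Moves the phase where cos t is closest to s to the origin of the shifted
      angle.\<close>
    define \<alpha> where "\<alpha> = (if s > 0 then 0 else - pi)"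
    have "ip (3/4) (cos t - s) \<le> ip (3/8) (1 - \<bar>s\<bar>) * (ip (3/4) (sin ((t + \<alpha>) / 2)) + ip (3/4) (sin ((t + \<alpha>) / 2)))" for t
    proof -
      define x where "x = \<bar>s\<bar> - 1"
      define y where "y = sin ((t + \<alpha>) / 2)"
      have x: "x > 0" using False by (simp add: x_def)
      have c2: "cos (t + \<alpha>) = 1 - 2 * y\<^sup>2"
      proof -
        have "2 * ((t + \<alpha>) / 2) = t + \<alpha>" by (simp add: field_simps)
        then show ?thesis using cos_double_sin[of "(t + \<alpha>) / 2"] by (simp only: y_def)
      qed
      have "\<bar>cos t - s\<bar> = x + (1 - cos (t + \<alpha>))"
      proof (cases "s > 0")
        case True
        then have "cos (t + \<alpha>) = cos t" "s > 1" using False by (auto simp: \<alpha>_def)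
        then show ?thesis using cos_le_one[of t] unfolding x_def by linarith
      next
        case ns: False
        then have "cos (t + \<alpha>) = - cos t" "s < -1" using False by (auto simp: \<alpha>_def cos_diff)
        then show ?thesis using cos_ge_minus_one[of t] unfolding x_def by linarith
      qed
      then have e: "\<bar>cos t - s\<bar> = x + 2 * y\<^sup>2" using c2 by simp
      \<comment> \<open>The inequality between the geometric and the arithmetic mean splits x + 2
        y^2 into a product: one factor depends on s alone, the other on the phase alone.\<close>
      have "0 \<le> (sqrt x - \<bar>y\<bar>)\<^sup>2" by simp
      then have "2 * (sqrt x * \<bar>y\<bar>) \<le> x + y\<^sup>2"
        using x by (simp add: power2_diff)
      moreover have "0 \<le> sqrt x * \<bar>y\<bar>" "0 \<le> y\<^sup>2" using x by auto
      ultimately have "sqrt x * \<bar>y\<bar> \<le> x + 2 * y\<^sup>2" by linarith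
      then have "ip (3/4) (cos t - s) \<le> ip (3/4) (sqrt x * \<bar>y\<bar>)"
        using x e by (intro ip_antimono) (auto simp: abs_mult)
      also have "\<dots> = ip (3/8) (1 - \<bar>s\<bar>) * ip (3/4) y"
        using x ip_minus[of "3/8" x] by (simp add: ip_mult ip_sqrt x_def)
      finally show ?thesis unfolding y_def by (rule order_trans) (auto intro!: mult_left_mono)
    qed
    then show ?thesis by (rule that)
  qed
  have "(\<integral>\<^sup>+t. ip (3/4) (cos t - s) \<partial>unif) \<le> (\<integral>\<^sup>+t. ip (3/8) (1 - \<bar>s\<bar>) * (ip (3/4) (sin ((t + \<alpha>) / 2)) + ip (3/4) (sin ((t + \<beta>) / 2))) \<partial>unif)"
    by (intro nn_integral_mono le)
  also have "\<dots> = ip (3/8) (1 - \<bar>s\<bar>) * (sin_half_const + sin_half_const)"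
    by (subst nn_integral_cmult, simp, subst nn_integral_add) (auto simp: nn_integral_sin_half_shift)
  finally show ?thesis by (simp add: mult_2)
qed

text \<open>By rotation invariance the direction of \<open>a\<close> is irrelevant, only its length
  matters.\<close>

lemma nn_integral_inner_cs:
  fixes a :: "real \<times> real"
  assumes [measurable]: "f \<in> borel_measurable borel"
  shows "(\<integral>\<^sup>+t. f (a \<bullet> cs t) \<partial>unif) = (\<integral>\<^sup>+t. f (norm a * cos t) \<partial>unif)"
proof -
  obtain u where u: "norm u = 1" "a = norm a *\<^sub>R u"
  proof (cases "a = 0")
    case True then show ?thesis using that[of "cs 0"] by simp
  next
    case False then show ?thesis using that[of "sgn a"] by (simp add: norm_sgn sgn_div_norm)
  qed
  have "u \<bullet> u = 1" using u by (simp add: dot_square_norm)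
  moreover have "u \<bullet> rot90 u = 0" by (cases u) (simp add: rot90_def)
  ultimately have e: "a \<bullet> (cos t *\<^sub>R u + sin t *\<^sub>R rot90 u) = norm a * cos t" for t
    by (subst u(2)) (simp add: inner_add_right)
  have "(\<integral>\<^sup>+t. f (a \<bullet> cs t) \<partial>unif) = (\<integral>\<^sup>+t. f (a \<bullet> (cos t *\<^sub>R u + sin t *\<^sub>R rot90 u)) \<partial>unif)"
    using nn_integral_rotate[OF u(1), of "\<lambda>w. f (a \<bullet> w)"] by simp
  then show ?thesis by (simp only: e)
qed

text \<open>Two independent phases suffice to make the density singularities at the edges integrable to
  a power above one half.\<close>

lemma nn_integral_ip_two:
  fixes a b :: "real \<times> real"
  assumes "a \<noteq> 0" "b \<noteq> 0"
  shows "(\<integral>\<^sup>+u. (\<integral>\<^sup>+t. ip (3/4) (a \<bullet> cs t + b \<bullet> cs u + c) \<partial>unif) \<partial>unif)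
    \<le> ip (3/4) (norm a) * ip (3/8) (norm b / norm a) * (8 * sin_half_const * sin_half_const)"
proof -
  define z where "z = norm a"
  define z' where "z' = norm b"
  have z: "z > 0" "z' > 0" using assms by (auto simp: z_def z'_def)
  let ?C = "2 * sin_half_const"
  \<comment> \<open>The strong one-phase bound; its price is split into one term for each edge, so
    that each is a power of an affine function of s and the weak bound applies to the second
    phase.\<close>
  have inner: "(\<integral>\<^sup>+t. ip (3/4) (a \<bullet> cs t + s) \<partial>unif)
      \<le> ip (3/4) z * ?C * (ip (3/8) ((s - z) / z) + ip (3/8) ((s + z) / z))" for s
  proof -
    have "(\<integral>\<^sup>+t. ip (3/4) (a \<bullet> cs t + s) \<partial>unif) = (\<integral>\<^sup>+t. ip (3/4) (z * cos t + s) \<partial>unif)"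
      using nn_integral_inner_cs[of "\<lambda>x. ip (3/4) (x + s)" a] by (simp add: z_def)
    also have "\<dots> = (\<integral>\<^sup>+t. ip (3/4) z * ip (3/4) (cos t - - s / z) \<partial>unif)"
      using z by (intro nn_integral_cong) (simp add: ip_mult[symmetric] right_diff_distrib distrib_left)
    also have "\<dots> = ip (3/4) z * (\<integral>\<^sup>+t. ip (3/4) (cos t - - s / z) \<partial>unif)"
      by (rule nn_integral_cmult) measurable
    also have "\<dots> \<le> ip (3/4) z * (ip (3/8) (1 - \<bar>- s / z\<bar>) * ?C)"
      by (intro mult_left_mono nn_integral_ip_strong) simp
    also have "ip (3/8) (1 - \<bar>- s / z\<bar>) \<le> ip (3/8) ((s - z) / z) + ip (3/8) ((s + z) / z)"
    proof (cases "s \<ge> 0")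
      case True
      then have "1 - \<bar>- s / z\<bar> = - ((s - z) / z)" using z by (simp add: field_simps)
      then show ?thesis by (simp only: ip_minus) simp
    next
      case False
      then have "1 - \<bar>- s / z\<bar> = (s + z) / z" using z by (simp add: field_simps)
      then show ?thesis by simp
    qed
    finally show ?thesis by (simp add: distrib_left mult_ac mult_left_mono mult_right_mono)
  qed
  have outer: "(\<integral>\<^sup>+u. ip (3/8) ((b \<bullet> cs u + d) / z) \<partial>unif) \<le> ip (3/8) (z' / z) * ?C" for d
  proof -
    have e: "(z' * cos u + d) / z = (z' / z) * (cos u - - d / z')" for u
      using z by (simp add: field_simps)
    have "(\<integral>\<^sup>+u. ip (3/8) ((b \<bullet> cs u + d) / z) \<partial>unif) = (\<integral>\<^sup>+u. ip (3/8) ((z' * cos u + d) / z) \<partial>unif)"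
      using nn_integral_inner_cs[of "\<lambda>x. ip (3/8) ((x + d) / z)" b] by (simp add: z'_def)
    also have "\<dots> = (\<integral>\<^sup>+u. ip (3/8) (z' / z) * ip (3/8) (cos u - - d / z') \<partial>unif)"
      by (simp only: e ip_mult)
    also have "\<dots> = ip (3/8) (z' / z) * (\<integral>\<^sup>+u. ip (3/8) (cos u - - d / z') \<partial>unif)"
      by (rule nn_integral_cmult) measurable
    also have "\<dots> \<le> ip (3/8) (z' / z) * ?C"
      by (intro mult_left_mono nn_integral_ip_weak) simp
    finally show ?thesis .
  qed
  have "(\<integral>\<^sup>+u. (\<integral>\<^sup>+t. ip (3/4) (a \<bullet> cs t + b \<bullet> cs u + c) \<partial>unif) \<partial>unif)
     \<le> (\<integral>\<^sup>+u. ip (3/4) z * ?C * (ip (3/8) ((b \<bullet> cs u + (c - z)) / z) + ip (3/8) ((b \<bullet> cs u + (c + z)) / z)) \<partial>unif)"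
    by (intro nn_integral_mono) (use inner[of "b \<bullet> cs _ + c"] in \<open>simp add: algebra_simps\<close>)
  also have "\<dots> = ip (3/4) z * ?C * ((\<integral>\<^sup>+u. ip (3/8) ((b \<bullet> cs u + (c - z)) / z) \<partial>unif) + (\<integral>\<^sup>+u. ip (3/8) ((b \<bullet> cs u + (c + z)) / z) \<partial>unif))"
    by (subst nn_integral_cmult, simp, subst nn_integral_add) auto
  also have "\<dots> \<le> ip (3/4) z * ?C * (ip (3/8) (z' / z) * ?C + ip (3/8) (z' / z) * ?C)"
    by (intro mult_left_mono add_mono outer) simp
  also have "\<dots> = ip (3/4) z * ip (3/8) (z' / z) * (8 * sin_half_const * sin_half_const)"
    by (simp add: mult_2[symmetric] mult_ac)
  finally show ?thesis by (simp add: z_def z'_def)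
qed

section \<open>The mean \<open>H0\<close> and its gradient\<close>

definition Et :: "('n::finite \<Rightarrow> real) \<Rightarrow> 'n state" where
  "Et \<theta> = (\<chi> i. cs (\<theta> i))"

definition del :: "'n::finite \<Rightarrow> 'n state \<Rightarrow> 'n state" where
  "del k a = (\<chi> i. if i = k then 0 else a $ i)"

lemma Et_measurable [measurable]: "Et \<in> borel_measurable (torus :: ('n::finite \<Rightarrow> real) measure)"
proof -
  have "(\<lambda>\<theta>. Et \<theta> \<bullet> b) \<in> borel_measurable torus" if b: "b \<in> Basis" for b :: "'n state"
  proof -
    obtain i u where b: "b = axis i u" "u \<in> Basis" using b by (auto simp: Basis_vec_def)
    have "(\<lambda>\<theta>. cs (\<theta> i) \<bullet> u) \<in> borel_measurable (torus :: ('n \<Rightarrow> real) measure)"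
      using measurable_compose[OF torus_component cs_measurable, of i] by measurable
    then show ?thesis by (simp add: b Et_def inner_axis)
  qed
  then show ?thesis by (subst borel_measurable_euclidean_space) auto
qed

lemma norm_Et: "norm (Et \<theta> :: 'n::finite state) \<le> CARD('n)"
proof -
  have "norm (Et \<theta> :: 'n state) \<le> (\<Sum>i\<in>UNIV. norm (Et \<theta> $ i))"
    unfolding norm_vec_def by (rule L2_set_le_sum) auto
  then show ?thesis by (simp add: Et_def)
qed

lemma abs_inner_Et: "\<bar>a \<bullet> Et \<theta>\<bar> \<le> CARD('n) * norm (a :: 'n::finite state)"
  using Cauchy_Schwarz_ineq2[of a "Et \<theta>"] mult_left_mono[OF norm_Et[of \<theta>], of "norm a"]
  by (simp add: mult.commute)

lemma inner_Et: "a \<bullet> Et \<theta> = (\<Sum>i\<in>UNIV. a $ i \<bullet> cs (\<theta> i))"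
  by (simp add: inner_vec_def Et_def)

lemma inner_Et_update: "a \<bullet> Et (\<theta>(k := w)) = a $ k \<bullet> cs w + del k a \<bullet> Et \<theta>"
proof -
  have "a \<bullet> Et (\<theta>(k := w)) = a $ k \<bullet> cs w + (\<Sum>i\<in>UNIV - {k}. a $ i \<bullet> cs ((\<theta>(k := w)) i))"
    unfolding inner_Et by (subst sum.remove[of _ k]) auto
  also have "(\<Sum>i\<in>UNIV - {k}. a $ i \<bullet> cs ((\<theta>(k := w)) i)) = (\<Sum>i\<in>UNIV - {k}. del k a $ i \<bullet> cs (\<theta> i))"
    by (intro sum.cong) (auto simp: del_def)
  also have "\<dots> = del k a \<bullet> Et \<theta>"
    unfolding inner_Et by (subst (2) sum.remove[of _ k]) (auto simp: del_def)
  finally show ?thesis .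
qed

lemma del_nth [simp]: "del k a $ i = (if i = k then 0 else a $ i)"
  by (simp add: del_def)

lemma del_id: "a $ k = 0 \<Longrightarrow> del k a = a"
  by (auto simp: vec_eq_iff)

lemma integrable_torus_bounded:
  fixes f :: "('n::finite \<Rightarrow> real) \<Rightarrow> 'b::{banach, second_countable_topology}"
  assumes "f \<in> borel_measurable torus" "\<And>\<theta>. norm (f \<theta>) \<le> C"
  shows "integrable torus f"
  using assms by (intro torus.integrable_const_bound[where B = C]) auto

definition H0 :: "'n::finite state \<Rightarrow> real" where
  "H0 a = (\<integral>\<theta>. \<bar>a \<bullet> Et \<theta>\<bar> \<partial>torus)"

definition Gam :: "'n::finite state \<Rightarrow> 'n state" where
  "Gam a = (\<integral>\<theta>. sgn (a \<bullet> Et \<theta>) *\<^sub>R Et \<theta> \<partial>torus)"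

text \<open>At \<open>slope k a\<close>, \<open>Psi\<close> gives the components of
  \<open>Gam a\<close> other than k, and \<open>Kap\<close> below gives the length of component k;
  see \<open>Gam_nth\<close>.\<close>

definition Psi :: "'n::finite state \<Rightarrow> 'n state" where
  "Psi s = (\<integral>\<theta>. psi (s \<bullet> Et \<theta>) *\<^sub>R Et \<theta> \<partial>torus)"

definition Kap :: "'n::finite state \<Rightarrow> real" where
  "Kap s = (\<integral>\<theta>. kap (s \<bullet> Et \<theta>) \<partial>torus)"

lemma kap_measurable [measurable]: "kap \<in> borel_measurable borel"
  by (rule borel_measurable_continuous_onI[OF kap_continuous])

lemma integrable_H0: "integrable torus (\<lambda>\<theta>. \<bar>a \<bullet> Et \<theta>\<bar>)"
  by (rule integrable_torus_bounded[where C = "CARD('a) * norm a"]) (auto simp: abs_inner_Et)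

lemma integrable_Gam: "integrable torus (\<lambda>\<theta>. sgn (a \<bullet> Et \<theta>) *\<^sub>R Et \<theta> :: 'n::finite state)"
  by (rule integrable_torus_bounded[where C = "CARD('n)"])
     (auto simp: norm_Et sgn_if)

lemma integrable_Psi: "integrable torus (\<lambda>\<theta>. psi (a \<bullet> Et \<theta>) *\<^sub>R Et \<theta> :: 'n::finite state)"
proof (rule integrable_torus_bounded[where C = "CARD('n)"])
  show "norm (psi (a \<bullet> Et \<theta>) *\<^sub>R Et \<theta>) \<le> CARD('n)" for \<theta> :: "'n \<Rightarrow> real"
    using mult_mono[OF psi_bound norm_Et[of \<theta>], of "a \<bullet> Et \<theta>"] by simp
qed measurable

lemma Gam_inner: "Gam a \<bullet> h = (\<integral>\<theta>. sgn (a \<bullet> Et \<theta>) * (h \<bullet> Et \<theta>) \<partial>torus)"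
  unfolding Gam_def by (subst integral_inner_left[OF integrable_Gam, symmetric]) (simp add: inner_commute)

lemma Psi_inner: "Psi a \<bullet> h = (\<integral>\<theta>. psi (a \<bullet> Et \<theta>) * (h \<bullet> Et \<theta>) \<partial>torus)"
  unfolding Psi_def by (subst integral_inner_left[OF integrable_Psi, symmetric]) (simp add: inner_commute)

lemma integrable_Gam_inner: "integrable torus (\<lambda>\<theta>. sgn (a \<bullet> Et \<theta>) * (h \<bullet> Et \<theta>))"
  using integrable_inner_left[OF integrable_Gam, of a h] by (simp add: inner_commute)

lemma integrable_Psi_inner: "integrable torus (\<lambda>\<theta>. psi (a \<bullet> Et \<theta>) * (h \<bullet> Et \<theta>))"
  using integrable_inner_left[OF integrable_Psi, of a h] by (simp add: inner_commute)

lemma sin_half_const_finite: "sin_half_const < \<infinity>"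
  unfolding sin_half_const_def by (rule nn_integral_sin_half_finite)

text \<open>\<open>ip\<close> is infinite exactly on the level set and has a finite
  integral.\<close>

lemma AE_cos_neq: "AE t in unif. cos t \<noteq> s"
proof -
  have "(\<integral>\<^sup>+t. ip (3/8) (cos t - s) \<partial>unif) \<noteq> \<infinity>"
    using nn_integral_ip_weak[of s] sin_half_const_finite
    by (auto simp: top_unique ennreal_mult_eq_top_iff)
  then have "AE t in unif. ip (3/8) (cos t - s) \<noteq> \<infinity>"
    by (intro nn_integral_PInf_AE) auto
  then show ?thesis by (auto simp: ip_def split: if_splits)
qed

text \<open>With all phases frozen except one whose component of \<open>a\<close> is nonzero, the
  level set reduces to that of a cosine.\<close>

lemma AE_inner_Et_neq:
  fixes a :: "'n::finite state"
  assumes "a \<noteq> 0"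
  shows "AE \<theta> in torus. a \<bullet> Et \<theta> \<noteq> c"
proof -
  obtain k where k: "a $ k \<noteq> 0" using assms by (auto simp: vec_eq_iff)
  have inner: "(\<integral>\<^sup>+w. indicator {c} (a $ k \<bullet> cs w + d) \<partial>unif) = 0" for d
  proof -
    have "(\<integral>\<^sup>+w. indicator {c} (a $ k \<bullet> cs w + d) \<partial>unif) = (\<integral>\<^sup>+w. indicator {c} (norm (a $ k) * cos w + d) \<partial>unif)"
      by (rule nn_integral_inner_cs[of "\<lambda>x. indicator {c} (x + d)"]) measurable
    also have "\<dots> = (\<integral>\<^sup>+w. 0 \<partial>unif)"
    proof (rule nn_integral_cong_AE)
      show "AE w in unif. indicator {c} (norm (a $ k) * cos w + d) = (0::ennreal)"
        using AE_cos_neq[of "(c - d) / norm (a $ k)"] by eventually_elim (use k in \<open>auto simp: field_simps\<close>)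
    qed
    finally show ?thesis by simp
  qed
  have "(\<integral>\<^sup>+\<theta>. indicator {c} (a \<bullet> Et \<theta>) \<partial>torus) = 0"
    by (subst nn_integral_resample[of _ k]) (auto simp: inner_Et_update inner)
  then have "AE \<theta> in torus. indicator {c} (a \<bullet> Et \<theta>) = (0::ennreal)"
    by (subst (asm) nn_integral_0_iff_AE) auto
  then show ?thesis by (auto simp: indicator_def)
qed

text \<open>A continuous choice of subgradients is the gradient: the subgradient inequalities at x
  and at q squeeze the error of linearization between 0 and (s q - s x) \<bullet> (q - x). Used for
  \<open>H0\<close> and, on the complement of the origin, for \<open>rho0\<close>.\<close>

lemma gderiv_of_subgradient:
  fixes f :: "'a::real_inner \<Rightarrow> real"
  assumes "open U" "x \<in> U"
    and sub: "\<And>p q. p \<in> U \<Longrightarrow> q \<in> U \<Longrightarrow> f p + s p \<bullet> (q - p) \<le> f q"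
    and cont: "isCont s x"
  shows "GDERIV f x :> s x"
  unfolding gderiv_def has_derivative_iff_norm
proof
  show "bounded_linear (\<lambda>h. h \<bullet> s x)" by (rule bounded_linear_inner_left)
  have lim: "((\<lambda>q. norm (s q - s x)) \<longlongrightarrow> 0) (at x)"
    using cont unfolding isCont_def by (simp add: tendsto_norm_zero_iff LIM_zero_iff)
  have "eventually (\<lambda>q. q \<in> U) (at x)"
    using assms(1,2) by (auto simp: eventually_at_topological)
  then have ev: "eventually (\<lambda>q. norm (norm (f q - f x - (q - x) \<bullet> s x) / norm (q - x)) \<le> norm (s q - s x)) (at x)"
  proof eventually_elim
    case (elim q)
    have "f x + s x \<bullet> (q - x) \<le> f q" "f q + s q \<bullet> (x - q) \<le> f x"
      using sub assms(2) elim by auto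
    then have "\<bar>f q - f x - (q - x) \<bullet> s x\<bar> \<le> (s q - s x) \<bullet> (q - x)"
      by (simp add: inner_diff_left inner_diff_right inner_commute)
    also have "\<dots> \<le> norm (s q - s x) * norm (q - x)" by (rule norm_cauchy_schwarz)
    finally show ?case by (cases "q = x") (auto simp: divide_le_eq)
  qed
  show "((\<lambda>y. norm (f y - f x - (y - x) \<bullet> s x) / norm (y - x)) \<longlongrightarrow> 0) (at x)"
    by (rule tendsto_0_le[OF lim, of _ 1]) (use ev in simp)
qed

text \<open>A sign times d is at most |d|, with equality for the sign of d itself; averaging gives
  \<open>Gam p \<bullet> q \<le> H0 q\<close>, an equality at q = p.\<close>

lemma H0_sub: "H0 p + Gam p \<bullet> (q - p) \<le> H0 (q :: 'n::finite state)"
proof -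
  have e: "H0 p = Gam p \<bullet> p"
    unfolding Gam_inner H0_def by (intro Bochner_Integration.integral_cong) (auto simp: sgn_if)
  have "Gam p \<bullet> q \<le> H0 q"
    unfolding Gam_inner H0_def
    by (intro integral_mono integrable_Gam_inner integrable_H0) (auto simp: sgn_if)
  then show ?thesis by (simp add: e inner_diff_right)
qed

text \<open>The sign jumps only on the null set where the inner product vanishes, so dominated
  convergence applies.\<close>

lemma Gam_continuous:
  fixes a :: "'n::finite state"
  assumes "a \<noteq> 0" shows "isCont Gam a"
  unfolding continuous_at_sequentially comp_def
proof safe
  fix x :: "nat \<Rightarrow> 'n state" assume x: "x \<longlonglongrightarrow> a"
  show "(\<lambda>n. Gam (x n)) \<longlonglongrightarrow> Gam a"
    unfolding Gam_def
  proof (rule integral_dominated_convergence[where w = "\<lambda>_. CARD('n)"])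
    show "AE \<theta> in torus. (\<lambda>n. sgn (x n \<bullet> Et \<theta>) *\<^sub>R Et \<theta>) \<longlonglongrightarrow> sgn (a \<bullet> Et \<theta>) *\<^sub>R Et \<theta>"
      using AE_inner_Et_neq[OF assms, of 0]
      by eventually_elim (intro tendsto_intros x; simp)
    show "AE \<theta> in torus. norm (sgn (x n \<bullet> Et \<theta>) *\<^sub>R Et \<theta>) \<le> real CARD('n)" for n
      by (auto simp: norm_Et sgn_if)
  qed auto
qed

lemma GDERIV_H0: "a \<noteq> 0 \<Longrightarrow> GDERIV H0 a :> Gam a"
  by (rule gderiv_of_subgradient[of UNIV]) (auto simp: H0_sub Gam_continuous)

text \<open>The means of cos and sin are read off at s = 2, where the sign is constantly 1 and
  \<open>kap\<close> is 0.\<close>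

lemma integral_cs_zero: "(\<integral>w. v \<bullet> cs w \<partial>unif) = 0"
proof -
  have c: "(\<integral>t. cos t \<partial>unif) = 0"
  proof -
    have "cos t + 2 > 0" for t :: real using cos_ge_minus_one[of t] by linarith
    then have "sgn (cos t + 2) = 1" for t :: real by (rule sgn_pos)
    then show ?thesis using integral_sgn_kap[of 2] by (simp add: kap_def clip_def)
  qed
  have s: "(\<integral>t. sin t \<partial>unif) = 0"
  proof -
    have "cos t + 2 > 0" for t :: real using cos_ge_minus_one[of t] by linarith
    then have "sgn (cos t + 2) = 1" for t :: real by (rule sgn_pos)
    then show ?thesis using integral_sgn_sin[of 2] by simp
  qed
  have i: "integrable unif cos" "integrable unif sin"
    by (auto intro!: unif.integrable_const_bound[where B = 1])
  have "(\<integral>w. v \<bullet> cs w \<partial>unif) = (\<integral>w. fst v * cos w + snd v * sin w \<partial>unif)"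
    by (cases v) (simp add: cs_def)
  also have "\<dots> = 0" using i c s by simp
  finally show ?thesis .
qed

text \<open>Phase k then enters only through a linear factor of mean zero.\<close>

lemma Psi_nth_zero:
  assumes "s $ k = 0" shows "Psi s $ k = 0"
proof -
  have "Psi s \<bullet> axis k v = 0" for v
  proof -
    have ax: "axis k v $ k = v" "del k (axis k v) = 0"
      by (auto simp: axis_def del_def vec_eq_iff)
    have "Psi s \<bullet> axis k v = (\<integral>\<theta>. (\<integral>w. psi (s \<bullet> Et \<theta>) * (v \<bullet> cs w) \<partial>unif) \<partial>torus)"
      unfolding Psi_inner
      by (subst integral_resample[OF integrable_Psi_inner, where k = k])
         (simp add: inner_Et_update assms del_id[OF assms] ax)
    then show ?thesis by (simp add: integral_cs_zero)
  qed
  from this[of "Psi s $ k"] show ?thesis by (simp add: inner_axis)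
qed

text \<open>The phase is rotated so that \<open>a\<close> points along the first axis; the part of
  \<open>v\<close> orthogonal to \<open>a\<close> then meets a sine and averages out.\<close>

lemma integral_inner_sgn:
  fixes a v :: "real \<times> real"
  assumes "a \<noteq> 0"
  shows "(\<integral>w. sgn (a \<bullet> cs w + s) \<partial>unif) = psi (s / norm a)"
    and "(\<integral>w. sgn (a \<bullet> cs w + s) * (v \<bullet> cs w) \<partial>unif) = (v \<bullet> sgn a) * kap (s / norm a)"
proof -
  define u where "u = sgn a"
  have u: "norm u = 1" "a = norm a *\<^sub>R u" using assms by (auto simp: u_def norm_sgn sgn_div_norm)
  have "u \<bullet> u = 1" using u by (simp add: dot_square_norm)
  moreover have "u \<bullet> rot90 u = 0" by (cases u) (simp add: rot90_def)
  ultimately have e: "a \<bullet> (cos t *\<^sub>R u + sin t *\<^sub>R rot90 u) = norm a * cos t" for t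
    by (subst u(2)) (simp add: inner_add_right)
  have sg: "sgn (norm a * cos t + s) = sgn (cos t + s / norm a)" for t
  proof -
    have "norm a * cos t + s = norm a * (cos t + s / norm a)" using assms by (simp add: distrib_left)
    then show ?thesis using assms by (simp add: sgn_mult)
  qed
  have "(\<integral>w. sgn (a \<bullet> cs w + s) \<partial>unif) = (\<integral>t. sgn (a \<bullet> (cos t *\<^sub>R u + sin t *\<^sub>R rot90 u) + s) \<partial>unif)"
    by (rule integral_rotate[OF u(1), of "\<lambda>w. sgn (a \<bullet> w + s)"]) measurable
  then show "(\<integral>w. sgn (a \<bullet> cs w + s) \<partial>unif) = psi (s / norm a)"
    by (simp add: e sg integral_sgn_psi)
  let ?s = "\<lambda>t. sgn (cos t + s / norm a)"
  have "(\<integral>w. sgn (a \<bullet> cs w + s) * (v \<bullet> cs w) \<partial>unif)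
      = (\<integral>t. sgn (a \<bullet> (cos t *\<^sub>R u + sin t *\<^sub>R rot90 u) + s) * (v \<bullet> (cos t *\<^sub>R u + sin t *\<^sub>R rot90 u)) \<partial>unif)"
    by (rule integral_rotate[OF u(1), of "\<lambda>w. sgn (a \<bullet> w + s) * (v \<bullet> w)"]) measurable
  also have "\<dots> = (\<integral>t. (v \<bullet> u) * (?s t * cos t) + (v \<bullet> rot90 u) * (?s t * sin t) \<partial>unif)"
    unfolding e sg by (intro Bochner_Integration.integral_cong) (auto simp: inner_add_right algebra_simps)
  also have "\<dots> = (v \<bullet> u) * (\<integral>t. ?s t * cos t \<partial>unif) + (v \<bullet> rot90 u) * (\<integral>t. ?s t * sin t \<partial>unif)"
  proof -
    have "integrable unif (\<lambda>t. ?s t * cos t)" "integrable unif (\<lambda>t. ?s t * sin t)"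
      by (auto intro!: unif.integrable_const_bound[where B = 1] simp: sgn_if)
    then show ?thesis by simp
  qed
  finally show "(\<integral>w. sgn (a \<bullet> cs w + s) * (v \<bullet> cs w) \<partial>unif) = (v \<bullet> sgn a) * kap (s / norm a)"
    by (simp add: integral_sgn_kap integral_sgn_sin u_def)
qed

text \<open>By homogeneity, \<open>a\<close> with \<open>a $ k \<noteq> 0\<close> is determined up to scaling by \<open>slope k a\<close> and the direction of
  \<open>a $ k\<close>; integrating out the phase \<open>k\<close> expresses the gradient through \<open>slope k a\<close>.\<close>

definition slope :: "'n::finite \<Rightarrow> 'n state \<Rightarrow> 'n state" where
  "slope k a = (1 / norm (a $ k)) *\<^sub>R del k a"

lemma Gam_reduce:
  fixes a :: "'n::finite state"
  assumes "a $ k \<noteq> 0"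
  shows "Gam a \<bullet> h = Psi (slope k a) \<bullet> h + (h $ k \<bullet> sgn (a $ k)) * Kap (slope k a)"
proof -
  let ?s = "slope k a"
  have inner: "(\<integral>w. sgn (a \<bullet> Et (\<theta>(k := w))) * (h \<bullet> Et (\<theta>(k := w))) \<partial>unif)
      = (h $ k \<bullet> sgn (a $ k)) * kap (?s \<bullet> Et \<theta>) + psi (?s \<bullet> Et \<theta>) * (del k h \<bullet> Et \<theta>)" for \<theta> :: "'n \<Rightarrow> real"
  proof -
    let ?d = "del k a \<bullet> Et \<theta>"
    have "(\<integral>w. sgn (a \<bullet> Et (\<theta>(k := w))) * (h \<bullet> Et (\<theta>(k := w))) \<partial>unif)
      = (\<integral>w. sgn (a $ k \<bullet> cs w + ?d) * (h $ k \<bullet> cs w) + sgn (a $ k \<bullet> cs w + ?d) * (del k h \<bullet> Et \<theta>) \<partial>unif)"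
      by (simp add: inner_Et_update distrib_left)
    also have "\<dots> = (\<integral>w. sgn (a $ k \<bullet> cs w + ?d) * (h $ k \<bullet> cs w) \<partial>unif) + (\<integral>w. sgn (a $ k \<bullet> cs w + ?d) * (del k h \<bullet> Et \<theta>) \<partial>unif)"
    proof (rule Bochner_Integration.integral_add)
      show "integrable unif (\<lambda>w. sgn (a $ k \<bullet> cs w + ?d) * (h $ k \<bullet> cs w))"
      proof (rule unif.integrable_const_bound[where B = "norm (h $ k)"])
        show "AE w in unif. norm (sgn (a $ k \<bullet> cs w + ?d) * (h $ k \<bullet> cs w)) \<le> norm (h $ k)"
          using Cauchy_Schwarz_ineq2[of "h $ k" "cs _"] by (auto simp: abs_mult sgn_if)
      qed measurable
      show "integrable unif (\<lambda>w. sgn (a $ k \<bullet> cs w + ?d) * (del k h \<bullet> Et \<theta>))"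
        by (rule unif.integrable_const_bound[where B = "\<bar>del k h \<bullet> Et \<theta>\<bar>"]) (auto simp: abs_mult sgn_if)
    qed
    also have "\<dots> = (h $ k \<bullet> sgn (a $ k)) * kap (?d / norm (a $ k)) + psi (?d / norm (a $ k)) * (del k h \<bullet> Et \<theta>)"
      using integral_inner_sgn[OF assms] by simp
    finally show ?thesis by (simp add: slope_def)
  qed
  have i1: "integrable torus (\<lambda>\<theta>. kap (?s \<bullet> Et \<theta>))"
    by (rule integrable_torus_bounded[where C = 1]) (auto simp: kap_nonneg kap_le)
  have "Gam a \<bullet> h = (\<integral>\<theta>. (h $ k \<bullet> sgn (a $ k)) * kap (?s \<bullet> Et \<theta>) + psi (?s \<bullet> Et \<theta>) * (del k h \<bullet> Et \<theta>) \<partial>torus)"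
    unfolding Gam_inner by (subst integral_resample[OF integrable_Gam_inner, where k = k]) (simp add: inner)
  also have "\<dots> = (h $ k \<bullet> sgn (a $ k)) * Kap ?s + Psi ?s \<bullet> del k h"
    unfolding Kap_def Psi_inner using i1 integrable_Psi_inner[of ?s "del k h"] by simp
  also have "Psi ?s \<bullet> del k h = Psi ?s \<bullet> h"
    using Psi_nth_zero[of ?s k] by (auto simp: inner_vec_def slope_def intro!: sum.cong)
  finally show ?thesis by simp
qed

text \<open>Shows that \<open>Psi\<close> is monotone, the integrand being nonnegative by
  \<open>psi_mono_product\<close>. Both injectivity and the growth estimates come from here.\<close>

lemma Psi_mono_eq:
  "(Psi s - Psi t) \<bullet> (s - t) = (\<integral>\<theta>. (psi (s \<bullet> Et \<theta>) - psi (t \<bullet> Et \<theta>)) * ((s - t) \<bullet> Et \<theta>) \<partial>torus)"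
proof -
  have "(\<integral>\<theta>. (psi (s \<bullet> Et \<theta>) - psi (t \<bullet> Et \<theta>)) * ((s - t) \<bullet> Et \<theta>) \<partial>torus)
     = (\<integral>\<theta>. psi (s \<bullet> Et \<theta>) * ((s - t) \<bullet> Et \<theta>) - psi (t \<bullet> Et \<theta>) * ((s - t) \<bullet> Et \<theta>) \<partial>torus)"
    by (simp add: left_diff_distrib)
  also have "\<dots> = Psi s \<bullet> (s - t) - Psi t \<bullet> (s - t)"
    unfolding Psi_inner using integrable_Psi_inner[of s "s - t"] integrable_Psi_inner[of t "s - t"] by simp
  finally show ?thesis by (simp add: inner_diff_left)
qed

lemma psi_mono_product: "0 \<le> (psi (s \<bullet> e) - psi (t \<bullet> e)) * ((s - t) \<bullet> e)"
  using psi_mono[of "s \<bullet> e" "t \<bullet> e"] psi_mono[of "t \<bullet> e" "s \<bullet> e"]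
  by (cases "s \<bullet> e \<le> t \<bullet> e") (auto simp: inner_diff_left zero_le_mult_iff)

section \<open>The derivative of \<open>Psi\<close>\<close>

text \<open>The quadratic form of the formal derivative of \<open>Psi\<close>. It is extended-valued
  because it may be infinite; see \<open>Phi_infinite\<close>.\<close>

definition Phi :: "'n::finite state \<Rightarrow> 'n state \<Rightarrow> ennreal" where
  "Phi s h = (\<integral>\<^sup>+\<theta>. ennreal (dpsi (s \<bullet> Et \<theta>) * (h \<bullet> Et \<theta>)\<^sup>2) \<partial>torus)"

lemma AE_edge: "AE \<theta> in torus. \<bar>s \<bullet> Et \<theta>\<bar> \<noteq> 1"
proof (cases "s = 0")
  case False
  show ?thesis using AE_inner_Et_neq[OF False, of 1] AE_inner_Et_neq[OF False, of "-1"]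
    by eventually_elim (auto simp: abs_if)
qed simp

text \<open>The Caratheodory form of the derivative avoids dividing by \<open>x n - s\<close>, which
  may vanish.\<close>

lemma psi_quotient_limit:
  assumes S: "\<bar>s\<bar> \<noteq> 1" and "x \<longlonglongrightarrow> s" and "\<And>n. t n \<noteq> 0" and "(\<lambda>n. (x n - s) / t n) \<longlonglongrightarrow> b"
  shows "(\<lambda>n. (psi (x n) - psi s) / t n) \<longlonglongrightarrow> dpsi s * b"
proof -
  obtain g where g: "\<And>z. psi z - psi s = g z * (z - s)" "isCont g s" "g s = dpsi s"
    using psi_deriv[OF S] unfolding CARAT_DERIV by blast
  have "(\<lambda>n. g (x n) * ((x n - s) / t n)) \<longlonglongrightarrow> g s * b"
    using isCont_tendsto_compose[OF g(2) assms(2)] assms(4) by (intro tendsto_mult)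
  then show ?thesis using g by simp
qed

text \<open>Fatou's lemma needs no domination, so this lower bound for the growth of
  \<open>Psi\<close> is available even where \<open>Psi\<close> is not differentiable.\<close>

lemma Phi_fatou:
  fixes s h :: "'n::finite state"
  assumes x: "x \<longlonglongrightarrow> s" and t: "\<And>n. 0 < t n" and h: "(\<lambda>n. (1 / t n) *\<^sub>R (x n - s)) \<longlonglongrightarrow> h"
  shows "Phi s h \<le> liminf (\<lambda>n. ennreal ((Psi (x n) - Psi s) \<bullet> (x n - s) / (t n)\<^sup>2))"
proof -
  let ?q = "\<lambda>n \<theta>. (psi (x n \<bullet> Et \<theta>) - psi (s \<bullet> Et \<theta>)) * ((x n - s) \<bullet> Et \<theta>) / (t n)\<^sup>2"
  have lim: "AE \<theta> in torus. (\<lambda>n. ennreal (?q n \<theta>)) \<longlonglongrightarrow> ennreal (dpsi (s \<bullet> Et \<theta>) * (h \<bullet> Et \<theta>)\<^sup>2)"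
    using AE_edge[of s]
  proof eventually_elim
    case (elim \<theta>)
    have b: "(\<lambda>n. (x n - s) \<bullet> Et \<theta> / t n) \<longlonglongrightarrow> h \<bullet> Et \<theta>"
      using tendsto_inner[OF h tendsto_const[of "Et \<theta>"]] by simp
    have "(\<lambda>n. (psi (x n \<bullet> Et \<theta>) - psi (s \<bullet> Et \<theta>)) / t n) \<longlonglongrightarrow> dpsi (s \<bullet> Et \<theta>) * (h \<bullet> Et \<theta>)"
      using elim b t by (intro psi_quotient_limit tendsto_intros x) (auto simp: inner_diff_left less_imp_neq[symmetric])
    from tendsto_mult[OF this b] show ?case
      by (intro tendsto_ennrealI) (simp add: power2_eq_square mult.assoc)
  qed
  have "Phi s h = (\<integral>\<^sup>+\<theta>. liminf (\<lambda>n. ennreal (?q n \<theta>)) \<partial>torus)"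
    unfolding Phi_def
    by (intro nn_integral_cong_AE) (use lim in eventually_elim, rule lim_imp_Liminf[symmetric], auto)
  also have "\<dots> \<le> liminf (\<lambda>n. \<integral>\<^sup>+\<theta>. ennreal (?q n \<theta>) \<partial>torus)"
    by (rule nn_integral_liminf) measurable
  also have "(\<lambda>n. \<integral>\<^sup>+\<theta>. ennreal (?q n \<theta>) \<partial>torus) = (\<lambda>n. ennreal ((Psi (x n) - Psi s) \<bullet> (x n - s) / (t n)\<^sup>2))"
  proof
    fix n
    have "integrable torus (\<lambda>\<theta>. (psi (x n \<bullet> Et \<theta>) - psi (s \<bullet> Et \<theta>)) * ((x n - s) \<bullet> Et \<theta>))"
      using Bochner_Integration.integrable_diff[OF integrable_Psi_inner[of "x n" "x n - s"] integrable_Psi_inner[of s "x n - s"]]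
      by (simp add: left_diff_distrib)
    then have "(\<integral>\<^sup>+\<theta>. ennreal (?q n \<theta>) \<partial>torus) = ennreal (\<integral>\<theta>. ?q n \<theta> \<partial>torus)"
      by (intro nn_integral_eq_integral integrable_divide_zero) (auto intro!: divide_nonneg_nonneg psi_mono_product)
    then show "(\<integral>\<^sup>+\<theta>. ennreal (?q n \<theta>) \<partial>torus) = ennreal ((Psi (x n) - Psi s) \<bullet> (x n - s) / (t n)\<^sup>2)"
      by (simp add: Psi_mono_eq)
  qed
  finally show ?thesis .
qed

text \<open>Reversing the unit vector at m changes the inner product with \<open>h\<close> by twice
  \<open>h $ m \<bullet> e m\<close>, so it cannot vanish for both choices.\<close>

lemma choose_angles:
  fixes h :: "'n::finite state" and e :: "'n \<Rightarrow> real \<times> real"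
  assumes e: "\<And>i. norm (e i) = 1" and m: "h $ m \<bullet> e m \<noteq> 0"
  obtains \<theta> where "\<And>i. 0 \<le> \<theta> i" "\<And>i. \<theta> i < 2*pi" "h \<bullet> Et \<theta> \<noteq> 0" "\<And>i. cs (\<theta> i) = e i \<or> cs (\<theta> i) = - e i"
proof -
  have "\<forall>i. \<exists>\<alpha>. e i = cs \<alpha> \<and> 0 \<le> \<alpha> \<and> \<alpha> < 2*pi" using unit_eq_cs e by blast
  then obtain \<theta> where \<theta>: "\<And>i. e i = cs (\<theta> i)" "\<And>i. 0 \<le> \<theta> i" "\<And>i. \<theta> i < 2*pi" by metis
  have "norm (- e m) = 1" using e by simp
  then obtain \<beta> where \<beta>: "- e m = cs \<beta>" "0 \<le> \<beta>" "\<beta> < 2*pi" using unit_eq_cs by blast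
  show ?thesis
  proof (cases "h \<bullet> Et \<theta> = 0")
    case False
    then show ?thesis using that \<theta> by metis
  next
    case True
    have "h \<bullet> Et (\<theta>(m := \<beta>)) \<noteq> 0"
      using True m inner_Et_update[of h \<theta> m "\<theta> m"] \<beta>(1)[symmetric] \<theta>(1)[of m, symmetric]
      by (simp add: inner_Et_update)
    then show ?thesis using \<theta> \<beta> by (intro that[of "\<theta>(m := \<beta>)"]) auto
  qed
qed

lemma norm_cs_diff: "norm (cs s - cs t) \<le> 2 * \<bar>s - t\<bar>"
proof -
  have "\<bar>cos s - cos t\<bar> \<le> \<bar>s - t\<bar>"
    using field_differentiable_bound[of UNIV cos "\<lambda>x. - sin x" 1 t s]
    by (auto intro: DERIV_cos simp: abs_sin_le_one)
  moreover have "\<bar>sin s - sin t\<bar> \<le> \<bar>s - t\<bar>"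
    using field_differentiable_bound[of UNIV sin cos 1 t s]
    by (auto intro: DERIV_sin simp: abs_cos_le_one)
  ultimately have "\<bar>cos s - cos t\<bar> + \<bar>sin s - sin t\<bar> \<le> 2 * \<bar>s - t\<bar>" by simp
  moreover have "norm (cs s - cs t) \<le> \<bar>cos s - cos t\<bar> + \<bar>sin s - sin t\<bar>"
    unfolding cs_def by (simp add: norm_prod_def) (rule sqrt_sum_squares_le_sum_abs)
  ultimately show ?thesis by (rule order_trans[rotated])
qed

lemma inner_Et_diff:
  assumes "\<And>i. \<bar>\<theta> i - \<theta>' i\<bar> \<le> \<epsilon>"
  shows "\<bar>a \<bullet> Et \<theta> - a \<bullet> Et \<theta>'\<bar> \<le> 2 * \<epsilon> * (\<Sum>i\<in>UNIV. norm (a $ i))"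
proof -
  have "\<bar>a \<bullet> Et \<theta> - a \<bullet> Et \<theta>'\<bar> = \<bar>\<Sum>i\<in>UNIV. a $ i \<bullet> (cs (\<theta> i) - cs (\<theta>' i))\<bar>"
    by (simp add: inner_Et inner_diff_right sum_subtractf)
  also have "\<dots> \<le> (\<Sum>i\<in>UNIV. \<bar>a $ i \<bullet> (cs (\<theta> i) - cs (\<theta>' i))\<bar>)" by (rule sum_abs)
  also have "\<dots> \<le> (\<Sum>i\<in>UNIV. norm (a $ i) * (2 * \<epsilon>))"
  proof (rule sum_mono)
    fix i
    have "norm (cs (\<theta> i) - cs (\<theta>' i)) \<le> 2 * \<epsilon>"
      by (rule order_trans[OF norm_cs_diff]) (use assms[of i] in simp)
    then show "\<bar>a $ i \<bullet> (cs (\<theta> i) - cs (\<theta>' i))\<bar> \<le> norm (a $ i) * (2 * \<epsilon>)"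
      by (intro order_trans[OF Cauchy_Schwarz_ineq2] mult_left_mono) auto
  qed
  also have "\<dots> = 2 * \<epsilon> * (\<Sum>i\<in>UNIV. norm (a $ i))"
    by (subst sum_distrib_right[symmetric]) (rule mult.commute)
  finally show ?thesis .
qed

text \<open>\<theta> is the lower corner, not the centre: the angles are taken in [0, 2 pi), so the
  box meets the cube in positive measure even when \<theta> has a coordinate 0.\<close>

definition tbox :: "('n::finite \<Rightarrow> real) \<Rightarrow> real \<Rightarrow> ('n \<Rightarrow> real) set" where
  "tbox \<theta> \<epsilon> = (\<Pi>\<^sub>E i\<in>UNIV. {\<theta> i<..<\<theta> i + \<epsilon>})"

lemma tbox_sets [measurable]: "tbox \<theta> \<epsilon> \<in> sets torus"
  unfolding tbox_def torus_def by (intro sets_PiM_I_finite) auto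

lemma tbox_iff: "\<phi> \<in> tbox \<theta> \<epsilon> \<longleftrightarrow> (\<forall>i. \<theta> i < \<phi> i \<and> \<phi> i < \<theta> i + \<epsilon>)"
  by (auto simp: tbox_def PiE_iff)

lemma emeasure_tbox_pos:
  assumes "\<And>i. 0 \<le> \<theta> i" "\<And>i. \<theta> i < 2*pi" "0 < \<epsilon>"
  shows "0 < emeasure torus (tbox \<theta> \<epsilon>)"
proof -
  have pos: "0 < emeasure unif {\<theta> i<..<\<theta> i + \<epsilon>}" for i
  proof -
    define \<delta> where "\<delta> = min \<epsilon> (2*pi - \<theta> i)"
    have \<delta>: "\<delta> > 0" using assms by (simp add: \<delta>_def)
    have "{\<theta> i<..<\<theta> i + \<delta>} \<subseteq> {0..2*pi} \<inter> {\<theta> i<..<\<theta> i + \<epsilon>}"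
      using assms(1)[of i] by (auto simp: \<delta>_def)
    then have "emeasure lborel {\<theta> i<..<\<theta> i + \<delta>} \<le> emeasure lborel ({0..2*pi} \<inter> {\<theta> i<..<\<theta> i + \<epsilon>})"
      by (intro emeasure_mono) auto
    then have "0 < emeasure lborel ({0..2*pi} \<inter> {\<theta> i<..<\<theta> i + \<epsilon>})"
      using \<delta> by (simp add: less_le_trans[of 0 "ennreal \<delta>"])
    then show ?thesis
      unfolding unif_def by (subst emeasure_uniform_measure) (auto simp: ennreal_zero_less_divide)
  qed
  have "emeasure torus (tbox \<theta> \<epsilon>) = (\<Prod>i\<in>UNIV. emeasure unif {\<theta> i<..<\<theta> i + \<epsilon>})"
    unfolding tbox_def torus_def by (intro torus_factors.emeasure_PiM) auto
  also have "\<dots> \<noteq> 0" using pos by (simp add: less_imp_neq[symmetric])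
  finally show ?thesis by (simp add: zero_less_iff_neq_zero)
qed

text \<open>The direction u of \<open>h\<close> works unless \<open>s\<close> is u or -u; then u is
  tilted by the angle of the triangle with sides 3, 4, 5, and the inner product with
  \<open>s\<close> has modulus 3/5.\<close>

lemma exists_good_unit:
  fixes h s :: "real \<times> real"
  assumes "h \<noteq> 0" "norm s \<le> 1"
  shows "\<exists>e. norm e = 1 \<and> h \<bullet> e \<noteq> 0 \<and> \<bar>s \<bullet> e\<bar> < 1"
proof -
  define u where "u = sgn h"
  have u: "norm u = 1" "h = norm h *\<^sub>R u" using assms by (auto simp: u_def norm_sgn sgn_div_norm)
  have uu: "u \<bullet> u = 1" using u by (simp add: dot_square_norm)
  have ur: "u \<bullet> rot90 u = 0" by (cases u) (simp add: rot90_def)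
  have rr: "norm (rot90 u) = 1" using u by (simp add: rot90_def norm_prod_def add.commute)
  have hu: "h \<bullet> u \<noteq> 0" using assms uu by (subst u(2)) simp
  have dec: "(s \<bullet> u)\<^sup>2 + (s \<bullet> rot90 u)\<^sup>2 = (norm s)\<^sup>2 * (norm u)\<^sup>2"
    by (cases u; cases s) (simp add: rot90_def norm_prod_def power2_eq_square algebra_simps)
  show ?thesis
  proof (cases "\<bar>s \<bullet> u\<bar> < 1")
    case True then show ?thesis using u hu by blast
  next
    case False
    have "(norm s)\<^sup>2 \<le> 1" using assms by (simp add: abs_square_le_1)
    moreover have "1 \<le> (s \<bullet> u)\<^sup>2" using False by (simp add: abs_square_less_1[symmetric] not_less[symmetric])
    moreover have "(s \<bullet> u)\<^sup>2 + (s \<bullet> rot90 u)\<^sup>2 = (norm s)\<^sup>2" using dec u(1) by simp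
    moreover have "0 \<le> (s \<bullet> rot90 u)\<^sup>2" by simp
    ultimately have z: "(s \<bullet> rot90 u)\<^sup>2 \<le> 0" "(s \<bullet> u)\<^sup>2 \<le> 1" by linarith+
    define e where "e = (3/5) *\<^sub>R u + (4/5) *\<^sub>R rot90 u"
    have "(norm e)\<^sup>2 = e \<bullet> e" by (simp add: power2_norm_eq_inner)
    also have "\<dots> = 9/25 * (u \<bullet> u) + 24/25 * (u \<bullet> rot90 u) + 16/25 * (rot90 u \<bullet> rot90 u)"
      by (simp add: e_def inner_add_left inner_add_right inner_commute[of "rot90 u" u] field_simps)
    also have "rot90 u \<bullet> rot90 u = 1" using rr by (simp add: dot_square_norm)
    finally have "(norm e)\<^sup>2 = 1" using uu ur by simp
    then have "norm e = 1" by (simp add: power2_eq_1_iff) (metis norm_ge_zero not_one_le_zero neg_0_le_iff_le)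
    moreover have "h \<bullet> e \<noteq> 0"
    proof -
      have "h \<bullet> rot90 u = 0" using ur by (subst u(2)) simp
      then show ?thesis using hu by (simp add: e_def inner_add_right)
    qed
    moreover have "\<bar>s \<bullet> e\<bar> < 1"
      using z abs_square_le_1[of "s \<bullet> u"] by (simp add: e_def inner_add_right)
    ultimately show ?thesis by blast
  qed
qed

text \<open>It suffices to find one configuration of phases with |s \<bullet> E| < 1 and h \<bullet>
  E nonzero, since the integrand is positive nearby. All phases except one are put orthogonal to
  their components of \<open>s\<close>; the remaining one is supplied by
  \<open>exists_good_unit\<close>, which is where norms at most 1 enter.\<close>

lemma Phi_pos:
  fixes s h :: "'n::finite state"
  assumes s: "\<And>i. norm (s $ i) \<le> 1" and "h \<noteq> 0"
  shows "0 < Phi s h"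
proof -
  obtain m where m: "h $ m \<noteq> 0" using assms by (auto simp: vec_eq_iff)
  obtain e0 where e0: "norm e0 = 1" "h $ m \<bullet> e0 \<noteq> 0" "\<bar>s $ m \<bullet> e0\<bar> < 1"
    using exists_good_unit[OF m s[of m]] by blast
  have "\<exists>e. norm e = 1 \<and> s $ i \<bullet> e = 0" for i
  proof (cases "s $ i = 0")
    case True then show ?thesis by (intro exI[of _ "cs 0"]) simp
  next
    case False
    show ?thesis
    proof (intro exI[of _ "rot90 (sgn (s $ i))"] conjI)
      show "norm (rot90 (sgn (s $ i))) = 1"
        using norm_sgn[of "s $ i"] False by (simp add: rot90_def norm_prod_def add.commute)
      have "sgn (s $ i) \<bullet> rot90 (sgn (s $ i)) = 0"
        by (cases "sgn (s $ i)") (simp add: rot90_def)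
      then show "s $ i \<bullet> rot90 (sgn (s $ i)) = 0"
        using False by (subst (asm) (1) sgn_div_norm) simp
    qed
  qed
  then obtain e1 where e1: "\<And>i. norm (e1 i) = 1" "\<And>i. s $ i \<bullet> e1 i = 0" by metis
  define e where "e = e1(m := e0)"
  obtain \<theta> where \<theta>: "\<And>i. 0 \<le> \<theta> i" "\<And>i. \<theta> i < 2*pi" "h \<bullet> Et \<theta> \<noteq> 0" "\<And>i. cs (\<theta> i) = e i \<or> cs (\<theta> i) = - e i"
  proof (rule choose_angles[of e h m])
    show "norm (e i) = 1" for i using e0 e1 by (simp add: e_def)
    show "h $ m \<bullet> e m \<noteq> 0" using e0 by (simp add: e_def)
  qed blast
  have "s \<bullet> Et \<theta> = s $ m \<bullet> cs (\<theta> m) + (\<Sum>i\<in>UNIV - {m}. s $ i \<bullet> cs (\<theta> i))"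
    unfolding inner_Et by (rule sum.remove) auto
  also have "(\<Sum>i\<in>UNIV - {m}. s $ i \<bullet> cs (\<theta> i)) = 0"
  proof (rule sum.neutral, rule ballI)
    fix i assume "i \<in> UNIV - {m}"
    then show "s $ i \<bullet> cs (\<theta> i) = 0" using \<theta>(4)[of i] e1(2)[of i] by (auto simp: e_def)
  qed
  finally have S: "\<bar>s \<bullet> Et \<theta>\<bar> < 1" using \<theta>(4)[of m] e0 by (auto simp: e_def)
  define L where "L = 1 + (\<Sum>i\<in>UNIV. norm (s $ i)) + (\<Sum>i\<in>UNIV. norm (h $ i))"
  have L: "L > 0" unfolding L_def by (intro add_pos_nonneg sum_nonneg) auto
  \<comment> \<open>By \<open>inner_Et_diff\<close> both inner products vary on the box by at most 2
    \<epsilon> L, half of the smaller margin.\<close>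
  define \<epsilon> where "\<epsilon> = min (1 - \<bar>s \<bullet> Et \<theta>\<bar>) \<bar>h \<bullet> Et \<theta>\<bar> / (4 * L)"
  have \<epsilon>: "\<epsilon> > 0" using S \<theta>(3) L by (simp add: \<epsilon>_def)
  have eL: "2 * \<epsilon> * L < 1 - \<bar>s \<bullet> Et \<theta>\<bar>" "2 * \<epsilon> * L < \<bar>h \<bullet> Et \<theta>\<bar>"
    using S \<theta>(3) L by (auto simp: \<epsilon>_def min_def field_simps)
  have good: "0 < dpsi (s \<bullet> Et \<phi>) * (h \<bullet> Et \<phi>)\<^sup>2" if "\<phi> \<in> tbox \<theta> \<epsilon>" for \<phi>
  proof -
    have c: "\<bar>\<phi> i - \<theta> i\<bar> \<le> \<epsilon>" for i using that by (auto simp: tbox_iff less_imp_le abs_le_iff) (smt (verit))+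
    have "\<bar>s \<bullet> Et \<phi> - s \<bullet> Et \<theta>\<bar> \<le> 2 * \<epsilon> * (\<Sum>i\<in>UNIV. norm (s $ i))" by (rule inner_Et_diff[OF c])
    also have "\<dots> \<le> 2 * \<epsilon> * L" using \<epsilon> unfolding L_def by (intro mult_left_mono) (auto intro!: sum_nonneg add_nonneg_nonneg)
    finally have 1: "\<bar>s \<bullet> Et \<phi>\<bar> < 1" using eL(1) by linarith
    have "\<bar>h \<bullet> Et \<phi> - h \<bullet> Et \<theta>\<bar> \<le> 2 * \<epsilon> * (\<Sum>i\<in>UNIV. norm (h $ i))" by (rule inner_Et_diff[OF c])
    also have "\<dots> \<le> 2 * \<epsilon> * L" using \<epsilon> unfolding L_def by (intro mult_left_mono) (auto intro!: sum_nonneg add_nonneg_nonneg)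
    finally have 2: "h \<bullet> Et \<phi> \<noteq> 0" using eL(2) by linarith
    show ?thesis using 1 2 by (auto simp: dpsi_def abs_square_less_1 intro!: mult_pos_pos divide_pos_pos)
  qed
  show ?thesis
  proof (rule ccontr)
    assume "\<not> 0 < Phi s h"
    then have "Phi s h = 0" by (simp add: zero_less_iff_neq_zero)
    then have "AE \<phi> in torus. ennreal (dpsi (s \<bullet> Et \<phi>) * (h \<bullet> Et \<phi>)\<^sup>2) = 0"
      unfolding Phi_def by (subst (asm) nn_integral_0_iff_AE) auto
    then have "AE \<phi> in torus. \<phi> \<notin> tbox \<theta> \<epsilon>"
      by eventually_elim (use good in \<open>auto simp: not_less[symmetric] ennreal_eq_0_iff\<close>)
    then have "emeasure torus (tbox \<theta> \<epsilon>) = 0"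
      by (subst (asm) AE_iff_measurable[OF tbox_sets[of \<theta> \<epsilon>]]) auto
    then show False using emeasure_tbox_pos[of \<theta> \<epsilon>] \<theta> \<epsilon> by simp
  qed
qed

text \<open>Halving the interval leaves the integral of 1/t unchanged by scaling, although it
  removes a piece worth at least 1/2; a finite value cannot do that.\<close>

lemma nn_integral_inverse_infinite:
  assumes "0 < \<delta>"
  shows "(\<integral>\<^sup>+t. ennreal (1 / t) * indicator {0<..<\<delta>} t \<partial>lborel) = \<infinity>" (is "?I = _")
proof (rule ccontr)
  assume fin: "?I \<noteq> \<infinity>"
  have a: "(\<integral>\<^sup>+t. ennreal (1 / t) * indicator {0<..<\<delta>/2} t \<partial>lborel) = ?I"
  proof -
    have "(\<integral>\<^sup>+t. ennreal (1 / t) * indicator {0<..<\<delta>/2} t \<partial>lborel)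
      = ennreal (1/2) * (\<integral>\<^sup>+t. ennreal (1 / (0 + 1/2 * t)) * indicator {0<..<\<delta>/2} (0 + 1/2 * t) \<partial>lborel)"
      by (subst nn_integral_real_affine[where c = "1/2" and t = 0]) auto
    also have "\<dots> = (\<integral>\<^sup>+t. ennreal (1/2) * (ennreal (1 / (0 + 1/2 * t)) * indicator {0<..<\<delta>/2} (0 + 1/2 * t)) \<partial>lborel)"
      by (rule nn_integral_cmult[symmetric]) measurable
    also have "\<dots> = ?I"
      by (intro nn_integral_cong) (auto split: split_indicator simp: ennreal_mult[symmetric] simp del: ennreal_half)
    finally show ?thesis .
  qed
  have "(\<integral>\<^sup>+t. ennreal (1 / \<delta>) * indicator {\<delta>/2..<\<delta>} t \<partial>lborel) = ennreal (1/2)"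
    using assms by (subst nn_integral_cmult_indicator) (auto simp: ennreal_mult[symmetric])
  then have "?I + ennreal (1/2) = (\<integral>\<^sup>+t. ennreal (1 / t) * indicator {0<..<\<delta>/2} t + ennreal (1 / \<delta>) * indicator {\<delta>/2..<\<delta>} t \<partial>lborel)"
    by (subst nn_integral_add) (auto simp: a)
  also have "\<dots> \<le> ?I"
    using assms by (intro nn_integral_mono) (auto split: split_indicator intro!: ennreal_leI simp: field_simps)
  finally have "?I + ennreal (1/2) \<le> ?I" .
  then show False using fin
    by (metis ennreal_add_left_cancel_le add.right_neutral ennreal_eq_0_iff infinity_ennreal_def le_zero_eq not_less zero_less_divide_1_iff zero_less_numeral less_le_not_le)
qed

text \<open>At a critical point the density has a logarithmic singularity, and the second variation is
  infinite in every direction that is seen there.\<close>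

lemma Phi_infinite:
  fixes s h :: "'n::finite state"
  assumes si: "norm (s $ i) = 1" and s0: "\<And>j. j \<noteq> i \<Longrightarrow> s $ j = 0"
    and h: "s $ i \<bullet> h $ i \<noteq> 0 \<or> (\<exists>j. j \<noteq> i \<and> h $ j \<noteq> 0)"
  shows "Phi s h = \<infinity>"
proof -
  \<comment> \<open>Phase i has to sit at \<open>s $ i\<close> or its negative, where the edge is
    reached. The phase m that makes h \<bullet> E nonzero may be i itself only if \<open>h\<close>
    is seen by \<open>s $ i\<close>.\<close>
  obtain m e0 where m: "norm e0 = 1" "h $ m \<bullet> e0 \<noteq> 0" "m = i \<longrightarrow> e0 = s $ i"
    using h
  proof
    assume "s $ i \<bullet> h $ i \<noteq> 0"
    then show ?thesis using that[of "s $ i" i] si by (simp add: inner_commute)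
  next
    assume "\<exists>j. j \<noteq> i \<and> h $ j \<noteq> 0"
    then obtain j where j: "j \<noteq> i" "h $ j \<noteq> 0" by blast
    then show ?thesis using that[of "sgn (h $ j)" j] by (simp add: norm_sgn sgn_div_norm)
  qed
  define e where "e = (\<lambda>_. cs 0)(i := s $ i, m := e0)"
  have ei: "e i = s $ i" using m by (auto simp: e_def)
  obtain \<theta> where \<theta>: "\<And>j. 0 \<le> \<theta> j" "\<And>j. \<theta> j < 2*pi" "h \<bullet> Et \<theta> \<noteq> 0" "\<And>j. cs (\<theta> j) = e j \<or> cs (\<theta> j) = - e j"
  proof (rule choose_angles[of e h m])
    show "norm (e j) = 1" for j using m si by (simp add: e_def)
    show "h $ m \<bullet> e m \<noteq> 0" using m by (simp add: e_def)
  qed blast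
  define L where "L = 1 + (\<Sum>i\<in>UNIV. norm (h $ i))"
  have L: "L > 0" unfolding L_def by (intro add_pos_nonneg sum_nonneg) auto
  define c where "c = \<bar>h \<bullet> Et \<theta>\<bar> / 2"
  have c: "c > 0" using \<theta>(3) by (simp add: c_def)
  \<comment> \<open>The three bounds keep the sine positive on (0, \<epsilon>), |h \<bullet> E| at
    least c on the box, and phase i inside [0, 2 pi].\<close>
  define \<epsilon> where "\<epsilon> = min (min 1 (c / (2 * L))) (2*pi - \<theta> i)"
  have \<epsilon>: "\<epsilon> > 0" "\<epsilon> \<le> 1" "\<epsilon> \<le> 2*pi - \<theta> i" "2 * \<epsilon> * L \<le> c"
  proof -
    show "\<epsilon> > 0" "\<epsilon> \<le> 1" "\<epsilon> \<le> 2*pi - \<theta> i" using c L \<theta>(2)[of i] by (auto simp: \<epsilon>_def)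
    have "\<epsilon> \<le> c / (2 * L)" by (auto simp: \<epsilon>_def)
    then show "2 * \<epsilon> * L \<le> c" using L by (simp add: field_simps)
  qed
  have hc: "c\<^sup>2 \<le> (h \<bullet> Et \<phi>)\<^sup>2" if "\<phi> \<in> tbox \<theta> \<epsilon>" for \<phi>
  proof -
    have cl: "\<bar>\<phi> i - \<theta> i\<bar> \<le> \<epsilon>" for i using that by (auto simp: tbox_iff less_imp_le abs_le_iff) (smt (verit))+
    have "\<bar>h \<bullet> Et \<phi> - h \<bullet> Et \<theta>\<bar> \<le> 2 * \<epsilon> * (\<Sum>i\<in>UNIV. norm (h $ i))" by (rule inner_Et_diff[OF cl])
    also have "\<dots> \<le> 2 * \<epsilon> * L" using \<epsilon> unfolding L_def by (intro mult_left_mono) auto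
    finally have "c \<le> \<bar>h \<bullet> Et \<phi>\<bar>" using \<epsilon>(4) unfolding c_def by linarith
    then show ?thesis using c by (metis abs_le_square_iff abs_of_pos power2_abs abs_abs)
  qed
  have sE: "s \<bullet> Et \<phi> = s $ i \<bullet> cs (\<phi> i)" for \<phi>
    unfolding inner_Et using s0 by (subst sum.remove[of _ i]) auto
  have inner: "(\<integral>\<^sup>+w. ennreal (dpsi (s $ i \<bullet> cs w)) * indicator {\<theta> i<..<\<theta> i + \<epsilon>} w \<partial>unif) = \<infinity>"
  proof -
    \<comment> \<open>At distance t from the critical phase |s \<bullet> E| is |cos t|, so
      \<open>dpsi\<close> equals 2 / (pi sin t), which is at least (2/pi)/t.\<close>
    have ge: "ennreal (2 / pi) * (ennreal (1 / t) * indicator {0<..<\<epsilon>} t)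
        \<le> ennreal (dpsi (s $ i \<bullet> cs (t + \<theta> i))) * indicator {\<theta> i<..<\<theta> i + \<epsilon>} (t + \<theta> i) * indicator {0..2*pi} (t + \<theta> i)" for t
    proof (cases "0 < t \<and> t < \<epsilon>")
      case True
      have st: "0 < sin t" using True \<epsilon> pi_gt3 by (intro sin_gt_zero) auto
      have ss: "s $ i \<bullet> s $ i = 1" using si by (simp add: dot_square_norm)
      have "s $ i \<bullet> rot90 (s $ i) = 0" by (cases "s $ i") (simp add: rot90_def)
      moreover have "rot90 (- s $ i) = - rot90 (s $ i)" by (simp add: rot90_def)
      ultimately have "\<bar>s $ i \<bullet> cs (t + \<theta> i)\<bar> = \<bar>cos t\<bar>"
        using \<theta>(4)[of i] ss by (auto simp: cs_add ei inner_add_right)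
      then have sq: "(s $ i \<bullet> cs (t + \<theta> i))\<^sup>2 = (cos t)\<^sup>2" by (metis power2_abs)
      have "(cos t)\<^sup>2 = 1 - (sin t)\<^sup>2" by (simp add: cos_squared_eq)
      then have "sqrt (1 - (s $ i \<bullet> cs (t + \<theta> i))\<^sup>2) = sin t" "(s $ i \<bullet> cs (t + \<theta> i))\<^sup>2 < 1"
        using sq st by auto
      then have "dpsi (s $ i \<bullet> cs (t + \<theta> i)) = 2 / (pi * sin t)"
        by (simp add: dpsi_def abs_square_less_1)
      moreover have "2 / pi * (1 / t) \<le> 2 / (pi * sin t)"
        using st True sin_x_le_x[of t] by (simp add: field_simps)
      ultimately have "ennreal (2 / pi) * ennreal (1 / t) \<le> ennreal (dpsi (s $ i \<bullet> cs (t + \<theta> i)))"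
        using True by (subst ennreal_mult[symmetric]) (auto intro!: ennreal_leI)
      then show ?thesis using True \<epsilon> \<theta>(1)[of i] by (auto simp: indicator_def)
    next
      case False
      then have z: "indicator {0<..<\<epsilon>} t = (0::ennreal)" by (auto simp: indicator_def)
      show ?thesis unfolding z by simp
    qed
    have "\<infinity> = ennreal (2 / pi) * (\<integral>\<^sup>+t. ennreal (1 / t) * indicator {0<..<\<epsilon>} t \<partial>lborel)"
      using nn_integral_inverse_infinite[OF \<epsilon>(1)] by (simp add: ennreal_mult_top)
    also have "\<dots> = (\<integral>\<^sup>+t. ennreal (2 / pi) * (ennreal (1 / t) * indicator {0<..<\<epsilon>} t) \<partial>lborel)"
      by (rule nn_integral_cmult[symmetric]) measurable
    also have "\<dots> \<le> (\<integral>\<^sup>+t. ennreal (dpsi (s $ i \<bullet> cs (t + \<theta> i))) * indicator {\<theta> i<..<\<theta> i + \<epsilon>} (t + \<theta> i) * indicator {0..2*pi} (t + \<theta> i) \<partial>lborel)"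
      by (intro nn_integral_mono ge)
    also have "\<dots> = (\<integral>\<^sup>+t. ennreal (dpsi (s $ i \<bullet> cs t)) * indicator {\<theta> i<..<\<theta> i + \<epsilon>} t * indicator {0..2*pi} t \<partial>lborel)"
      by (subst (2) nn_integral_real_affine[where c = 1 and t = "\<theta> i"]) (auto simp: add.commute)
    finally have "(\<integral>\<^sup>+t. ennreal (dpsi (s $ i \<bullet> cs t)) * indicator {\<theta> i<..<\<theta> i + \<epsilon>} t * indicator {0..2*pi} t \<partial>lborel) = \<infinity>"
      by (simp add: top_unique)
    then show ?thesis
      by (subst nn_integral_unif) (auto simp: ennreal_top_divide)
  qed
  have "(\<infinity>::ennreal) = (\<integral>\<^sup>+\<phi>. \<infinity> * indicator (tbox \<theta> \<epsilon>) \<phi> \<partial>torus)"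
    using emeasure_tbox_pos[of \<theta>, OF \<theta>(1,2) \<epsilon>(1)] by (subst nn_integral_cmult_indicator) (auto simp: ennreal_top_mult)
  also have "\<dots> \<le> (\<integral>\<^sup>+\<phi>. (\<integral>\<^sup>+w. ennreal (dpsi (s $ i \<bullet> cs w)) * indicator (tbox \<theta> \<epsilon>) (\<phi>(i := w)) \<partial>unif) \<partial>torus)"
  proof (rule nn_integral_mono)
    fix \<phi> :: "'n \<Rightarrow> real"
    show "\<infinity> * indicator (tbox \<theta> \<epsilon>) \<phi> \<le> (\<integral>\<^sup>+w. ennreal (dpsi (s $ i \<bullet> cs w)) * indicator (tbox \<theta> \<epsilon>) (\<phi>(i := w)) \<partial>unif)"
    proof (cases "\<phi> \<in> tbox \<theta> \<epsilon>")
      case True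
      then have "indicator (tbox \<theta> \<epsilon>) (\<phi>(i := w)) = (indicator {\<theta> i<..<\<theta> i + \<epsilon>} w :: ennreal)" for w
        by (auto simp: indicator_def tbox_iff)
      then show ?thesis using inner by simp
    qed simp
  qed
  also have "\<dots> = (\<integral>\<^sup>+\<phi>. ennreal (dpsi (s \<bullet> Et \<phi>)) * indicator (tbox \<theta> \<epsilon>) \<phi> \<partial>torus)"
    by (subst nn_integral_resample[of _ i]) (auto simp: sE)
  finally have inf: "(\<integral>\<^sup>+\<phi>. ennreal (dpsi (s \<bullet> Et \<phi>)) * indicator (tbox \<theta> \<epsilon>) \<phi> \<partial>torus) = \<infinity>"
    by (simp add: top_unique)
  have "(\<integral>\<^sup>+\<phi>. ennreal (c\<^sup>2) * (ennreal (dpsi (s \<bullet> Et \<phi>)) * indicator (tbox \<theta> \<epsilon>) \<phi>) \<partial>torus) \<le> Phi s h"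
    unfolding Phi_def
  proof (rule nn_integral_mono)
    fix \<phi> :: "'n \<Rightarrow> real"
    show "ennreal (c\<^sup>2) * (ennreal (dpsi (s \<bullet> Et \<phi>)) * indicator (tbox \<theta> \<epsilon>) \<phi>) \<le> ennreal (dpsi (s \<bullet> Et \<phi>) * (h \<bullet> Et \<phi>)\<^sup>2)"
    proof (cases "\<phi> \<in> tbox \<theta> \<epsilon>")
      case True
      then show ?thesis
        using mult_right_mono[OF hc[OF True] dpsi_nonneg[of "s \<bullet> Et \<phi>"]] dpsi_nonneg[of "s \<bullet> Et \<phi>"]
        by (simp add: ennreal_mult[symmetric] mult.commute[of _ "c\<^sup>2"] mult.commute[of _ "(h \<bullet> Et \<phi>)\<^sup>2"] ennreal_leI)
    qed simp
  qed
  then show ?thesis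
    using c by (subst (asm) nn_integral_cmult) (auto simp: inf ennreal_mult_top top_unique)
qed

section \<open>Differentiability of \<open>Psi\<close> where the edge singularities are
  integrable\<close>

lemma emeasure_torus_UNIV [simp]: "emeasure torus UNIV = 1"
  using torus.emeasure_space_1 by simp

text \<open>\<open>dpsi\<close> is of the order of the power -1/2 of the distance to the edges; the
  exponent 3/4 controls its power 3/2 and so provides uniform integrability.\<close>

definition Jint :: "'n::finite state \<Rightarrow> ennreal" where
  "Jint s = (\<integral>\<^sup>+\<theta>. ip (3/4) (1 - \<bar>s \<bullet> Et \<theta>\<bar>) \<partial>torus)"

text \<open>|s \<bullet> E| is at most the sum of the norms, so the edges stay at a positive
  distance.\<close>

lemma Jint_bounded_inside:
  fixes s :: "'n::finite state"
  assumes "(\<Sum>i\<in>UNIV. norm (s $ i)) < 1"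
  shows "\<exists>C<\<infinity>. eventually (\<lambda>s'. Jint s' \<le> C) (nhds s)"
proof -
  define \<eta> where "\<eta> = (1 - (\<Sum>i\<in>UNIV. norm (s $ i))) / 2"
  have \<eta>: "\<eta> > 0" using assms by (simp add: \<eta>_def)
  have "((\<lambda>s'::'n state. \<Sum>i\<in>UNIV. norm (s' $ i)) \<longlongrightarrow> (\<Sum>i\<in>UNIV. norm (s $ i))) (nhds s)"
    by (intro tendsto_intros filterlim_ident)
  then have "eventually (\<lambda>s'::'n state. (\<Sum>i\<in>UNIV. norm (s' $ i)) < 1 - \<eta>) (nhds s)"
    by (rule order_tendstoD) (use assms in \<open>simp add: \<eta>_def field_simps\<close>)
  then have "eventually (\<lambda>s'. Jint s' \<le> ip (3/4) \<eta>) (nhds s)"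
  proof eventually_elim
    case (elim s')
    have "ip (3/4) (1 - \<bar>s' \<bullet> Et \<theta>\<bar>) \<le> ip (3/4) \<eta>" for \<theta> :: "'n \<Rightarrow> real"
    proof (rule ip_antimono)
      have "\<bar>s' \<bullet> Et \<theta>\<bar> \<le> (\<Sum>i\<in>UNIV. \<bar>s' $ i \<bullet> cs (\<theta> i)\<bar>)" unfolding inner_Et by (rule sum_abs)
      also have "\<dots> \<le> (\<Sum>i\<in>UNIV. norm (s' $ i))"
        by (intro sum_mono order_trans[OF Cauchy_Schwarz_ineq2]) simp
      finally show "\<bar>\<eta>\<bar> \<le> \<bar>1 - \<bar>s' \<bullet> Et \<theta>\<bar>\<bar>" using elim \<eta> by simp
    qed simp
    then have "Jint s' \<le> (\<integral>\<^sup>+\<theta>. ip (3/4) \<eta> \<partial>(torus :: ('n \<Rightarrow> real) measure))" unfolding Jint_def by (intro nn_integral_mono)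
    then show ?case by (simp add: emeasure_torus_UNIV)
  qed
  then show ?thesis using ip_finite[of \<eta> "3/4"] \<eta> by (intro exI[of _ "ip (3/4) \<eta>"]) auto
qed

lemma nn_integral_ip_torus:
  fixes s :: "'n::finite state"
  assumes ij: "i \<noteq> j" and nz: "s $ i \<noteq> 0" "s $ j \<noteq> 0"
  shows "(\<integral>\<^sup>+\<theta>. ip (3/4) (s \<bullet> Et \<theta> + c) \<partial>torus)
    \<le> ip (3/4) (norm (s $ i)) * ip (3/8) (norm (s $ j) / norm (s $ i)) * (8 * sin_half_const * sin_half_const)" (is "_ \<le> ?B")
proof -
  have "(\<integral>\<^sup>+\<theta>. ip (3/4) (s \<bullet> Et \<theta> + c) \<partial>torus)
    = (\<integral>\<^sup>+\<theta>. (\<integral>\<^sup>+w. ip (3/4) (s $ i \<bullet> cs w + del i s \<bullet> Et \<theta> + c) \<partial>unif) \<partial>torus)"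
    by (subst nn_integral_resample[of _ i]) (auto simp: inner_Et_update)
  also have "\<dots> = (\<integral>\<^sup>+\<theta>. (\<integral>\<^sup>+u. (\<integral>\<^sup>+w. ip (3/4) (s $ i \<bullet> cs w + del i s \<bullet> Et (\<theta>(j := u)) + c) \<partial>unif) \<partial>unif) \<partial>torus)"
    by (subst nn_integral_resample[of _ j]) auto
  also have "\<dots> = (\<integral>\<^sup>+\<theta>. (\<integral>\<^sup>+u. (\<integral>\<^sup>+w. ip (3/4) (s $ i \<bullet> cs w + s $ j \<bullet> cs u + (del j (del i s) \<bullet> Et \<theta> + c)) \<partial>unif) \<partial>unif) \<partial>torus)"
    using ij by (simp add: inner_Et_update add.assoc)
  also have "\<dots> \<le> (\<integral>\<^sup>+\<theta>. ?B \<partial>(torus :: ('n \<Rightarrow> real) measure))"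
    by (intro nn_integral_mono nn_integral_ip_two nz)
  finally show ?thesis by (simp add: emeasure_torus_UNIV)
qed

text \<open>The two-phase estimate, applied to each edge separately. Near \<open>s\<close> the
  lengths of the two components stay away from zero and the first one stays bounded, so the constant
  is uniform.\<close>

lemma Jint_bounded_two:
  fixes s :: "'n::finite state"
  assumes ij: "i \<noteq> j" and nz: "s $ i \<noteq> 0" "s $ j \<noteq> 0"
  shows "\<exists>C<\<infinity>. eventually (\<lambda>s'. Jint s' \<le> C) (nhds s)"
proof -
  define a where "a = norm (s $ i)"
  define b where "b = norm (s $ j)"
  have ab: "a > 0" "b > 0" using nz by (auto simp: a_def b_def)
  define B where "B = ip (3/4) (a/2) * ip (3/8) (b/2 / (2*a)) * (8 * sin_half_const * sin_half_const)"
  have "B < \<infinity>" unfolding B_def using ab ip_finite[of "a/2" "3/4"] ip_finite[of "b/2/(2*a)" "3/8"] sin_half_const_finite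
    by (auto simp: ennreal_mult_less_top)
  have ti: "((\<lambda>s'::'n state. norm (s' $ i)) \<longlongrightarrow> a) (nhds s)" "((\<lambda>s'::'n state. norm (s' $ j)) \<longlongrightarrow> b) (nhds s)"
    unfolding a_def b_def by (intro tendsto_intros filterlim_ident)+
  have "eventually (\<lambda>s'::'n state. norm (s' $ i) > a/2) (nhds s)" "eventually (\<lambda>s'::'n state. norm (s' $ i) < 2 * a) (nhds s)"
    "eventually (\<lambda>s'::'n state. norm (s' $ j) > b/2) (nhds s)"
    using ab by (intro order_tendstoD[OF ti(1)] order_tendstoD[OF ti(2)]; simp)+
  then have "eventually (\<lambda>s'. Jint s' \<le> B + B) (nhds s)"
  proof eventually_elim
    case (elim s')
    have bd: "(\<integral>\<^sup>+\<theta>. ip (3/4) (s' \<bullet> Et \<theta> + c) \<partial>torus) \<le> B" for c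
    proof -
      have "s' $ i \<noteq> 0" "s' $ j \<noteq> 0" using elim ab by auto
      then have "(\<integral>\<^sup>+\<theta>. ip (3/4) (s' \<bullet> Et \<theta> + c) \<partial>torus) \<le> ip (3/4) (norm (s' $ i)) * ip (3/8) (norm (s' $ j) / norm (s' $ i)) * (8 * sin_half_const * sin_half_const)"
        by (rule nn_integral_ip_torus[OF ij])
      also have "\<dots> \<le> B" unfolding B_def
      proof (intro mult_mono ip_antimono)
        have "b/2 / (2*a) \<le> norm (s' $ j) / norm (s' $ i)"
          using elim ab by (intro frac_le) auto
        then show "\<bar>b/2 / (2*a)\<bar> \<le> \<bar>norm (s' $ j) / norm (s' $ i)\<bar>" using ab by simp
      qed (use elim ab in auto)
      finally show ?thesis .
    qed
    have le: "ip (3/4) (1 - \<bar>S\<bar>) \<le> ip (3/4) (S + -1) + ip (3/4) (S + 1)" for S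
    proof (cases "S \<ge> 0")
      case True
      then have "1 - \<bar>S\<bar> = - (S + -1)" by simp
      then show ?thesis by (simp only: ip_minus) simp
    next
      case False
      then have "1 - \<bar>S\<bar> = S + 1" by simp
      then show ?thesis by (simp only:) (rule add_increasing[OF zero_le order_refl])
    qed
    have "Jint s' \<le> (\<integral>\<^sup>+\<theta>. ip (3/4) (s' \<bullet> Et \<theta> + -1) + ip (3/4) (s' \<bullet> Et \<theta> + 1) \<partial>torus)"
      unfolding Jint_def by (intro nn_integral_mono le)
    also have "\<dots> = (\<integral>\<^sup>+\<theta>. ip (3/4) (s' \<bullet> Et \<theta> + -1) \<partial>torus) + (\<integral>\<^sup>+\<theta>. ip (3/4) (s' \<bullet> Et \<theta> + 1) \<partial>torus)"
      by (rule nn_integral_add) measurable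
    also have "\<dots> \<le> B + B" by (intro add_mono bd)
    finally show ?case .
  qed
  then show ?thesis using \<open>B < \<infinity>\<close> by (intro exI[of _ "B + B"]) auto
qed

text \<open>An elementary case of Vitali's theorem: above the level k^2 a function is at most its
  power 3/2 divided by k, and below it dominated convergence applies.\<close>

lemma vitali_power:
  fixes f :: "nat \<Rightarrow> 'a \<Rightarrow> real"
  assumes "prob_space M" and [measurable]: "\<And>n. f n \<in> borel_measurable M"
    and nn: "\<And>n x. 0 \<le> f n x" and lim: "AE x in M. (\<lambda>n. f n x) \<longlonglongrightarrow> 0"
    and bd: "\<And>n. (\<integral>\<^sup>+x. ennreal (f n x powr (3/2)) \<partial>M) \<le> ennreal c"
  shows "(\<lambda>n. \<integral>\<^sup>+x. ennreal (f n x) \<partial>M) \<longlonglongrightarrow> 0"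
proof (rule order_tendstoI)
  interpret prob_space M by fact
  fix e :: ennreal assume "0 < e"
  then obtain y where y: "0 < y" "y < e" using dense by blast
  then obtain e' where e': "0 < e'" "ennreal e' < e"
    by (cases y) (auto simp: less_top[symmetric])
  \<comment> \<open>Makes the tail bound |c| / k smaller than e'/2.\<close>
  define k where "k = 2 * (\<bar>c\<bar> + 1) / e'"
  have k: "k > 0" using e' by (simp add: k_def)
  have split: "f n x \<le> min (f n x) (k\<^sup>2) + f n x powr (3/2) / k" for n x
  proof (cases "f n x \<le> k\<^sup>2")
    case False
    then have f: "f n x > k\<^sup>2" "f n x > 0" using k by (auto intro: less_trans[of 0 "k\<^sup>2"])
    then have "k \<le> sqrt (f n x)" using k by (simp add: real_le_rsqrt)
    then have "f n x * k \<le> f n x * sqrt (f n x)" using nn by (intro mult_left_mono) auto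
    also have "f n x * sqrt (f n x) = f n x powr 1 * f n x powr (1/2)"
      using f(2) by (simp only: powr_half_sqrt less_imp_le powr_one)
    also have "\<dots> = f n x powr (3/2)" by (simp only: powr_add[symmetric]) simp
    finally have "f n x \<le> f n x powr (3/2) / k" using k by (simp add: pos_le_divide_eq)
    then show ?thesis using f k by (simp add: add_increasing)
  qed (use k in auto)
  have l0: "(\<lambda>n. \<integral>\<^sup>+x. ennreal (min (f n x) (k\<^sup>2)) \<partial>M) \<longlonglongrightarrow> (\<integral>\<^sup>+x. 0 \<partial>M)"
  proof (rule nn_integral_dominated_convergence[where w = "\<lambda>_. ennreal (k\<^sup>2)"])
    show "AE x in M. (\<lambda>n. ennreal (min (f n x) (k\<^sup>2))) \<longlonglongrightarrow> 0"
      using lim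
    proof eventually_elim
      case (elim x)
      have "(\<lambda>n. min (f n x) (k\<^sup>2)) \<longlonglongrightarrow> min 0 (k\<^sup>2)" by (intro tendsto_intros elim)
      then have "(\<lambda>n. ennreal (min (f n x) (k\<^sup>2))) \<longlonglongrightarrow> ennreal 0" by (intro tendsto_ennrealI) simp
      then show ?case by simp
    qed
  qed (auto simp: emeasure_space_1 intro!: ennreal_leI)
  then have "eventually (\<lambda>n. (\<integral>\<^sup>+x. ennreal (min (f n x) (k\<^sup>2)) \<partial>M) < ennreal (e'/2)) sequentially"
    using e' by (intro order_tendstoD(2)[OF l0]) auto
  then show "eventually (\<lambda>n. (\<integral>\<^sup>+x. ennreal (f n x) \<partial>M) < e) sequentially"
  proof eventually_elim
    case (elim n)
    have "(\<integral>\<^sup>+x. ennreal (f n x) \<partial>M) \<le> (\<integral>\<^sup>+x. ennreal (min (f n x) (k\<^sup>2)) + ennreal (1 / k) * ennreal (f n x powr (3/2)) \<partial>M)"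
      using split nn k by (intro nn_integral_mono) (auto simp: ennreal_mult[symmetric] ennreal_plus[symmetric] simp del: ennreal_plus intro!: ennreal_leI)
    also have "\<dots> = (\<integral>\<^sup>+x. ennreal (min (f n x) (k\<^sup>2)) \<partial>M) + ennreal (1 / k) * (\<integral>\<^sup>+x. ennreal (f n x powr (3/2)) \<partial>M)"
      by (subst nn_integral_add) (auto simp: nn_integral_cmult)
    also have "\<dots> \<le> ennreal (e'/2) + ennreal (1 / k) * ennreal \<bar>c\<bar>"
      using elim bd[of n] by (intro add_mono mult_left_mono) (auto intro: order_trans ennreal_leI)
    also have "\<dots> = ennreal (e'/2 + 1 / k * \<bar>c\<bar>)"
      using k e' by (subst ennreal_mult[symmetric]) (auto simp: ennreal_plus[symmetric] simp del: ennreal_plus)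
    also have "\<dots> \<le> ennreal e'"
      using e' by (intro ennreal_leI) (simp add: k_def field_simps)
    finally show ?case using e' by simp
  qed
qed simp

definition DPsi :: "'n::finite state \<Rightarrow> 'n state \<Rightarrow> 'n state" where
  "DPsi s h = (\<integral>\<theta>. (dpsi (s \<bullet> Et \<theta>) * (h \<bullet> Et \<theta>)) *\<^sub>R Et \<theta> \<partial>torus)"

lemma inverse_sqrt_le_ip:
  "x \<noteq> 0 \<Longrightarrow> ennreal (1 / sqrt \<bar>x\<bar>) \<le> 1 + ip (3/4) x"
proof -
  assume x: "x \<noteq> 0"
  have "1 / sqrt \<bar>x\<bar> \<le> 1 + \<bar>x\<bar> powr - (3/4)"
  proof (cases "\<bar>x\<bar> \<ge> 1")
    case True
    then have "1 / sqrt \<bar>x\<bar> \<le> 1" by simp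
    then show ?thesis using powr_ge_zero[of "\<bar>x\<bar>" "- (3/4)"] by linarith
  next
    case False
    have "1 / sqrt \<bar>x\<bar> = \<bar>x\<bar> powr - (1/2)" using x by (simp add: powr_minus_divide powr_half_sqrt)
    also have "\<dots> \<le> \<bar>x\<bar> powr - (3/4)" using False x by (intro powr_mono') auto
    finally show ?thesis by simp
  qed
  then have "ennreal (1 / sqrt \<bar>x\<bar>) \<le> ennreal (1 + \<bar>x\<bar> powr - (3/4))" by (rule ennreal_leI)
  then show ?thesis using x by (simp add: ip_def ennreal_plus)
qed

lemma integrable_dpsi:
  assumes "Jint s < \<infinity>"
  shows "integrable torus (\<lambda>\<theta>. dpsi (s \<bullet> Et \<theta>))"
proof (rule integrableI_bounded)
  have "(\<integral>\<^sup>+\<theta>. ennreal (norm (dpsi (s \<bullet> Et \<theta>))) \<partial>torus) \<le> (\<integral>\<^sup>+\<theta>. 1 + ip (3/4) (1 - \<bar>s \<bullet> Et \<theta>\<bar>) \<partial>torus)"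
  proof (rule nn_integral_mono_AE)
    show "AE \<theta> in torus. ennreal (norm (dpsi (s \<bullet> Et \<theta>))) \<le> 1 + ip (3/4) (1 - \<bar>s \<bullet> Et \<theta>\<bar>)"
      using AE_edge[of s]
    proof eventually_elim
      case (elim \<theta>)
      have "ennreal (norm (dpsi (s \<bullet> Et \<theta>))) \<le> ennreal (1 / sqrt \<bar>1 - \<bar>s \<bullet> Et \<theta>\<bar>\<bar>)"
        using dpsi_le[OF elim] dpsi_nonneg[of "s \<bullet> Et \<theta>"] by (intro ennreal_leI) auto
      also have "\<dots> \<le> 1 + ip (3/4) (1 - \<bar>s \<bullet> Et \<theta>\<bar>)" by (rule inverse_sqrt_le_ip) (use elim in auto)
      finally show ?case .
    qed
  qed
  also have "\<dots> = 1 + Jint s" unfolding Jint_def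
    by (subst nn_integral_add) (auto simp: emeasure_torus_UNIV)
  finally show "(\<integral>\<^sup>+\<theta>. ennreal (norm (dpsi (s \<bullet> Et \<theta>))) \<partial>torus) < \<infinity>"
    using assms by (auto simp: less_top[symmetric] top_unique)
qed measurable

lemma integrable_DPsi:
  fixes s :: "'n::finite state"
  assumes "Jint s < \<infinity>"
  shows "integrable torus (\<lambda>\<theta>. (dpsi (s \<bullet> Et \<theta>) * (h \<bullet> Et \<theta>)) *\<^sub>R Et \<theta>)"
proof (rule Bochner_Integration.integrable_bound)
  show "integrable torus (\<lambda>\<theta>. dpsi (s \<bullet> Et \<theta>) * (CARD('n) * norm h * CARD('n)))"
    using integrable_dpsi[OF assms] by simp
  have "norm ((dpsi (s \<bullet> Et \<theta>) * (h \<bullet> Et \<theta>)) *\<^sub>R Et \<theta>)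
      \<le> norm (dpsi (s \<bullet> Et \<theta>) * (CARD('n) * norm h * CARD('n)))" for \<theta> :: "'n \<Rightarrow> real"
  proof -
    have "\<bar>h \<bullet> Et \<theta>\<bar> * norm (Et \<theta>) \<le> (CARD('n) * norm h) * CARD('n)"
      by (intro mult_mono abs_inner_Et norm_Et) auto
    from mult_left_mono[OF this dpsi_nonneg[of "s \<bullet> Et \<theta>"]] show ?thesis
      using dpsi_nonneg[of "s \<bullet> Et \<theta>"] by (simp add: abs_mult mult.assoc)
  qed
  then show "AE \<theta> in torus. norm ((dpsi (s \<bullet> Et \<theta>) * (h \<bullet> Et \<theta>)) *\<^sub>R Et \<theta>)
      \<le> norm (dpsi (s \<bullet> Et \<theta>) * (CARD('n) * norm h * CARD('n)))"
    by simp
qed measurable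

lemma DPsi_linear:
  assumes "Jint s < \<infinity>"
  shows "linear (DPsi s)"
proof (rule linearI)
  show "DPsi s (x + y) = DPsi s x + DPsi s y" for x y
    unfolding DPsi_def
    by (subst Bochner_Integration.integral_add[symmetric, OF integrable_DPsi[OF assms] integrable_DPsi[OF assms]])
       (simp add: inner_add_left distrib_left scaleR_add_left)
  show "DPsi s (r *\<^sub>R x) = r *\<^sub>R DPsi s x" for r x
    unfolding DPsi_def
    by (subst integral_scaleR_right[symmetric]) (simp_all add: mult_ac)
qed

text \<open>Through this identity \<open>Phi_pos\<close> makes the derivative injective.\<close>

lemma DPsi_inner:
  assumes "Jint s < \<infinity>"
  shows "ennreal (DPsi s h \<bullet> h) = Phi s h"
proof -
  have e: "(\<lambda>\<theta>. (dpsi (s \<bullet> Et \<theta>) * (h \<bullet> Et \<theta>)) *\<^sub>R Et \<theta> \<bullet> h) = (\<lambda>\<theta>. dpsi (s \<bullet> Et \<theta>) * (h \<bullet> Et \<theta>)\<^sup>2)"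
    by (auto simp: power2_eq_square inner_commute)
  have "integrable torus (\<lambda>\<theta>. dpsi (s \<bullet> Et \<theta>) * (h \<bullet> Et \<theta>)\<^sup>2)"
    using integrable_inner_left[OF integrable_DPsi[OF assms, of h], of h] by (simp only: e)
  moreover have "DPsi s h \<bullet> h = (\<integral>\<theta>. dpsi (s \<bullet> Et \<theta>) * (h \<bullet> Et \<theta>)\<^sup>2 \<partial>torus)"
    unfolding DPsi_def by (subst integral_inner_left[OF integrable_DPsi[OF assms], symmetric]) (simp only: e)
  ultimately show ?thesis unfolding Phi_def
    by (subst nn_integral_eq_integral) (auto simp: dpsi_nonneg)
qed

text \<open>The normalized remainder \<open>D n\<close> tends to 0 almost everywhere, because the
  edges form a null set, and it is bounded in L^(3/2) by \<open>Jint\<close> at both points;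
  \<open>vitali_power\<close> then makes its mean tend to 0.\<close>

lemma Psi_has_derivative:
  fixes s :: "'n::finite state"
  assumes C: "C < \<infinity>" and ev: "eventually (\<lambda>s'. Jint s' \<le> C) (nhds s)"
  shows "(Psi has_derivative DPsi s) (at s)"
  unfolding has_derivative_iff_norm
proof
  have J: "Jint s \<le> C" using ev by (rule eventually_nhds_x_imp_x)
  then have Js: "Jint s < \<infinity>" using C by (rule le_less_trans)
  show "bounded_linear (DPsi s)" using DPsi_linear[OF Js] linear_conv_bounded_linear by blast
  let ?N = "real CARD('n)"
  let ?q = "\<lambda>y. norm (Psi y - Psi s - DPsi s (y - s)) / norm (y - s)"
  show "(?q \<longlongrightarrow> 0) (at s)"
    unfolding tendsto_at_iff_sequentially
  proof (intro allI impI)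
    fix X :: "nat \<Rightarrow> 'n state" assume X: "\<forall>i. X i \<in> UNIV - {s}" "X \<longlonglongrightarrow> s"
    define t where "t n = norm (X n - s)" for n
    have t: "t n > 0" for n using X by (simp add: t_def)
    have "eventually (\<lambda>n. Jint (X n) \<le> C) sequentially"
      using ev X(2) unfolding filterlim_def le_filter_def eventually_filtermap by blast
    then obtain n0 where n0: "\<And>n. n \<ge> n0 \<Longrightarrow> Jint (X n) \<le> C" by (auto simp: eventually_sequentially)
    define D where "D n \<theta> = \<bar>psi (X n \<bullet> Et \<theta>) - psi (s \<bullet> Et \<theta>) - dpsi (s \<bullet> Et \<theta>) * ((X n - s) \<bullet> Et \<theta>)\<bar> / t n" for n \<theta>
    have [measurable]: "D n \<in> borel_measurable torus" for n unfolding D_def by measurable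
    have D0: "0 \<le> D n \<theta>" for n \<theta> using t[of n] by (simp add: D_def)
    have lim: "AE \<theta> in torus. (\<lambda>n. D (n + n0) \<theta>) \<longlonglongrightarrow> 0"
      using AE_edge[of s]
    proof eventually_elim
      case (elim \<theta>)
      obtain g where g: "\<And>z. psi z - psi (s \<bullet> Et \<theta>) = g z * (z - s \<bullet> Et \<theta>)" "isCont g (s \<bullet> Et \<theta>)" "g (s \<bullet> Et \<theta>) = dpsi (s \<bullet> Et \<theta>)"
        using psi_deriv[OF elim] unfolding CARAT_DERIV by blast
      have Dle: "D n \<theta> \<le> \<bar>g (X n \<bullet> Et \<theta>) - g (s \<bullet> Et \<theta>)\<bar> * ?N" for n
      proof -
        have "D n \<theta> = \<bar>g (X n \<bullet> Et \<theta>) - g (s \<bullet> Et \<theta>)\<bar> * (\<bar>(X n - s) \<bullet> Et \<theta>\<bar> / t n)"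
          unfolding D_def g(1) g(3)[symmetric] by (simp add: inner_diff_left left_diff_distrib[symmetric] abs_mult)
        also have "\<dots> \<le> \<bar>g (X n \<bullet> Et \<theta>) - g (s \<bullet> Et \<theta>)\<bar> * ?N"
          using abs_inner_Et[of "X n - s" \<theta>] t[of n] by (intro mult_left_mono) (auto simp: pos_divide_le_eq t_def[symmetric])
        finally show ?thesis .
      qed
      have "(\<lambda>n. \<bar>g (X n \<bullet> Et \<theta>) - g (s \<bullet> Et \<theta>)\<bar> * ?N) \<longlonglongrightarrow> \<bar>g (s \<bullet> Et \<theta>) - g (s \<bullet> Et \<theta>)\<bar> * ?N"
        by (intro tendsto_intros isCont_tendsto_compose[OF g(2)] X(2))
      then have up: "(\<lambda>n. \<bar>g (X n \<bullet> Et \<theta>) - g (s \<bullet> Et \<theta>)\<bar> * ?N) \<longlonglongrightarrow> 0" by simp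
      have "(\<lambda>n. D n \<theta>) \<longlonglongrightarrow> 0"
        using D0 Dle by (intro tendsto_0_le[OF up, of _ 1]) (auto intro!: always_eventually)
      then show ?case by (rule LIMSEQ_ignore_initial_segment)
    qed
    \<comment> \<open>With m the smaller distance to the edges, the remainder is at most 9 N
      m^(-1/2): 8 from \<open>psi_diff_le\<close> and 1 from \<open>dpsi_le\<close>, rounded up to
      10. The power 3/2 turns m^(-1/2) into m^(-3/4).\<close>
    define K where "K = (10 * ?N) powr (3/2)"
    have bdD: "(\<integral>\<^sup>+\<theta>. ennreal (D n \<theta> powr (3/2)) \<partial>torus) \<le> ennreal K * (C + C)" if "n \<ge> n0" for n
    proof -
      have "(\<integral>\<^sup>+\<theta>. ennreal (D n \<theta> powr (3/2)) \<partial>torus)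
        \<le> (\<integral>\<^sup>+\<theta>. ennreal K * (ip (3/4) (1 - \<bar>X n \<bullet> Et \<theta>\<bar>) + ip (3/4) (1 - \<bar>s \<bullet> Et \<theta>\<bar>)) \<partial>torus)"
      proof (rule nn_integral_mono_AE)
        show "AE \<theta> in torus. ennreal (D n \<theta> powr (3/2)) \<le> ennreal K * (ip (3/4) (1 - \<bar>X n \<bullet> Et \<theta>\<bar>) + ip (3/4) (1 - \<bar>s \<bullet> Et \<theta>\<bar>))"
          using AE_edge[of s] AE_edge[of "X n"]
        proof eventually_elim
          case (elim \<theta>)
          define a where "a = \<bar>1 - \<bar>X n \<bullet> Et \<theta>\<bar>\<bar>"
          define b where "b = \<bar>1 - \<bar>s \<bullet> Et \<theta>\<bar>\<bar>"
          have ab: "a > 0" "b > 0" using elim by (auto simp: a_def b_def)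
          have i: "\<bar>(X n - s) \<bullet> Et \<theta>\<bar> \<le> ?N * t n" using abs_inner_Et[of "X n - s" \<theta>] by (simp add: t_def)
          have p1: "\<bar>psi (X n \<bullet> Et \<theta>) - psi (s \<bullet> Et \<theta>)\<bar> \<le> 4 * (?N * t n) * (1 / sqrt a + 1 / sqrt b)"
            unfolding a_def b_def
            by (rule order_trans[OF psi_diff_le[OF elim(2,1)]])
               (use i in \<open>intro mult_right_mono mult_left_mono; simp add: inner_diff_left\<close>)
          have p2: "\<bar>dpsi (s \<bullet> Et \<theta>) * ((X n - s) \<bullet> Et \<theta>)\<bar> \<le> (1 / sqrt b) * (?N * t n)"
            using dpsi_le[OF elim(1)] dpsi_nonneg[of "s \<bullet> Et \<theta>"] i ab
            unfolding abs_mult b_def[symmetric] by (intro mult_mono) auto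
          define m where "m = min a b"
          have m: "m > 0" "1 / sqrt a \<le> 1 / sqrt m" "1 / sqrt b \<le> 1 / sqrt m"
            using ab by (auto simp: m_def intro!: divide_left_mono mult_pos_pos)
          have "D n \<theta> * t n \<le> 4 * (?N * t n) * (1 / sqrt a + 1 / sqrt b) + (1 / sqrt b) * (?N * t n)"
            using p1 p2 t[of n] unfolding D_def by simp
          also have "\<dots> \<le> 4 * (?N * t n) * (1 / sqrt m + 1 / sqrt m) + (1 / sqrt m) * (?N * t n)"
            using m t[of n] by (intro add_mono mult_left_mono mult_right_mono) auto
          also have "\<dots> = (9 * ?N / sqrt m) * t n" by (simp add: field_simps)
          finally have "D n \<theta> \<le> 9 * ?N / sqrt m" using t[of n] mult_le_cancel_right_pos by blast
          also have "\<dots> \<le> 10 * ?N * (m powr - (1/2))"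
            using m(1) by (simp add: powr_minus_divide powr_half_sqrt divide_right_mono)
          finally have "D n \<theta> powr (3/2) \<le> (10 * ?N * (m powr - (1/2))) powr (3/2)"
            using D0 by (intro powr_mono2) auto
          also have "\<dots> = K * m powr - (3/4)" by (simp add: K_def powr_mult powr_powr)
          also have "\<dots> \<le> K * (a powr - (3/4) + b powr - (3/4))"
            by (intro mult_left_mono) (auto simp: m_def K_def min_def)
          finally have "ennreal (D n \<theta> powr (3/2)) \<le> ennreal (K * (a powr - (3/4) + b powr - (3/4)))"
            by (rule ennreal_leI)
          also have "\<dots> = ennreal K * (ennreal (a powr - (3/4)) + ennreal (b powr - (3/4)))"
            by (simp add: ennreal_mult K_def)
          finally show ?case using elim by (simp add: ip_def a_def b_def)
        qed
      qed
      also have "\<dots> = ennreal K * (Jint (X n) + Jint s)"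
        unfolding Jint_def by (subst nn_integral_cmult, measurable, subst nn_integral_add) auto
      also have "\<dots> \<le> ennreal K * (C + C)" using n0[OF that] J by (intro mult_left_mono add_mono) auto
      finally show ?thesis .
    qed
    obtain c where c: "ennreal K * (C + C) = ennreal c"
    proof (cases "ennreal K * (C + C)")
      case top
      then show ?thesis using C by (auto simp: ennreal_mult_eq_top_iff)
    qed blast
    have v: "(\<lambda>n. \<integral>\<^sup>+\<theta>. ennreal (D (n + n0) \<theta>) \<partial>torus) \<longlonglongrightarrow> 0"
      by (rule vitali_power[where c = c]) (use bdD[of "_ + n0"] c in \<open>auto simp: torus.prob_space_axioms D0 lim\<close>)
    have q: "ennreal (?q (X n)) \<le> ennreal ?N * (\<integral>\<^sup>+\<theta>. ennreal (D n \<theta>) \<partial>torus)" for n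
    proof -
      let ?r = "\<lambda>\<theta>. (psi (X n \<bullet> Et \<theta>) - psi (s \<bullet> Et \<theta>) - dpsi (s \<bullet> Et \<theta>) * ((X n - s) \<bullet> Et \<theta>)) *\<^sub>R Et \<theta>"
      have e: "?r = (\<lambda>\<theta>. psi (X n \<bullet> Et \<theta>) *\<^sub>R Et \<theta> - psi (s \<bullet> Et \<theta>) *\<^sub>R Et \<theta> - (dpsi (s \<bullet> Et \<theta>) * ((X n - s) \<bullet> Et \<theta>)) *\<^sub>R Et \<theta>)"
        by (auto simp: scaleR_diff_left)
      have ir: "integrable torus ?r" unfolding e
        by (intro Bochner_Integration.integrable_diff integrable_Psi integrable_DPsi Js)
      have "Psi (X n) - Psi s - DPsi s (X n - s) = (\<integral>\<theta>. ?r \<theta> \<partial>torus)"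
        unfolding e Psi_def DPsi_def
        by (subst Bochner_Integration.integral_diff[OF Bochner_Integration.integrable_diff[OF integrable_Psi integrable_Psi] integrable_DPsi[OF Js]])
           (subst Bochner_Integration.integral_diff[OF integrable_Psi integrable_Psi], simp)
      then have "ennreal (norm (Psi (X n) - Psi s - DPsi s (X n - s))) \<le> (\<integral>\<^sup>+\<theta>. ennreal (norm (?r \<theta>)) \<partial>torus)"
        using integral_norm_bound_ennreal[OF ir] by simp
      also have "\<dots> \<le> (\<integral>\<^sup>+\<theta>. ennreal (?N * t n) * ennreal (D n \<theta>) \<partial>torus)"
      proof (rule nn_integral_mono)
        fix \<theta> :: "'n \<Rightarrow> real"
        have "norm (?r \<theta>) \<le> (?N * t n) * D n \<theta>"
          using mult_left_mono[OF norm_Et[of \<theta>], of "D n \<theta> * t n"] D0[of n \<theta>] t[of n]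
          by (simp add: D_def mult_ac)
        then show "ennreal (norm (?r \<theta>)) \<le> ennreal (?N * t n) * ennreal (D n \<theta>)"
          using t[of n] D0 by (subst ennreal_mult[symmetric]) (auto intro!: ennreal_leI)
      qed
      also have "\<dots> = ennreal (?N * t n) * (\<integral>\<^sup>+\<theta>. ennreal (D n \<theta>) \<partial>torus)" by (rule nn_integral_cmult) measurable
      finally have "ennreal (1 / t n) * ennreal (norm (Psi (X n) - Psi s - DPsi s (X n - s)))
         \<le> ennreal (1 / t n) * (ennreal (?N * t n) * (\<integral>\<^sup>+\<theta>. ennreal (D n \<theta>) \<partial>torus))"
        by (intro mult_left_mono) auto
      then show ?thesis
        using t[of n] by (simp add: mult.assoc[symmetric] ennreal_mult[symmetric] t_def)
    qed
    have "(\<lambda>n. ennreal ?N * (\<integral>\<^sup>+\<theta>. ennreal (D (n + n0) \<theta>) \<partial>torus)) \<longlonglongrightarrow> ennreal ?N * 0"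
      by (intro ennreal_tendsto_cmult v) auto
    then have up: "(\<lambda>n. ennreal ?N * (\<integral>\<^sup>+\<theta>. ennreal (D (n + n0) \<theta>) \<partial>torus)) \<longlonglongrightarrow> 0" by simp
    have "(\<lambda>n. ennreal (?q (X (n + n0)))) \<longlonglongrightarrow> 0"
      by (rule tendsto_sandwich[OF _ _ tendsto_const up]) (use q in \<open>auto intro!: always_eventually\<close>)
    then have "(\<lambda>n. ennreal (?q (X (n + n0)))) \<longlonglongrightarrow> ennreal 0" by simp
    then have "(\<lambda>n. ?q (X (n + n0))) \<longlonglongrightarrow> 0" by (subst (asm) tendsto_ennreal_iff) auto
    then show "((?q \<circ> X) \<longlonglongrightarrow> 0)" unfolding comp_def by (rule LIMSEQ_offset)
  qed
qed

section \<open>\<open>H0\<close> as a norm equivalent to the Euclidean one\<close>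

lemma measure_torus_UNIV [simp]: "measure torus UNIV = 1"
  using torus.prob_space by simp

lemma H0_nonneg: "0 \<le> H0 a"
  unfolding H0_def by simp

lemma H0_scale: "H0 (c *\<^sub>R a) = \<bar>c\<bar> * H0 a"
  unfolding H0_def by (simp add: abs_mult)

lemma H0_triangle: "H0 (a + b) \<le> H0 a + H0 b"
proof -
  have "H0 (a + b) \<le> (\<integral>\<theta>. \<bar>a \<bullet> Et \<theta>\<bar> + \<bar>b \<bullet> Et \<theta>\<bar> \<partial>torus)"
    unfolding H0_def by (intro integral_mono integrable_H0 Bochner_Integration.integrable_add) (auto simp: inner_add_left)
  then show ?thesis unfolding H0_def by (simp add: integrable_H0)
qed

lemma H0_le: "H0 a \<le> CARD('n) * norm (a :: 'n::finite state)"
proof -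
  have "H0 a \<le> (\<integral>\<theta>. CARD('n) * norm a \<partial>(torus :: ('n \<Rightarrow> real) measure))"
    unfolding H0_def by (intro integral_mono integrable_H0) (auto simp: abs_inner_Et)
  then show ?thesis by simp
qed

lemma H0_lipschitz: "\<bar>H0 a - H0 b\<bar> \<le> CARD('n) * norm (a - b :: 'n::finite state)"
  using H0_triangle[of "a - b" b] H0_triangle[of "b - a" a] H0_le[of "a - b"] H0_le[of "b - a"]
  by (simp add: norm_minus_commute abs_le_iff)

lemma H0_continuous: "continuous_on A (H0 :: 'n::finite state \<Rightarrow> real)"
proof (rule continuous_on_subset[of UNIV])
  show "continuous_on UNIV (H0 :: 'n state \<Rightarrow> real)"
  proof (rule lipschitz_on_continuous_on[of "real CARD('n)"], rule lipschitz_onI)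
    show "dist (H0 a) (H0 b) \<le> real CARD('n) * dist a b" for a b :: "'n state"
      using H0_lipschitz[of a b] by (simp add: dist_norm)
  qed simp
qed simp

lemma H0_zero [simp]: "H0 0 = 0"
  by (simp add: H0_def)

lemma not_AE_torus_False: "\<not> (AE \<theta> in torus. False)"
  using torus.AE_False by simp

lemma H0_pos: "a \<noteq> 0 \<Longrightarrow> 0 < H0 a"
proof (rule ccontr)
  assume a: "a \<noteq> 0" and "\<not> 0 < H0 a"
  then have "H0 a = 0" using H0_nonneg[of a] by simp
  then have "AE \<theta> in torus. \<bar>a \<bullet> Et \<theta>\<bar> = 0"
    unfolding H0_def by (subst (asm) integral_nonneg_eq_0_iff_AE[OF integrable_H0]) auto
  then have "AE \<theta> in (torus :: ('a \<Rightarrow> real) measure). False"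
    using AE_inner_Et_neq[OF a, of 0] by eventually_elim auto
  then show False using not_AE_torus_False by blast
qed

lemma H0_lower: "\<exists>c>0. \<forall>a::'n::finite state. c * norm a \<le> H0 a"
proof -
  have "\<exists>m\<in>sphere (0::'n state) 1. \<forall>a\<in>sphere (0::'n state) 1. H0 m \<le> H0 a"
  proof (rule continuous_attains_inf)
    show "sphere (0::'n state) 1 \<noteq> {}" by (simp add: sphere_eq_empty)
  qed (auto intro: H0_continuous)
  then obtain m :: "'n state" where "m \<in> sphere 0 1" "\<forall>a\<in>sphere (0::'n state) 1. H0 m \<le> H0 a" by blast
  then have m: "norm m = 1" "\<And>a::'n state. norm a = 1 \<Longrightarrow> H0 m \<le> H0 a" by auto
  have "H0 m * norm a \<le> H0 a" for a :: "'n state"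
  proof (cases "a = 0")
    case False
    have "H0 m \<le> H0 ((1 / norm a) *\<^sub>R a)" using False by (intro m) simp
    then show ?thesis using False by (simp add: H0_scale field_simps)
  qed simp
  moreover have "0 < H0 m" using m by (intro H0_pos) auto
  ultimately show ?thesis by blast
qed

section \<open>The dual norm and its gradient\<close>

definition rho0 :: "'n::finite state \<Rightarrow> real" where
  "rho0 x = (SUP a\<in>{a. H0 a \<le> 1}. x \<bullet> a)"

lemma compact_H0_ball: "compact {a::'n::finite state. H0 a \<le> 1}" "compact {a::'n::finite state. H0 a = 1}"
proof -
  obtain c where c: "c > 0" "\<And>a::'n state. c * norm a \<le> H0 a" using H0_lower by blast
  have b: "norm a \<le> 1 / c" if "H0 a \<le> 1" for a :: "'n state"
    using order_trans[OF c(2) that] c(1) by (simp add: field_simps)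
  show "compact {a::'n state. H0 a \<le> 1}" unfolding compact_eq_bounded_closed
    using b by (auto intro!: boundedI[where B = "1 / c"] closed_Collect_le H0_continuous continuous_intros)
  show "compact {a::'n state. H0 a = 1}" unfolding compact_eq_bounded_closed
    using b by (auto intro!: boundedI[where B = "1 / c"] closed_Collect_eq H0_continuous continuous_intros)
qed

lemma rho0_attained:
  fixes x :: "'n::finite state"
  shows "\<exists>a. H0 a \<le> 1 \<and> x \<bullet> a = rho0 x \<and> (\<forall>b. H0 b \<le> 1 \<longrightarrow> x \<bullet> b \<le> rho0 x)"
proof -
  have "\<exists>a\<in>{a. H0 a \<le> 1}. \<forall>b\<in>{a. H0 a \<le> 1}. x \<bullet> b \<le> x \<bullet> a"
    by (intro continuous_attains_sup compact_H0_ball) (auto intro!: exI[of _ 0] continuous_intros)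
  then obtain a where a: "H0 a \<le> 1" "\<And>b. H0 b \<le> 1 \<Longrightarrow> x \<bullet> b \<le> x \<bullet> a" by auto
  have "rho0 x = x \<bullet> a" unfolding rho0_def
    using a by (intro cSup_eq_maximum) auto
  then show ?thesis using a by auto
qed

lemma rho0_ge: "H0 b \<le> 1 \<Longrightarrow> x \<bullet> b \<le> rho0 x"
  using rho0_attained by blast

lemma rho0_pos: "x \<noteq> 0 \<Longrightarrow> 0 < rho0 x"
proof -
  assume x: "x \<noteq> 0"
  have "x \<bullet> ((1 / H0 x) *\<^sub>R x) \<le> rho0 x" using H0_pos[OF x] by (intro rho0_ge) (simp add: H0_scale)
  moreover have "0 < x \<bullet> ((1 / H0 x) *\<^sub>R x)" using H0_pos[OF x] x by simp
  ultimately show ?thesis by simp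
qed

lemma rho0_zero [simp]: "rho0 0 = 0"
  using rho0_attained[of 0] by auto

lemma rho0_holder: "x \<bullet> a \<le> rho0 x * H0 a"
proof (cases "a = 0")
  case False
  have "x \<bullet> ((1 / H0 a) *\<^sub>R a) \<le> rho0 x" using H0_pos[OF False] by (intro rho0_ge) (simp add: H0_scale)
  then show ?thesis using H0_pos[OF False] by (simp add: field_simps)
qed simp

lemma rho0_eq_bound:
  assumes "\<And>b. H0 b \<le> 1 \<Longrightarrow> x \<bullet> b \<le> r" "H0 a \<le> 1" "x \<bullet> a = r"
  shows "rho0 x = r"
  using rho0_attained[of x] assms by (metis order_antisym rho0_ge)

text \<open>The choice is harmless away from the origin, where \<open>phat_unique\<close> shows that
  there is only one maximizer.\<close>

definition phat :: "'n::finite state \<Rightarrow> 'n state" where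
  "phat x = (SOME p. H0 p = 1 \<and> x \<bullet> p = rho0 x)"

lemma phat:
  assumes "x \<noteq> 0"
  shows "H0 (phat x) = 1" "x \<bullet> phat x = rho0 x"
proof -
  obtain a where a: "H0 a \<le> 1" "x \<bullet> a = rho0 x" using rho0_attained by blast
  have "rho0 x \<le> rho0 x * H0 a" using rho0_holder[of x a] a by simp
  then have "H0 a = 1" using a rho0_pos[OF assms] by simp
  then have "\<exists>p. H0 p = 1 \<and> x \<bullet> p = rho0 x" using a by blast
  then have "H0 (phat x) = 1 \<and> x \<bullet> phat x = rho0 x" unfolding phat_def by (rule someI_ex)
  then show "H0 (phat x) = 1" "x \<bullet> phat x = rho0 x" by auto
qed

text \<open>By the duality inequality \<open>rho0 x * H0 a - x \<bullet> a\<close> is nonnegative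
  for all a and vanishes at p, so its derivative there is zero. This replaces a Lagrange multiplier
  argument.\<close>

lemma Gam_maximizer:
  assumes "x \<noteq> 0" "H0 p = 1" "x \<bullet> p = rho0 x"
  shows "rho0 x *\<^sub>R Gam p = x"
proof -
  have p: "p \<noteq> 0" using assms by auto
  have g: "((\<lambda>a. rho0 x * H0 a - x \<bullet> a) has_derivative (\<lambda>h. rho0 x * (h \<bullet> Gam p) - x \<bullet> h)) (at p)"
    using GDERIV_H0[OF p] unfolding gderiv_def by (auto intro!: derivative_eq_intros)
  have "(\<lambda>h. rho0 x * (h \<bullet> Gam p) - x \<bullet> h) = (\<lambda>h. 0)"
    by (rule differential_zero_maxmin[OF _ open_UNIV g]) (use assms rho0_holder[of x] in \<open>auto simp: \<close>)
  then have "rho0 x * (h \<bullet> Gam p) - x \<bullet> h = 0" for h by meson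
  then have "(rho0 x *\<^sub>R Gam p - x) \<bullet> h = 0" for h by (simp add: inner_diff_left inner_diff_right inner_commute)
  then show ?thesis by (metis inner_eq_zero_iff right_minus_eq)
qed

text \<open>Phases orthogonal to the components of \<open>s\<close> give s \<bullet> E = 0, and a
  whole box around them stays below 1.\<close>

lemma not_AE_outside:
  fixes s :: "'n::finite state"
  shows "\<not> (AE \<theta> in torus. 1 \<le> \<bar>s \<bullet> Et \<theta>\<bar>)"
proof
  assume ae: "AE \<theta> in torus. 1 \<le> \<bar>s \<bullet> Et \<theta>\<bar>"
  have "\<exists>\<alpha>. s $ i \<bullet> cs \<alpha> = 0 \<and> 0 \<le> \<alpha> \<and> \<alpha> < 2*pi" for i
  proof (cases "s $ i = 0")
    case True then show ?thesis by (intro exI[of _ 0]) simp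
  next
    case False
    have "norm (rot90 (sgn (s $ i))) = 1"
      using norm_sgn[of "s $ i"] False by (simp add: rot90_def norm_prod_def add.commute)
    then obtain \<alpha> where \<alpha>: "rot90 (sgn (s $ i)) = cs \<alpha>" "0 \<le> \<alpha>" "\<alpha> < 2*pi" using unit_eq_cs by blast
    have "sgn (s $ i) \<bullet> rot90 (sgn (s $ i)) = 0"
      by (cases "sgn (s $ i)") (simp add: rot90_def)
    then have "s $ i \<bullet> rot90 (sgn (s $ i)) = 0"
      using False by (subst (asm) (1) sgn_div_norm) simp
    then show ?thesis using \<alpha> by auto
  qed
  then obtain \<theta> where \<theta>: "\<And>i. s $ i \<bullet> cs (\<theta> i) = 0" "\<And>i. 0 \<le> \<theta> i" "\<And>i. \<theta> i < 2*pi" by metis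
  have S: "s \<bullet> Et \<theta> = 0" by (simp add: inner_Et \<theta>)
  define L where "L = 1 + (\<Sum>i\<in>UNIV. norm (s $ i))"
  have L: "L > 0" unfolding L_def by (intro add_pos_nonneg sum_nonneg) auto
  define \<epsilon> where "\<epsilon> = 1 / (4 * L)"
  have \<epsilon>: "\<epsilon> > 0" "2 * \<epsilon> * L < 1" using L by (auto simp: \<epsilon>_def)
  have good: "\<bar>s \<bullet> Et \<phi>\<bar> < 1" if "\<phi> \<in> tbox \<theta> \<epsilon>" for \<phi>
  proof -
    have c: "\<bar>\<phi> i - \<theta> i\<bar> \<le> \<epsilon>" for i using that by (auto simp: tbox_iff less_imp_le abs_le_iff) (smt (verit))+
    have "\<bar>s \<bullet> Et \<phi> - s \<bullet> Et \<theta>\<bar> \<le> 2 * \<epsilon> * (\<Sum>i\<in>UNIV. norm (s $ i))" by (rule inner_Et_diff[OF c])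
    also have "\<dots> \<le> 2 * \<epsilon> * L" using \<epsilon> unfolding L_def by (intro mult_left_mono) auto
    finally show ?thesis using \<epsilon>(2) S by simp
  qed
  have "AE \<phi> in torus. \<phi> \<notin> tbox \<theta> \<epsilon>" using ae by eventually_elim (use good in force)
  then have "emeasure torus (tbox \<theta> \<epsilon>) = 0"
    by (subst (asm) AE_iff_measurable[OF tbox_sets[of \<theta> \<epsilon>]]) auto
  then show False using emeasure_tbox_pos[of \<theta> \<epsilon>] \<theta> \<epsilon> by simp
qed

lemma Kap_pos: "0 < Kap s"
proof -
  have i: "integrable torus (\<lambda>\<theta>. kap (s \<bullet> Et \<theta>))"
    by (rule integrable_torus_bounded[where C = 1]) (auto simp: kap_nonneg kap_le)
  have "Kap s \<noteq> 0"
  proof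
    assume "Kap s = 0"
    then have "AE \<theta> in torus. kap (s \<bullet> Et \<theta>) = 0"
      unfolding Kap_def by (subst (asm) integral_nonneg_eq_0_iff_AE[OF i]) (auto simp: kap_nonneg)
    then have "AE \<theta> in torus. 1 \<le> \<bar>s \<bullet> Et \<theta>\<bar>"
      by eventually_elim (metis kap_pos less_irrefl not_le)
    then show False using not_AE_outside by blast
  qed
  moreover have "0 \<le> Kap s" unfolding Kap_def by (simp add: kap_nonneg)
  ultimately show ?thesis by simp
qed

text \<open>Equal values force the nonnegative integrand of \<open>Psi_mono_eq\<close> to vanish
  almost everywhere. Where s \<bullet> E and t \<bullet> E differ, strictness of \<open>psi\<close>
  then pushes both outside (-1, 1), which \<open>not_AE_outside\<close> excludes.\<close>

lemma Psi_injective: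
  assumes "Psi s = Psi t" shows "s = t"
proof (rule ccontr)
  assume "s \<noteq> t"
  then have st: "s - t \<noteq> 0" by simp
  have i: "integrable torus (\<lambda>\<theta>. (psi (s \<bullet> Et \<theta>) - psi (t \<bullet> Et \<theta>)) * ((s - t) \<bullet> Et \<theta>))"
    using Bochner_Integration.integrable_diff[OF integrable_Psi_inner[of s "s - t"] integrable_Psi_inner[of t "s - t"]]
    by (simp add: left_diff_distrib)
  have "(\<integral>\<theta>. (psi (s \<bullet> Et \<theta>) - psi (t \<bullet> Et \<theta>)) * ((s - t) \<bullet> Et \<theta>) \<partial>torus) = 0"
    using Psi_mono_eq[of s t] assms by simp
  then have "AE \<theta> in torus. (psi (s \<bullet> Et \<theta>) - psi (t \<bullet> Et \<theta>)) * ((s - t) \<bullet> Et \<theta>) = 0"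
    by (subst (asm) integral_nonneg_eq_0_iff_AE[OF i]) (auto intro!: psi_mono_product)
  then have "AE \<theta> in torus. 1 \<le> \<bar>s \<bullet> Et \<theta>\<bar>"
    using AE_inner_Et_neq[OF st, of 0]
  proof eventually_elim
    case (elim \<theta>)
    then have "psi (s \<bullet> Et \<theta>) = psi (t \<bullet> Et \<theta>)" "s \<bullet> Et \<theta> \<noteq> t \<bullet> Et \<theta>" by (auto simp: inner_diff_left)
    then show ?case using psi_less[of "s \<bullet> Et \<theta>" "t \<bullet> Et \<theta>"] psi_less[of "t \<bullet> Et \<theta>" "s \<bullet> Et \<theta>"]
      by (metis less_irrefl linorder_neqE_linordered_idom not_le)
  qed
  then show False using not_AE_outside by blast
qed

lemma vec_eqI_axis: "(\<And>v. x \<bullet> axis k v = y \<bullet> axis k v) \<Longrightarrow> x $ k = (y :: 'n::finite state) $ k"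
  unfolding inner_axis using vector_eq_rdot by blast

lemma Gam_nth:
  assumes "a $ k \<noteq> 0"
  shows "Gam a $ k = Kap (slope k a) *\<^sub>R sgn (a $ k)"
    and "i \<noteq> k \<Longrightarrow> Gam a $ i = Psi (slope k a) $ i"
proof -
  have "Gam a \<bullet> axis k v = axis k (Kap (slope k a) *\<^sub>R sgn (a $ k)) \<bullet> axis k v" for v
    unfolding Gam_reduce[OF assms]
    using Psi_nth_zero[of "slope k a" k] by (simp add: inner_axis slope_def inner_commute[of v])
  then show "Gam a $ k = Kap (slope k a) *\<^sub>R sgn (a $ k)"
    using vec_eqI_axis[of "Gam a" k "axis k (Kap (slope k a) *\<^sub>R sgn (a $ k))"] by simp
  assume ik: "i \<noteq> k"
  have "Gam a \<bullet> axis i v = Psi (slope k a) \<bullet> axis i v" for v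
    unfolding Gam_reduce[OF assms] using ik by (simp add: axis_def)
  then show "Gam a $ i = Psi (slope k a) $ i" by (rule vec_eqI_axis)
qed

lemma Gam_nth_zero:
  assumes "a $ k = 0" shows "Gam a $ k = 0"
proof -
  have "Gam a \<bullet> axis k v = 0 \<bullet> axis k v" for v
  proof -
    have ax: "axis k v $ k = v" "del k (axis k v) = 0"
      by (auto simp: axis_def del_def vec_eq_iff)
    have "Gam a \<bullet> axis k v = (\<integral>\<theta>. (\<integral>w. sgn (a \<bullet> Et \<theta>) * (v \<bullet> cs w) \<partial>unif) \<partial>torus)"
      unfolding Gam_inner
      by (subst integral_resample[OF integrable_Gam_inner, where k = k])
         (simp add: inner_Et_update assms del_id[OF assms] ax)
    then show ?thesis by (simp add: integral_cs_zero)
  qed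
  from vec_eqI_axis[OF this] show ?thesis by simp
qed

text \<open>\<open>Kap\<close> is positive, so the direction of each component of a maximizer, and
  whether it vanishes, can be read off from its gradient.\<close>

lemma sgn_Gam: "sgn (Gam a $ k) = sgn (a $ k)"
proof (cases "a $ k = 0")
  case False
  then show ?thesis using Gam_nth(1)[OF False] Kap_pos[of "slope k a"] by (simp add: sgn_scaleR sgn_div_norm[of "sgn (a $ k)"] norm_sgn)
qed (simp add: Gam_nth_zero)

lemma Psi_slope:
  assumes "a $ k \<noteq> 0" shows "Psi (slope k a) = del k (Gam a)"
  using Gam_nth(2)[OF assms] Psi_nth_zero[of "slope k a" k] by (auto simp: vec_eq_iff slope_def)

lemma state_from_slope:
  "a = norm (a $ k) *\<^sub>R (slope k a + axis k (sgn (a $ k)))" if "a $ k \<noteq> 0"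
  using that by (auto simp: vec_eq_iff slope_def axis_def sgn_div_norm)

text \<open>The gradient determines the direction of component k by \<open>sgn_Gam\<close> and the
  slope by \<open>Psi_injective\<close>; the remaining scale is fixed by
  \<open>H0 = 1\<close>.\<close>

lemma Gam_injective:
  assumes "H0 p = 1" "H0 q = 1" "Gam p = Gam q"
  shows "p = q"
proof -
  have "p \<noteq> 0" using assms by auto
  then obtain k where k: "p $ k \<noteq> 0" by (auto simp: vec_eq_iff)
  have sg: "sgn (p $ k) = sgn (q $ k)" using sgn_Gam[of p k] sgn_Gam[of q k] assms by simp
  then have k': "q $ k \<noteq> 0" using k by (metis sgn_zero_iff)
  have sl: "slope k p = slope k q" using Psi_slope[OF k] Psi_slope[OF k'] assms
    by (simp add: Psi_injective)
  define w where "w = slope k p + axis k (sgn (p $ k))"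
  have pw: "p = norm (p $ k) *\<^sub>R w" "q = norm (q $ k) *\<^sub>R w"
    using state_from_slope[OF k] state_from_slope[OF k'] sg sl by (auto simp: w_def)
  have "norm (p $ k) * H0 w = 1" "norm (q $ k) * H0 w = 1"
    using assms(1,2) H0_scale[of "norm (p $ k)" w] H0_scale[of "norm (q $ k)" w] pw by auto
  then have "norm (p $ k) = norm (q $ k)"
    by (cases "H0 w = 0") (simp, metis mult_right_cancel)
  then show ?thesis using pw(1) by (subst pw(2)) simp
qed

lemma Gam_phat: "x \<noteq> 0 \<Longrightarrow> Gam (phat x) = (1 / rho0 x) *\<^sub>R x"
proof -
  assume x: "x \<noteq> 0"
  have "(1 / rho0 x) *\<^sub>R (rho0 x *\<^sub>R Gam (phat x)) = (1 / rho0 x) *\<^sub>R x"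
    using Gam_maximizer[OF x phat[OF x]] by simp
  then show ?thesis using rho0_pos[OF x] by simp
qed

lemma phat_unique:
  assumes "x \<noteq> 0" "H0 p = 1" "x \<bullet> p = rho0 x"
  shows "phat x = p"
proof (rule Gam_injective)
  show "H0 (phat x) = 1" using phat assms by blast
  have "rho0 x *\<^sub>R Gam (phat x) = rho0 x *\<^sub>R Gam p"
    using Gam_maximizer[OF assms] Gam_maximizer[OF assms(1) phat[OF assms(1)]] by simp
  then show "Gam (phat x) = Gam p" using rho0_pos[OF assms(1)] by simp
qed (rule assms)

lemma rho0_sub:
  assumes "p \<noteq> 0" shows "rho0 p + phat p \<bullet> (q - p) \<le> rho0 q"
  using rho0_ge[of "phat p" q] phat[OF assms] by (simp add: inner_diff_right inner_commute)

lemma rho0_continuous: "continuous_on A (rho0 :: 'n::finite state \<Rightarrow> real)"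
proof (rule continuous_on_subset[of UNIV])
  obtain c where c: "c > 0" "\<And>a::'n state. c * norm a \<le> H0 a" using H0_lower by blast
  have le: "rho0 x - rho0 y \<le> 1 / c * norm (x - y)" for x y :: "'n state"
  proof -
    obtain a where a: "H0 a \<le> 1" "x \<bullet> a = rho0 x" using rho0_attained by blast
    have "rho0 x - rho0 y \<le> x \<bullet> a - y \<bullet> a" using a rho0_ge[of a y] by simp
    also have "\<dots> \<le> norm (x - y) * norm a" using norm_cauchy_schwarz[of "x - y" a] by (simp add: inner_diff_left)
    also have "\<dots> \<le> norm (x - y) * (1 / c)"
      using order_trans[OF c(2) a(1)] c(1) by (intro mult_left_mono) (auto simp: field_simps)
    finally show ?thesis by (simp add: mult.commute)
  qed
  show "continuous_on UNIV (rho0 :: 'n state \<Rightarrow> real)"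
  proof (rule lipschitz_on_continuous_on[of "1 / c"], rule lipschitz_onI)
    show "dist (rho0 x) (rho0 y) \<le> 1 / c * dist x y" for x y :: "'n state"
      using le[of x y] le[of y x] by (simp add: dist_norm norm_minus_commute abs_le_iff)
  qed (use c in simp)
qed simp

text \<open>A closed graph with values in a compact set: by uniqueness the graph is cut out by the
  closed condition of being a maximizer.\<close>

lemma phat_continuous: "continuous_on (- {0}) (phat :: 'n::finite state \<Rightarrow> 'n state)"
proof (rule iffD2[OF continuous_closed_graph_eq[of "{a :: 'n state. H0 a = 1}"]])
  let ?S = "- {0} :: 'n state set" and ?T = "{a :: 'n state. H0 a = 1}"
  show "compact ?T" by (rule compact_H0_ball)
  show "phat \<in> ?S \<rightarrow> ?T" using phat(1) by auto
  have "(\<lambda>x. (x, phat x)) ` ?S = (?S \<times> ?T) \<inter> {z. fst z \<bullet> snd z = rho0 (fst z)}"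
  proof (intro set_eqI iffI)
    fix z assume "z \<in> (?S \<times> ?T) \<inter> {z. fst z \<bullet> snd z = rho0 (fst z)}"
    then have "fst z \<in> ?S" "z = (fst z, phat (fst z))"
      using phat_unique[of "fst z" "snd z"] by (auto simp: prod_eq_iff mem_Times_iff)
    then show "z \<in> (\<lambda>x. (x, phat x)) ` ?S" by blast
  qed (auto simp: phat)
  moreover have "closed {z :: 'n state \<times> 'n state. fst z \<bullet> snd z = rho0 (fst z)}"
    by (intro closed_Collect_eq continuous_intros continuous_on_compose2[OF rho0_continuous[of UNIV]]) auto
  ultimately show "closedin (top_of_set (?S \<times> ?T)) ((\<lambda>x. (x, phat x)) ` ?S)"
    by (simp add: closedin_closed_Int)
qed

lemma isCont_phat: "x \<noteq> 0 \<Longrightarrow> isCont phat x"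
  using phat_continuous continuous_on_eq_continuous_at[of "- {0}" phat] by auto

lemma GDERIV_rho0: "x \<noteq> 0 \<Longrightarrow> GDERIV rho0 x :> phat x"
  by (rule gderiv_of_subgradient[of "- {0}"]) (auto simp: rho0_sub isCont_phat)

lemma rho0_scale: "0 \<le> c \<Longrightarrow> rho0 (c *\<^sub>R x) = c * rho0 x"
proof -
  assume c: "0 \<le> c"
  obtain a where a: "H0 a \<le> 1" "x \<bullet> a = rho0 x" using rho0_attained by blast
  show ?thesis by (rule rho0_eq_bound[of _ _ a]) (use a c rho0_ge in \<open>auto intro: mult_left_mono\<close>)
qed

lemma phat_scale: "0 < c \<Longrightarrow> x \<noteq> 0 \<Longrightarrow> phat (c *\<^sub>R x) = phat x"
  by (rule phat_unique) (auto simp: phat rho0_scale)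

section \<open>The Hessian of the dual norm\<close>

text \<open>Bounds the quotient in \<open>Phi_fatou\<close> by Cauchy-Schwarz: slow growth of
  \<open>Psi\<close> along a sequence bounds the second variation in its limit direction.\<close>

lemma Psi_growth_sequence:
  fixes s :: "'n::finite state"
  assumes X: "X \<longlonglongrightarrow> s" "\<And>n::nat. X n \<noteq> s" and K: "0 \<le> K" "\<And>n. norm (Psi (X n) - Psi s) \<le> K * norm (X n - s)"
    and h: "(\<lambda>n. (1 / norm (X n - s)) *\<^sub>R (X n - s)) \<longlonglongrightarrow> h"
  shows "Phi s h \<le> ennreal K"
proof -
  have t: "0 < norm (X n - s)" for n using X by simp
  have "Phi s h \<le> liminf (\<lambda>n. ennreal ((Psi (X n) - Psi s) \<bullet> (X n - s) / (norm (X n - s))\<^sup>2))"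
    by (rule Phi_fatou[OF X(1) t h])
  also have "\<dots> \<le> liminf (\<lambda>n. ennreal K)"
  proof (intro Liminf_mono always_eventually allI ennreal_leI)
    fix n
    have "(Psi (X n) - Psi s) \<bullet> (X n - s) \<le> norm (Psi (X n) - Psi s) * norm (X n - s)" by (rule norm_cauchy_schwarz)
    also have "\<dots> \<le> (K * norm (X n - s)) * norm (X n - s)" using K by (intro mult_right_mono) auto
    finally show "(Psi (X n) - Psi s) \<bullet> (X n - s) / (norm (X n - s))\<^sup>2 \<le> K"
      using t[of n] by (simp add: pos_divide_le_eq power2_eq_square mult.assoc)
  qed
  finally show ?thesis by (simp add: Liminf_const)
qed

lemma unit_subsequence:
  fixes X :: "nat \<Rightarrow> 'a::euclidean_space"
  assumes "\<And>n. X n \<noteq> s"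
  obtains h r where "norm h = 1" "strict_mono (r :: nat \<Rightarrow> nat)" "(\<lambda>n. (1 / norm (X (r n) - s)) *\<^sub>R (X (r n) - s)) \<longlonglongrightarrow> h"
proof -
  have "seq_compact (sphere (0::'a) 1)" by (simp add: compact_imp_seq_compact)
  moreover have "\<forall>n. (1 / norm (X n - s)) *\<^sub>R (X n - s) \<in> sphere 0 1" using assms by simp
  ultimately obtain h r where "h \<in> sphere (0::'a) 1" "strict_mono (r :: nat \<Rightarrow> nat)" "((\<lambda>n. (1 / norm (X n - s)) *\<^sub>R (X n - s)) \<circ> r) \<longlonglongrightarrow> h"
    by (rule seq_compactE)
  then show ?thesis using that by (simp add: comp_def)
qed

lemma not_eventually_nhds_sequence:
  fixes s :: "'a::metric_space"
  assumes "\<And>n. \<not> eventually (P n) (nhds s)"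
  obtains X where "X \<longlonglongrightarrow> s" "\<And>n::nat. \<not> P n (X n)"
proof -
  have "\<exists>x. dist x s < inverse (real (Suc n)) \<and> \<not> P n x" for n
    using assms[of n] unfolding eventually_nhds_metric by (auto simp del: of_nat_Suc)
  then obtain X where X: "\<And>n. dist (X n) s < inverse (real (Suc n))" "\<And>n. \<not> P n (X n)" by metis
  have "X \<longlonglongrightarrow> s"
    by (rule tendsto_dist_iff[THEN iffD2], rule tendsto_sandwich[OF _ _ tendsto_const LIMSEQ_inverse_real_of_nat])
       (use X(1) in \<open>auto intro!: always_eventually less_imp_le\<close>)
  then show ?thesis using X that by blast
qed

text \<open>If no constant worked, some sequence would have a unit limit direction with second
  variation 0, against \<open>Phi_pos\<close>. Differentiability of \<open>Psi\<close> is not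
  assumed.\<close>

lemma Psi_growth:
  fixes s :: "'n::finite state"
  assumes s: "\<And>i. norm (s $ i) \<le> 1"
  obtains c where "0 < c" "eventually (\<lambda>t. c * norm (t - s) \<le> norm (Psi t - Psi s)) (nhds s)"
proof (rule ccontr)
  assume neg: "\<not> thesis"
  have "\<not> eventually (\<lambda>t. inverse (real (Suc n)) * norm (t - s) \<le> norm (Psi t - Psi s)) (nhds s)" for n
    using that[of "inverse (real (Suc n))"] neg by auto
  then obtain X where X: "X \<longlonglongrightarrow> s" "\<And>n. \<not> inverse (real (Suc n)) * norm (X n - s) \<le> norm (Psi (X n) - Psi s)"
    using not_eventually_nhds_sequence[of "\<lambda>n t. inverse (real (Suc n)) * norm (t - s) \<le> norm (Psi t - Psi s)" s] by blast
  have ne: "X n \<noteq> s" for n using X(2)[of n] by auto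
  obtain h r where h: "norm h = 1" "strict_mono (r :: nat \<Rightarrow> nat)" "(\<lambda>n. (1 / norm (X (r n) - s)) *\<^sub>R (X (r n) - s)) \<longlonglongrightarrow> h"
    using unit_subsequence[of X s] ne by blast
  \<comment> \<open>Without the first m terms all growth constants are at most 1/(m+1), because
    \<open>r k \<ge> k\<close>.\<close>
  have "Phi s h \<le> ennreal (inverse (real (Suc m)))" for m
  proof (rule Psi_growth_sequence[of "\<lambda>n. X (r (n + m))"])
    show "(\<lambda>n. X (r (n + m))) \<longlonglongrightarrow> s"
      using LIMSEQ_ignore_initial_segment[OF LIMSEQ_subseq_LIMSEQ[OF X(1) h(2)], of m] by (simp add: comp_def)
    show "(\<lambda>n. (1 / norm (X (r (n + m)) - s)) *\<^sub>R (X (r (n + m)) - s)) \<longlonglongrightarrow> h"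
      by (rule LIMSEQ_ignore_initial_segment[OF h(3)])
    fix n
    have "inverse (real (Suc (r (n + m)))) \<le> inverse (real (Suc m))"
      using seq_suble[OF h(2), of "n + m"] by (intro le_imp_inverse_le) auto
    from mult_right_mono[OF this, of "norm (X (r (n + m)) - s)"] X(2)[of "r (n + m)"]
    show "norm (Psi (X (r (n + m))) - Psi s) \<le> inverse (real (Suc m)) * norm (X (r (n + m)) - s)" by simp
  qed (use ne in auto)
  then have "Phi s h \<le> ennreal 0"
    by (intro LIMSEQ_le_const[OF tendsto_ennrealI[OF LIMSEQ_inverse_real_of_nat]]) auto
  moreover have "h \<noteq> 0" using h(1) by auto
  ultimately show False using Phi_pos[OF s, of h] by simp
qed

text \<open>A sequence violating the estimate grows at most linearly, so its limit direction h has
  finite second variation. By \<open>Phi_infinite\<close> the quantity on the left vanishes at h;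
  yet along the normalized sequence it stays above \<epsilon> c, with c the constant of
  \<open>Psi_growth\<close>.\<close>

lemma Psi_growth_critical:
  fixes s :: "'n::finite state"
  assumes si: "norm (s $ i) = 1" and s0: "\<And>j. j \<noteq> i \<Longrightarrow> s $ j = 0" and "0 < \<epsilon>"
  shows "eventually (\<lambda>t. \<bar>s $ i \<bullet> (t - s) $ i\<bar> + (\<Sum>j\<in>UNIV - {i}. norm ((t - s) $ j)) \<le> \<epsilon> * norm (Psi t - Psi s)) (nhds s)"
proof (rule ccontr)
  define q where "q h = \<bar>s $ i \<bullet> h $ i\<bar> + (\<Sum>j\<in>UNIV - {i}. norm (h $ j))" for h :: "'n state"
  assume "\<not> ?thesis"
  then have neg: "\<not> eventually (\<lambda>t. q (t - s) \<le> \<epsilon> * norm (Psi t - Psi s)) (nhds s)" by (simp add: q_def)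
  have sle: "norm (s $ j) \<le> 1" for j using si s0[of j] by (cases "j = i") auto
  obtain c where c: "0 < c" "eventually (\<lambda>t. c * norm (t - s) \<le> norm (Psi t - Psi s)) (nhds s)"
    using Psi_growth[OF sle] by blast
  \<comment> \<open>The lower growth bound is carried as a premise, so that the violating sequence
    satisfies it at every index.\<close>
  have "\<not> eventually (\<lambda>t. c * norm (t - s) \<le> norm (Psi t - Psi s) \<longrightarrow> q (t - s) \<le> \<epsilon> * norm (Psi t - Psi s)) (nhds s)"
  proof
    assume "eventually (\<lambda>t. c * norm (t - s) \<le> norm (Psi t - Psi s) \<longrightarrow> q (t - s) \<le> \<epsilon> * norm (Psi t - Psi s)) (nhds s)"
    then have "eventually (\<lambda>t. q (t - s) \<le> \<epsilon> * norm (Psi t - Psi s)) (nhds s)"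
      using c(2) by eventually_elim blast
    then show False using neg by blast
  qed
  then obtain X where X: "X \<longlonglongrightarrow> s" "\<And>n::nat. \<not> (c * norm (X n - s) \<le> norm (Psi (X n) - Psi s) \<longrightarrow> q (X n - s) \<le> \<epsilon> * norm (Psi (X n) - Psi s))"
    using not_eventually_nhds_sequence[of "\<lambda>_ t. c * norm (t - s) \<le> norm (Psi t - Psi s) \<longrightarrow> q (t - s) \<le> \<epsilon> * norm (Psi t - Psi s)" s] by blast
  have ne: "X n \<noteq> s" for n
  proof
    assume "X n = s"
    then show False using X(2)[of n] by (simp add: q_def)
  qed
  obtain h r where h: "norm h = 1" "strict_mono (r :: nat \<Rightarrow> nat)" "(\<lambda>n. (1 / norm (X (r n) - s)) *\<^sub>R (X (r n) - s)) \<longlonglongrightarrow> h"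
    using unit_subsequence[of X s] ne by blast
  have qscale: "q (a *\<^sub>R v) = a * q v" if "0 \<le> a" for a v
    using that by (simp add: q_def abs_mult sum_distrib_left distrib_left)
  have q_le: "q v \<le> (1 + CARD('n)) * norm v" for v
  proof -
    have "\<bar>s $ i \<bullet> v $ i\<bar> \<le> norm v"
      using Cauchy_Schwarz_ineq2[of "s $ i" "v $ i"] si Finite_Cartesian_Product.norm_nth_le[of v i] by simp
    moreover have "(\<Sum>j\<in>UNIV - {i}. norm (v $ j)) \<le> (\<Sum>j\<in>UNIV - {i}. norm v)"
      by (intro sum_mono Finite_Cartesian_Product.norm_nth_le)
    moreover have "(\<Sum>j\<in>UNIV - {i}. norm v) \<le> CARD('n) * norm v"
      by (simp add: card_Diff_singleton mult_right_mono)
    ultimately show ?thesis unfolding q_def by (simp add: distrib_right)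
  qed
  define K where "K = (1 + CARD('n)) / \<epsilon>"
  have "Phi s h \<le> ennreal K"
  proof (rule Psi_growth_sequence[of "\<lambda>n. X (r n)"])
    show "(\<lambda>n. X (r n)) \<longlonglongrightarrow> s" using LIMSEQ_subseq_LIMSEQ[OF X(1) h(2)] by (simp add: comp_def)
    fix n
    have "\<epsilon> * norm (Psi (X (r n)) - Psi s) \<le> (1 + CARD('n)) * norm (X (r n) - s)"
      using X(2)[of "r n"] q_le[of "X (r n) - s"] by linarith
    then show "norm (Psi (X (r n)) - Psi s) \<le> K * norm (X (r n) - s)"
      using \<open>0 < \<epsilon>\<close> by (simp add: K_def field_simps)
  qed (use ne h(3) \<open>0 < \<epsilon>\<close> in \<open>auto simp: K_def\<close>)
  then have "Phi s h \<noteq> \<infinity>" by (auto simp: top_unique)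
  then have "s $ i \<bullet> h $ i = 0" "\<And>j. j \<noteq> i \<Longrightarrow> h $ j = 0"
    using Phi_infinite[OF si s0, of h] by blast+
  then have "q h = 0" by (simp add: q_def)
  have "(\<lambda>n. q ((1 / norm (X (r n) - s)) *\<^sub>R (X (r n) - s))) \<longlonglongrightarrow> q h"
    unfolding q_def by (intro tendsto_intros h(3))
  moreover have "\<epsilon> * c \<le> q ((1 / norm (X (r n) - s)) *\<^sub>R (X (r n) - s))" for n
  proof -
    have "0 < norm (X (r n) - s)" using ne by simp
    moreover have "\<epsilon> * (c * norm (X (r n) - s)) \<le> q (X (r n) - s)"
      using X(2)[of "r n"] \<open>0 < \<epsilon>\<close> mult_left_mono[of "c * norm (X (r n) - s)" "norm (Psi (X (r n)) - Psi s)" \<epsilon>] by linarith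
    ultimately show ?thesis by (subst qscale) (auto simp: field_simps)
  qed
  ultimately have "\<epsilon> * c \<le> q h" by (intro LIMSEQ_le_const) auto
  then show False using \<open>q h = 0\<close> c(1) \<open>0 < \<epsilon>\<close> mult_pos_pos[of \<epsilon> c] by linarith
qed

section \<open>Differentiating an inverse at a single point\<close>

lemma derivative_lipschitz_at:
  assumes "(\<zeta> has_derivative \<zeta>') (at y)"
  obtains B where "0 < B" "eventually (\<lambda>x. norm (\<zeta> x - \<zeta> y) \<le> B * norm (x - y)) (nhds y)"
proof -
  obtain B where B: "\<And>h. norm (\<zeta>' h) \<le> norm h * B" "0 < B"
    using bounded_linear.pos_bounded[OF has_derivative_bounded_linear[OF assms]] by blast
  have "((\<lambda>x. norm (\<zeta> x - \<zeta> y - \<zeta>' (x - y)) / norm (x - y)) \<longlongrightarrow> 0) (at y)"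
    using assms unfolding has_derivative_iff_norm by blast
  then have "eventually (\<lambda>x. norm (\<zeta> x - \<zeta> y - \<zeta>' (x - y)) / norm (x - y) < 1) (at y)"
    by (rule order_tendstoD) simp
  then have "eventually (\<lambda>x. norm (\<zeta> x - \<zeta> y) \<le> (B + 1) * norm (x - y)) (at y)"
    using eventually_neq_at_within[of y y UNIV]
  proof eventually_elim
    case (elim x)
    then have "norm (\<zeta> x - \<zeta> y - \<zeta>' (x - y)) \<le> norm (x - y)" by (simp add: divide_less_eq_1)
    moreover have "norm (\<zeta> x - \<zeta> y) \<le> norm (\<zeta> x - \<zeta> y - \<zeta>' (x - y)) + norm (\<zeta>' (x - y))"
      using norm_triangle_ineq[of "\<zeta> x - \<zeta> y - \<zeta>' (x - y)" "\<zeta>' (x - y)"] by simp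
    ultimately show ?case using B(1)[of "x - y"] by (simp add: distrib_right mult.commute)
  qed
  then have "eventually (\<lambda>x. norm (\<zeta> x - \<zeta> y) \<le> (B + 1) * norm (x - y)) (nhds y)"
    by (subst eventually_nhds_conv_at) simp
  then show ?thesis using B(2) by (intro that[of "B + 1"]) auto
qed

text \<open>F is differentiable at one point only. The growth bound makes
  \<open>norm (\<sigma> x - \<sigma> y)\<close> of the order of \<open>norm (x - y)\<close>, so the
  remainder of F is negligible and a left inverse of \<open>F'\<close> can be applied.\<close>

lemma implicit_differentiable:
  fixes F :: "'b::euclidean_space \<Rightarrow> 'b" and \<sigma> :: "'a::real_normed_vector \<Rightarrow> 'b"
  assumes F: "(F has_derivative F') (at (\<sigma> y))" and inj: "\<And>h. F' h = 0 \<Longrightarrow> h = 0"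
    and cont: "isCont \<sigma> y" and \<zeta>: "(\<zeta> has_derivative \<zeta>') (at y)"
    and eq: "eventually (\<lambda>x. F (\<sigma> x) = \<zeta> x) (nhds y)"
    and c: "0 < c" "eventually (\<lambda>s. c * norm (s - \<sigma> y) \<le> norm (F s - F (\<sigma> y))) (nhds (\<sigma> y))"
  shows "\<sigma> differentiable (at y)"
proof -
  have lin: "linear F'" using has_derivative_linear[OF F] .
  have "inj F'" using linear_injective_0[OF lin] inj by blast
  then obtain L where L: "linear L" "L \<circ> F' = id" using linear_injective_left_inverse[OF lin] by blast
  interpret L: bounded_linear L using L(1) linear_conv_bounded_linear by blast
  obtain K where K: "\<And>h. norm (L h) \<le> norm h * K" "0 < K" using L.pos_bounded by blast
  obtain B where B: "0 < B" "eventually (\<lambda>x. norm (\<zeta> x - \<zeta> y) \<le> B * norm (x - y)) (nhds y)"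
    using derivative_lipschitz_at[OF \<zeta>] by blast
  have y0: "F (\<sigma> y) = \<zeta> y" using eq by (rule eventually_nhds_x_imp_x)
  define R where "R s = norm (F s - F (\<sigma> y) - F' (s - \<sigma> y)) / norm (s - \<sigma> y)" for s
  have "(R \<longlongrightarrow> 0) (at (\<sigma> y))" using F unfolding has_derivative_iff_norm R_def by blast
  then have "isCont R (\<sigma> y)" unfolding isCont_def by (simp add: R_def)
  then have Rlim: "((\<lambda>x. R (\<sigma> x)) \<longlongrightarrow> 0) (at y)"
    using isCont_o2[OF cont, of R] unfolding isCont_def by (simp add: R_def)
  define Z where "Z x = norm (\<zeta> x - \<zeta> y - \<zeta>' (x - y)) / norm (x - y)" for x
  have Zlim: "(Z \<longlongrightarrow> 0) (at y)" using \<zeta> unfolding has_derivative_iff_norm Z_def by blast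
  have \<sigma>lim: "filterlim \<sigma> (nhds (\<sigma> y)) (nhds y)"
    using cont by (simp add: isCont_def tendsto_at_iff_tendsto_nhds)
  have lip: "eventually (\<lambda>x. c * norm (\<sigma> x - \<sigma> y) \<le> norm (F (\<sigma> x) - F (\<sigma> y))) (at y)"
    using filterlim_iff[THEN iffD1, OF \<sigma>lim] c(2) eventually_nhds_conv_at by blast
  have eq': "eventually (\<lambda>x. F (\<sigma> x) = \<zeta> x) (at y)" and B': "eventually (\<lambda>x. norm (\<zeta> x - \<zeta> y) \<le> B * norm (x - y)) (at y)"
    using eq B(2) eventually_nhds_conv_at by blast+
  have "(\<sigma> has_derivative (\<lambda>h. L (\<zeta>' h))) (at y)"
    unfolding has_derivative_iff_norm
  proof
    show "bounded_linear (\<lambda>h. L (\<zeta>' h))"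
      by (intro bounded_linear_compose[OF L.bounded_linear_axioms] has_derivative_bounded_linear[OF \<zeta>])
    have lim: "((\<lambda>x. K * (R (\<sigma> x) * (B / c) + Z x)) \<longlongrightarrow> 0) (at y)"
      by (rule tendsto_eq_intros Rlim Zlim refl | simp)+
    show "((\<lambda>x. norm (\<sigma> x - \<sigma> y - L (\<zeta>' (x - y))) / norm (x - y)) \<longlongrightarrow> 0) (at y)"
    proof (rule tendsto_0_le[OF lim, of _ 1])
      show "eventually (\<lambda>x. norm (norm (\<sigma> x - \<sigma> y - L (\<zeta>' (x - y))) / norm (x - y)) \<le> norm (K * (R (\<sigma> x) * (B / c) + Z x)) * 1) (at y)"
        using lip eq' B' eventually_neq_at_within[of y y UNIV]
      proof eventually_elim
        case (elim x)
        have xy: "0 < norm (x - y)" using elim by simp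
        have s: "norm (\<sigma> x - \<sigma> y) \<le> (B / c) * norm (x - y)"
          using elim y0 c(1) by (simp add: field_simps)
        have "\<sigma> x - \<sigma> y = L (F' (\<sigma> x - \<sigma> y))" using L(2) by (metis comp_apply id_apply)
        then have "\<sigma> x - \<sigma> y - L (\<zeta>' (x - y)) = L ((\<zeta> x - \<zeta> y - \<zeta>' (x - y)) - (F (\<sigma> x) - F (\<sigma> y) - F' (\<sigma> x - \<sigma> y)))"
          using elim y0 by (simp add: L.diff)
        then have "norm (\<sigma> x - \<sigma> y - L (\<zeta>' (x - y))) \<le> norm ((\<zeta> x - \<zeta> y - \<zeta>' (x - y)) - (F (\<sigma> x) - F (\<sigma> y) - F' (\<sigma> x - \<sigma> y))) * K"
          using K(1) by metis
        also have "\<dots> \<le> (norm (\<zeta> x - \<zeta> y - \<zeta>' (x - y)) + norm (F (\<sigma> x) - F (\<sigma> y) - F' (\<sigma> x - \<sigma> y))) * K"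
          using K(2) by (intro mult_right_mono norm_triangle_ineq4) auto
        also have "norm (F (\<sigma> x) - F (\<sigma> y) - F' (\<sigma> x - \<sigma> y)) = R (\<sigma> x) * norm (\<sigma> x - \<sigma> y)"
          using linear_0[OF lin] by (cases "\<sigma> x = \<sigma> y") (auto simp: R_def)
        also have "norm (\<zeta> x - \<zeta> y - \<zeta>' (x - y)) = Z x * norm (x - y)" using xy by (simp add: Z_def)
        also have "(Z x * norm (x - y) + R (\<sigma> x) * norm (\<sigma> x - \<sigma> y)) * K
            \<le> (Z x * norm (x - y) + R (\<sigma> x) * ((B / c) * norm (x - y))) * K"
          using s K(2) by (intro mult_right_mono add_left_mono mult_left_mono) (auto simp: R_def)
        also have "\<dots> = K * (R (\<sigma> x) * (B / c) + Z x) * norm (x - y)" by (simp add: algebra_simps)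
        finally have "norm (\<sigma> x - \<sigma> y - L (\<zeta>' (x - y))) / norm (x - y) \<le> K * (R (\<sigma> x) * (B / c) + Z x)"
          using xy by (simp add: pos_divide_le_eq)
        then show ?case by simp
      qed
    qed
  qed
  then show ?thesis unfolding differentiable_def by blast
qed

lemma zero_derivativeI:
  fixes g :: "'a::real_normed_vector \<Rightarrow> 'b::real_normed_vector"
  assumes "\<And>\<epsilon>. 0 < \<epsilon> \<Longrightarrow> eventually (\<lambda>x. norm (g x - g y) \<le> \<epsilon> * norm (x - y)) (nhds y)"
  shows "(g has_derivative (\<lambda>_. 0)) (at y)"
  unfolding has_derivative_iff_norm
proof
  show "((\<lambda>x. norm (g x - g y - 0) / norm (x - y)) \<longlongrightarrow> 0) (at y)"
  proof (rule tendstoI)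
    fix e :: real assume "0 < e"
    then have "eventually (\<lambda>x. norm (g x - g y) \<le> (e/2) * norm (x - y)) (at y)"
      using assms[of "e/2"] eventually_nhds_conv_at by auto
    then show "eventually (\<lambda>x. dist (norm (g x - g y - 0) / norm (x - y)) 0 < e) (at y)"
      using eventually_neq_at_within[of y y UNIV]
    proof eventually_elim
      case (elim x)
      have "norm (g x - g y) / norm (x - y) \<le> e/2" using elim by (simp add: pos_divide_le_eq)
      also have "\<dots> < e" using \<open>0 < e\<close> by simp
      finally show ?case by simp
    qed
  qed
qed simp

lemma differentiable_vec_nth:
  "g differentiable F \<Longrightarrow> (\<lambda>x. g x $ i) differentiable F"
  unfolding differentiable_def using bounded_linear.has_derivative[OF bounded_linear_vec_nth] by blast

lemma differentiable_eventually_cong: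
  assumes "f differentiable (at y)" "eventually (\<lambda>x. g x = f x) (nhds y)"
  shows "g differentiable (at y)"
proof -
  obtain D where "(f has_derivative D) (at y)" using assms(1) unfolding differentiable_def by blast
  moreover have "eventually (\<lambda>x. f x = g x) (at y)" using assms(2) unfolding eventually_nhds_conv_at by (auto elim: eventually_mono)
  moreover have "f y = g y" using eventually_nhds_x_imp_x[OF assms(2)] by simp
  ultimately have "(g has_derivative D) (at y)" by (rule has_derivative_transform_eventually) simp
  then show ?thesis unfolding differentiable_def by blast
qed

lemma differentiable_vecI:
  fixes f :: "'a::real_normed_vector \<Rightarrow> ('b::euclidean_space)^'n::finite"
  assumes "\<And>j. (\<lambda>x. f x $ j) differentiable (at y)"
  shows "f differentiable (at y)"
proof -
  have bl: "bounded_linear (axis j :: 'b \<Rightarrow> 'b^'n)" for j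
    by (rule linear_conv_bounded_linear[THEN iffD1], rule linearI) (auto simp: axis_def vec_eq_iff)
  have "(\<lambda>x. axis j (f x $ j) :: 'b^'n) differentiable (at y)" for j
    using assms[of j] bounded_linear.has_derivative[OF bl] unfolding differentiable_def by blast
  then have "(\<lambda>x. \<Sum>j\<in>UNIV. axis j (f x $ j)) differentiable (at y)" by (intro differentiable_sum) auto
  moreover have "(\<Sum>j\<in>UNIV. axis j (v $ j)) = v" for v :: "'b^'n"
    by (auto simp: vec_eq_iff axis_def if_distrib cong: if_cong)
  ultimately show ?thesis by simp
qed

lemma differentiable_sgn_at:
  fixes g :: "'a::real_normed_vector \<Rightarrow> 'b::real_inner"
  assumes "g differentiable (at y)" "g y \<noteq> 0"
  shows "(\<lambda>x. sgn (g x)) differentiable (at y)"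
proof -
  have "(\<lambda>x. norm (g x)) differentiable (at y)"
    by (rule differentiable_compose[OF differentiable_norm_at assms(1), unfolded comp_def]) (rule assms(2))
  then have "(\<lambda>x. inverse (norm (g x)) *\<^sub>R g x) differentiable (at y)"
    using assms by (intro differentiable_scaleR differentiable_inverse) auto
  then show ?thesis by (simp add: sgn_div_norm)
qed

text \<open>The slope \<sigma> of the maximizer solves \<open>Psi (\<sigma> x) = \<zeta> x\<close>
  with differentiable right-hand side, and the maximizer is recovered from the slope and the
  direction of \<open>x $ k\<close>. So everything reduces to differentiability of \<sigma>.\<close>

lemma phat_differentiable:
  fixes y :: "'n::finite state"
  assumes y0: "y \<noteq> 0"
  shows "phat differentiable (at y)"
proof -
  define p where "p = phat y"
  have "p \<noteq> 0" using phat(1)[OF y0] by (auto simp: p_def)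
  \<comment> \<open>For the largest component k all components of the slope have norm at most 1, as
    \<open>Psi_growth\<close> requires.\<close>
  have "Max (range (\<lambda>i. norm (p $ i))) \<in> range (\<lambda>i. norm (p $ i))" by (intro Max_in) auto
  then obtain k where k: "Max (range (\<lambda>i. norm (p $ i))) = norm (p $ k)" by (rule rangeE)
  have kmax: "norm (p $ i) \<le> norm (p $ k)" for i unfolding k[symmetric] by (rule Max_ge) auto
  have pk: "p $ k \<noteq> 0"
  proof
    assume "p $ k = 0"
    then have "p $ i = 0" for i using kmax[of i] by simp
    then show False using \<open>p \<noteq> 0\<close> by (simp add: vec_eq_iff)
  qed
  have plim: "(phat \<longlongrightarrow> p) (nhds y)"
    using isCont_phat[OF y0] by (simp add: isCont_def tendsto_at_iff_tendsto_nhds p_def)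
  have ev_ne: "eventually (\<lambda>x. x \<noteq> 0) (nhds y)"
    using tendsto_imp_eventually_ne[OF filterlim_ident y0] by simp
  have ev_k: "eventually (\<lambda>x. phat x $ k \<noteq> 0) (nhds y)"
    using tendsto_imp_eventually_ne[OF tendsto_vec_nth[OF plim, of k] pk] .
  define \<sigma> where "\<sigma> x = slope k (phat x)" for x
  define s where "s = \<sigma> y"
  have s_nth: "s $ i = (if i = k then 0 else (1 / norm (p $ k)) *\<^sub>R p $ i)" for i
    by (simp add: s_def \<sigma>_def slope_def p_def)
  have s_le: "norm (s $ i) \<le> 1" for i using kmax[of i] pk by (simp add: s_nth)
  have "((\<lambda>x. (1 / norm (phat x $ k)) *\<^sub>R (\<chi> i. if i = k then 0 else phat x $ i)) \<longlongrightarrow> (1 / norm (p $ k)) *\<^sub>R (\<chi> i. if i = k then 0 else p $ i)) (nhds y)"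
  proof (intro tendsto_intros tendsto_vec_lambda plim)
    show "norm (p $ k) \<noteq> 0" using pk by simp
    show "((\<lambda>x. if i = k then 0 else phat x $ i) \<longlongrightarrow> (if i = k then 0 else p $ i)) (nhds y)" for i
      by (cases "i = k") (auto intro: tendsto_vec_nth plim)
  qed
  then have \<sigma>lim: "(\<sigma> \<longlongrightarrow> s) (nhds y)" by (simp add: \<sigma>_def[abs_def] s_def slope_def del_def p_def cong del: if_weak_cong)
  have \<sigma>cont: "isCont \<sigma> y" using \<sigma>lim by (simp add: isCont_def tendsto_at_iff_tendsto_nhds s_def)
  have rho: "rho0 differentiable (at y)" using GDERIV_rho0[OF y0] unfolding gderiv_def differentiable_def by blast
  define \<zeta> where "\<zeta> x = del k ((1 / rho0 x) *\<^sub>R x)" for x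
  have "\<zeta> differentiable (at y)"
  proof (rule differentiable_vecI)
    fix j
    have "(\<lambda>x. (1 / rho0 x) *\<^sub>R x $ j) differentiable (at y)"
      using rho rho0_pos[OF y0] by (intro differentiable_scaleR differentiable_divide differentiable_vec_nth) auto
    then show "(\<lambda>x. \<zeta> x $ j) differentiable (at y)" by (cases "j = k") (auto simp: \<zeta>_def)
  qed
  then obtain \<zeta>' where \<zeta>': "(\<zeta> has_derivative \<zeta>') (at y)" unfolding differentiable_def by blast
  have eq: "eventually (\<lambda>x. Psi (\<sigma> x) = \<zeta> x) (nhds y)"
    using ev_ne ev_k by eventually_elim (simp add: \<sigma>_def \<zeta>_def Psi_slope Gam_phat)
  have eqy: "Psi s = \<zeta> y" using eventually_nhds_x_imp_x[OF eq] by (simp add: s_def)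
  obtain c where c: "0 < c" "eventually (\<lambda>t. c * norm (t - s) \<le> norm (Psi t - Psi s)) (nhds s)"
    using Psi_growth[OF s_le] by blast
  have sgn_eq: "sgn (phat x $ j) = sgn (x $ j)" if "x \<noteq> 0" for x j
    using sgn_Gam[of "phat x" j] Gam_phat[OF that] rho0_pos[OF that] by (simp add: sgn_scaleR)
  have \<sigma>diff: "\<sigma> differentiable (at y)"
  proof (cases "\<exists>C<\<infinity>. eventually (\<lambda>s'. Jint s' \<le> C) (nhds s)")
    case True
    then obtain C where C: "C < \<infinity>" "eventually (\<lambda>s'. Jint s' \<le> C) (nhds s)" by blast
    have J: "Jint s < \<infinity>" using eventually_nhds_x_imp_x[OF C(2)] C(1) by (rule le_less_trans)
    show ?thesis
    proof (rule implicit_differentiable[OF _ _ \<sigma>cont \<zeta>' eq c(1)])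
      show "(Psi has_derivative DPsi s) (at (\<sigma> y))" using Psi_has_derivative[OF C] by (simp add: s_def)
      show "h = 0" if "DPsi s h = 0" for h
        using DPsi_inner[OF J, of h] Phi_pos[OF s_le, of h] that by (cases "h = 0") auto
      show "eventually (\<lambda>t. c * norm (t - \<sigma> y) \<le> norm (Psi t - Psi (\<sigma> y))) (nhds (\<sigma> y))"
        using c(2) by (simp add: s_def)
    qed
  next
    case False
    \<comment> \<open>Without a local bound on \<open>Jint\<close> the slope is a single vector of
      length one: two nonzero components, or a sum of norms below one, would give such a
      bound.\<close>
    have not_two: "i = j" if "s $ i \<noteq> 0" "s $ j \<noteq> 0" for i j
      using Jint_bounded_two[of i j s] that False by blast
    have sum: "1 \<le> (\<Sum>i\<in>UNIV. norm (s $ i))" using Jint_bounded_inside[of s] False by force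
    obtain i where i: "s $ i \<noteq> 0" using sum by (metis not_one_le_zero norm_zero sum.neutral)
    have s0: "s $ j = 0" if "j \<noteq> i" for j using not_two[OF i] that by blast
    have "(\<Sum>j\<in>UNIV. norm (s $ j)) = norm (s $ i)"
      using s0 by (subst sum.remove[of _ i]) auto
    then have si: "norm (s $ i) = 1" using sum s_le[of i] by simp
    obtain B where B: "0 < B" "eventually (\<lambda>x. norm (\<zeta> x - \<zeta> y) \<le> B * norm (x - y)) (nhds y)"
      using derivative_lipschitz_at[OF \<zeta>'] by blast
    have small: "eventually (\<lambda>x. \<bar>s $ i \<bullet> (\<sigma> x - s) $ i\<bar> + (\<Sum>j\<in>UNIV - {i}. norm ((\<sigma> x - s) $ j)) \<le> \<epsilon> * norm (x - y)) (nhds y)"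
      if "0 < \<epsilon>" for \<epsilon>
    proof -
      have "eventually (\<lambda>t. \<bar>s $ i \<bullet> (t - s) $ i\<bar> + (\<Sum>j\<in>UNIV - {i}. norm ((t - s) $ j)) \<le> (\<epsilon> / B) * norm (Psi t - Psi s)) (nhds s)"
        using that B(1) by (intro Psi_growth_critical si s0) auto
      then have "eventually (\<lambda>x. \<bar>s $ i \<bullet> (\<sigma> x - s) $ i\<bar> + (\<Sum>j\<in>UNIV - {i}. norm ((\<sigma> x - s) $ j)) \<le> (\<epsilon> / B) * norm (Psi (\<sigma> x) - Psi s)) (nhds y)"
        using \<sigma>lim unfolding filterlim_iff by blast
      then show ?thesis using eq B(2)
      proof eventually_elim
        case (elim x)
        have "(\<epsilon> / B) * norm (Psi (\<sigma> x) - Psi s) \<le> (\<epsilon> / B) * (B * norm (x - y))"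
          using elim eqy that B(1) by (intro mult_left_mono) auto
        then show ?case using elim(1) B(1) by simp
      qed
    qed
    have u: "((\<lambda>x. s $ i \<bullet> \<sigma> x $ i) has_derivative (\<lambda>_. 0)) (at y)"
    proof (rule zero_derivativeI)
      fix \<epsilon> :: real assume "0 < \<epsilon>"
      from small[OF this] show "eventually (\<lambda>x. norm (s $ i \<bullet> \<sigma> x $ i - s $ i \<bullet> \<sigma> y $ i) \<le> \<epsilon> * norm (x - y)) (nhds y)"
      proof eventually_elim
        case (elim x)
        have "0 \<le> (\<Sum>j\<in>UNIV - {i}. norm ((\<sigma> x - s) $ j))" by (intro sum_nonneg) auto
        moreover have "s $ i \<bullet> \<sigma> x $ i - s $ i \<bullet> \<sigma> y $ i = s $ i \<bullet> (\<sigma> x - s) $ i" by (simp add: inner_diff_right s_def)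
        ultimately show ?case using elim by simp
      qed
    qed
    have other: "(\<lambda>x. \<sigma> x $ j) differentiable (at y)" if j: "j \<noteq> i" for j
    proof -
      have "((\<lambda>x. \<sigma> x $ j) has_derivative (\<lambda>_. 0)) (at y)"
      proof (rule zero_derivativeI)
        fix \<epsilon> :: real assume "0 < \<epsilon>"
        from small[OF this] show "eventually (\<lambda>x. norm (\<sigma> x $ j - \<sigma> y $ j) \<le> \<epsilon> * norm (x - y)) (nhds y)"
        proof eventually_elim
          case (elim x)
          have "norm ((\<sigma> x - s) $ j) \<le> (\<Sum>j\<in>UNIV - {i}. norm ((\<sigma> x - s) $ j))"
            using j by (intro member_le_sum) auto
          also have "\<dots> \<le> \<bar>s $ i \<bullet> (\<sigma> x - s) $ i\<bar> + (\<Sum>j\<in>UNIV - {i}. norm ((\<sigma> x - s) $ j))" by simp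
          also note elim
          finally show ?case by (simp add: s_def)
        qed
      qed
      then show ?thesis unfolding differentiable_def by blast
    qed
    have ik: "i \<noteq> k" using i by (auto simp: s_nth)
    \<comment> \<open>The growth estimate controls component i only along \<open>s $ i\<close>. Its
      direction comes from elsewhere: it is that of \<open>x $ i\<close>, because \<open>Gam\<close>
      preserves directions of components.\<close>
    have \<sigma>_sgn: "\<sigma> x $ i = norm (\<sigma> x $ i) *\<^sub>R sgn (x $ i)" if "x \<noteq> 0" "phat x $ k \<noteq> 0" for x
    proof -
      have "sgn (\<sigma> x $ i) = sgn (phat x $ i)" using ik that(2) by (simp add: \<sigma>_def slope_def sgn_scaleR sgn_div_norm inverse_eq_divide)
      moreover have "\<sigma> x $ i = norm (\<sigma> x $ i) *\<^sub>R sgn (\<sigma> x $ i)"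
        by (cases "\<sigma> x $ i = 0") (simp_all add: sgn_div_norm)
      ultimately show ?thesis using sgn_eq[OF that(1), of i] by simp
    qed
    define w where "w x = s $ i \<bullet> sgn (x $ i)" for x :: "'n state"
    have "s $ i = sgn (y $ i)" using \<sigma>_sgn[OF y0] pk si by (simp add: s_def p_def)
    then have wy: "w y = 1" and yi: "y $ i \<noteq> 0" using si i by (auto simp: w_def dot_square_norm)
    have wdiff: "w differentiable (at y)" unfolding w_def
      by (intro differentiable_inner differentiable_const differentiable_sgn_at differentiable_vec_nth differentiable_ident yi)
    have "isCont w y" using differentiable_imp_continuous_within[OF wdiff] .
    then have "(w \<longlongrightarrow> w y) (nhds y)" by (simp add: isCont_def tendsto_at_iff_tendsto_nhds)
    then have wne: "eventually (\<lambda>x. w x \<noteq> 0) (nhds y)" by (rule tendsto_imp_eventually_ne) (simp add: wy)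
    \<comment> \<open>The quotient is the length of \<open>\<sigma> x $ i\<close>; near y the
      denominator is close to 1.\<close>
    have "(\<lambda>x. (s $ i \<bullet> \<sigma> x $ i / w x) *\<^sub>R sgn (x $ i)) differentiable (at y)"
      using u wdiff wy yi
      by (intro differentiable_scaleR differentiable_divide differentiable_sgn_at differentiable_vec_nth differentiable_ident)
         (auto simp: differentiable_def)
    moreover have "eventually (\<lambda>x. \<sigma> x $ i = (s $ i \<bullet> \<sigma> x $ i / w x) *\<^sub>R sgn (x $ i)) (nhds y)"
      using ev_ne ev_k wne
    proof eventually_elim
      case (elim x)
      have "s $ i \<bullet> \<sigma> x $ i = norm (\<sigma> x $ i) * w x"
        unfolding w_def by (subst \<sigma>_sgn[OF elim(1,2)]) simp
      then show ?case using elim \<sigma>_sgn[OF elim(1,2)] by simp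
    qed
    ultimately have "(\<lambda>x. \<sigma> x $ i) differentiable (at y)" by (rule differentiable_eventually_cong)
    then show ?thesis using other by (intro differentiable_vecI) metis
  qed
  define P where "P x = \<sigma> x + axis k (sgn (x $ k))" for x
  have Pdiff: "P differentiable (at y)"
  proof (rule differentiable_vecI)
    fix j
    have yk: "y $ k \<noteq> 0"
      using sgn_Gam[of "phat y" k] Gam_phat[OF y0] rho0_pos[OF y0] pk by (auto simp: p_def sgn_scaleR sgn_zero_iff)
    have "(\<lambda>x. \<sigma> x $ j + (if j = k then sgn (x $ k) else 0)) differentiable (at y)"
      using yk \<sigma>diff by (cases "j = k") (auto intro!: differentiable_add differentiable_vec_nth differentiable_sgn_at)
    then show "(\<lambda>x. P x $ j) differentiable (at y)" by (simp add: P_def axis_def)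
  qed
  \<comment> \<open>Slope and direction of component k determine the maximizer up to a positive
    factor, which \<open>H0 = 1\<close> fixes.\<close>
  have repr: "phat x = (1 / H0 (P x)) *\<^sub>R P x" "P x \<noteq> 0" if "x \<noteq> 0" "phat x $ k \<noteq> 0" for x
  proof -
    have e: "phat x = norm (phat x $ k) *\<^sub>R P x"
      using state_from_slope[OF that(2)] sgn_eq[OF that(1), of k] by (simp add: P_def \<sigma>_def)
    then have "norm (phat x $ k) * H0 (P x) = 1"
      using phat(1)[OF that(1)] H0_scale[of "norm (phat x $ k)" "P x"] by simp
    then have "norm (phat x $ k) = 1 / H0 (P x)" by (metis mult_zero_right nonzero_eq_divide_eq zero_neq_one)
    then show "phat x = (1 / H0 (P x)) *\<^sub>R P x" using e by simp
    show "P x \<noteq> 0" using e that(2) by auto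
  qed
  have Py: "P y \<noteq> 0" using repr(2)[OF y0] pk by (simp add: p_def)
  have "H0 differentiable (at (P y))" using GDERIV_H0[OF Py] unfolding gderiv_def differentiable_def by blast
  then have "(\<lambda>x. H0 (P x)) differentiable (at y)"
    using differentiable_chain_at[OF Pdiff] by (simp add: comp_def)
  then have "(\<lambda>x. (1 / H0 (P x)) *\<^sub>R P x) differentiable (at y)"
    using Pdiff H0_pos[OF Py] by (intro differentiable_scaleR differentiable_divide) auto
  moreover have "eventually (\<lambda>x. phat x = (1 / H0 (P x)) *\<^sub>R P x) (nhds y)"
    using ev_ne ev_k by eventually_elim (rule repr)
  ultimately show ?thesis by (rule differentiable_eventually_cong)
qed

text \<open>Rotating one component of the maximizer does not change \<open>H0\<close> and improves the linear
  functional to second order, which bounds the Hessian from below.\<close>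

definition rot_at :: "'n::finite \<Rightarrow> real \<Rightarrow> 'n state \<Rightarrow> 'n state" where
  "rot_at i t p = (\<chi> j. if j = i then cos t *\<^sub>R p $ i + sin t *\<^sub>R rot90 (p $ i) else p $ j)"

lemma norm_rot: "norm (cos t *\<^sub>R v + sin t *\<^sub>R rot90 v) = norm (v :: real \<times> real)"
proof -
  have "(cos t * fst v - sin t * snd v)\<^sup>2 + (cos t * snd v + sin t * fst v)\<^sup>2
      = ((fst v)\<^sup>2 + (snd v)\<^sup>2) * ((cos t)\<^sup>2 + (sin t)\<^sup>2)"
    by algebra
  then show ?thesis by (simp add: norm_prod_def rot90_def)
qed

text \<open>Integrating over phase k sees only the length of component k, by
  \<open>nn_integral_inner_cs\<close>.\<close>

lemma H0_norm_component:
  assumes "norm (a $ k) = norm (b $ k)" "del k a = del k b"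
  shows "H0 a = H0 (b :: 'n::finite state)"
proof -
  have "ennreal (H0 c) = (\<integral>\<^sup>+\<theta>. (\<integral>\<^sup>+w. ennreal \<bar>norm (c $ k) * cos w + del k c \<bullet> Et \<theta>\<bar> \<partial>unif) \<partial>torus)" for c :: "'n state"
  proof -
    have "ennreal (H0 c) = (\<integral>\<^sup>+\<theta>. ennreal \<bar>c \<bullet> Et \<theta>\<bar> \<partial>torus)"
      unfolding H0_def by (rule nn_integral_eq_integral[symmetric, OF integrable_H0]) simp
    also have "\<dots> = (\<integral>\<^sup>+\<theta>. (\<integral>\<^sup>+w. ennreal \<bar>c $ k \<bullet> cs w + del k c \<bullet> Et \<theta>\<bar> \<partial>unif) \<partial>torus)"
      by (subst nn_integral_resample[of _ k]) (auto simp: inner_Et_update)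
    also have "\<dots> = (\<integral>\<^sup>+\<theta>. (\<integral>\<^sup>+w. ennreal \<bar>norm (c $ k) * cos w + del k c \<bullet> Et \<theta>\<bar> \<partial>unif) \<partial>torus)"
      by (intro nn_integral_cong nn_integral_inner_cs[of "\<lambda>x. ennreal \<bar>x + _\<bar>"]) measurable
    finally show ?thesis .
  qed
  then have "ennreal (H0 a) = ennreal (H0 b)" using assms by simp
  then show ?thesis using H0_nonneg by (metis ennreal_inj)
qed

lemma H0_rot_at [simp]: "H0 (rot_at i t p) = H0 p"
  by (rule H0_norm_component[of _ i]) (auto simp: rot_at_def norm_rot vec_eq_iff)

text \<open>If \<open>D b \<bullet> b\<close> were 0, the subgradient inequality at y + x b would
  bound \<open>rho0 (y + x *\<^sub>R b) - rho0 y\<close> above by o(x^2). Testing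
  \<open>rho0\<close> with the maximizer rotated in component i by an angle proportional to x bounds
  it below by a positive multiple of x^2.\<close>

lemma hessian_pos:
  fixes y b :: "'n::finite state"
  assumes y0: "y \<noteq> 0" and D: "(phat has_derivative D) (at y)"
    and b0: "b \<bullet> phat y = 0" and rot: "b $ i \<bullet> rot90 (phat y $ i) \<noteq> 0"
  shows "D b \<bullet> b \<noteq> 0"
proof
  assume z: "D b \<bullet> b = 0"
  define p where "p = phat y"
  define \<beta> where "\<beta> = b $ i \<bullet> rot90 (p $ i)"
  have \<beta>: "\<beta> \<noteq> 0" using rot by (simp add: \<beta>_def p_def)
  define \<gamma> where "\<gamma> = b $ i \<bullet> p $ i"
  define \<alpha> where "\<alpha> = y $ i \<bullet> p $ i"
  have dec: "x \<bullet> rot_at i t p = x \<bullet> p + ((cos t - 1) * (x $ i \<bullet> p $ i) + sin t * (x $ i \<bullet> rot90 (p $ i)))" for x t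
  proof -
    have "rot_at i t p = p + axis i ((cos t - 1) *\<^sub>R p $ i + sin t *\<^sub>R rot90 (p $ i))"
      by (auto simp: rot_at_def vec_eq_iff axis_def algebra_simps)
    then show ?thesis by (simp add: inner_add_right inner_axis)
  qed
  have p: "H0 p = 1" "y \<bullet> p = rho0 y" using phat[OF y0] by (auto simp: p_def)
  \<comment> \<open>\<open>y $ i\<close> is parallel to \<open>p $ i\<close>, so the rotation
    changes y \<bullet> p only to second order.\<close>
  have yr: "y $ i \<bullet> rot90 (p $ i) = 0"
  proof -
    have "rho0 y *\<^sub>R Gam p = y" using Gam_maximizer[OF y0 p] .
    then have yi: "y $ i = rho0 y *\<^sub>R Gam p $ i" by (metis vector_scaleR_component)
    show ?thesis
    proof (cases "p $ i = 0")
      case True then show ?thesis by (simp add: rot90_def zero_prod_def[symmetric])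
    next
      case False
      have "p $ i \<bullet> rot90 (p $ i) = 0" by (cases "p $ i") (simp add: rot90_def)
      then show ?thesis unfolding yi Gam_nth(1)[OF False] by (simp add: sgn_div_norm)
    qed
  qed
  have lower: "(cos t - 1) * \<alpha> + x * ((cos t - 1) * \<gamma> + sin t * \<beta>) \<le> rho0 (y + x *\<^sub>R b) - rho0 y" for x t
  proof -
    have "(y + x *\<^sub>R b) \<bullet> rot_at i t p \<le> rho0 (y + x *\<^sub>R b)" by (rule rho0_ge) (simp add: p)
    moreover have "(y + x *\<^sub>R b) \<bullet> rot_at i t p = y \<bullet> rot_at i t p + x * (b \<bullet> rot_at i t p)" by (simp add: inner_add_left)
    moreover have "y \<bullet> rot_at i t p = rho0 y + (cos t - 1) * \<alpha>" using dec[of y t] yr p(2) by (simp add: \<alpha>_def)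
    moreover have "b \<bullet> rot_at i t p = (cos t - 1) * \<gamma> + sin t * \<beta>" using dec[of b t] b0 by (simp add: \<gamma>_def \<beta>_def p_def)
    ultimately show ?thesis by simp
  qed
  have upper: "rho0 (y + x *\<^sub>R b) - rho0 y \<le> x * (phat (y + x *\<^sub>R b) \<bullet> b)" if "y + x *\<^sub>R b \<noteq> 0" for x
    using rho0_sub[OF that, of y] by (simp add: inner_commute)
  have "((\<lambda>x. phat (y + x *\<^sub>R b)) has_derivative (\<lambda>x. D (x *\<^sub>R b))) (at 0)"
  proof -
    have "((\<lambda>x. y + x *\<^sub>R b) has_derivative (\<lambda>x. x *\<^sub>R b)) (at 0)" by (auto intro!: derivative_eq_intros)
    moreover have "(phat has_derivative D) (at (y + 0 *\<^sub>R b))" using D by simp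
    ultimately show ?thesis by (rule has_derivative_compose)
  qed
  then have "((\<lambda>x. phat (y + x *\<^sub>R b) \<bullet> b) has_derivative (\<lambda>x. D (x *\<^sub>R b) \<bullet> b)) (at 0)"
    by (rule has_derivative_inner_left)
  moreover have "(\<lambda>x. D (x *\<^sub>R b) \<bullet> b) = (\<lambda>x. 0)"
    using z linear_scale[OF has_derivative_linear[OF D]] by auto
  ultimately have "((\<lambda>x. phat (y + x *\<^sub>R b) \<bullet> b) has_real_derivative 0) (at 0)"
    by (simp add: has_field_derivative_def lambda_zero)
  then have lim: "((\<lambda>x. phat (y + x *\<^sub>R b) \<bullet> b / x) \<longlongrightarrow> 0) (at 0)"
    using b0 by (simp add: has_field_derivative_iff inner_commute)
  define q where "q = 1 + \<bar>\<alpha>\<bar> + \<bar>\<gamma>\<bar>"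
  have q: "0 < q" by (simp add: q_def)
  \<comment> \<open>For the angle of modulus \<delta> x the gain is |\<beta>| \<delta> x^2 / 2, and
    the loss is at most \<delta>^2 x^2 (|\<alpha>| + |\<gamma>|) / 2; this \<delta> keeps the
    difference \<kappa> x^2 positive.\<close>
  define \<delta> where "\<delta> = \<bar>\<beta>\<bar> / (2 * q)"
  have "0 < \<delta>" "2 * \<delta> * q = \<bar>\<beta>\<bar>" using \<beta> q by (auto simp: \<delta>_def)
  then have \<delta>: "0 < \<delta>" "2 * \<delta> * (1 + \<bar>\<alpha>\<bar> + \<bar>\<gamma>\<bar>) = \<bar>\<beta>\<bar>" unfolding q_def by auto
  define \<kappa> where "\<kappa> = \<bar>\<beta>\<bar> * \<delta> / 2 - \<delta>\<^sup>2 * (\<bar>\<alpha>\<bar> + \<bar>\<gamma>\<bar>) / 2"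
  have "\<delta>\<^sup>2 * (\<bar>\<alpha>\<bar> + \<bar>\<gamma>\<bar>) < \<bar>\<beta>\<bar> * \<delta>"
  proof -
    have "\<delta> * (\<bar>\<alpha>\<bar> + \<bar>\<gamma>\<bar>) < \<bar>\<beta>\<bar>"
    proof -
      have "\<bar>\<alpha>\<bar> + \<bar>\<gamma>\<bar> < 2 * (1 + \<bar>\<alpha>\<bar> + \<bar>\<gamma>\<bar>)"
        using abs_ge_zero[of \<alpha>] abs_ge_zero[of \<gamma>] by argo
      from mult_strict_left_mono[OF this \<delta>(1)] show ?thesis using \<delta>(2) by (simp only: mult_ac)
    qed
    from mult_strict_left_mono[OF this \<delta>(1)] show ?thesis by (simp add: power2_eq_square mult_ac)
  qed
  then have \<kappa>: "0 < \<kappa>" by (simp add: \<kappa>_def)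
  have "eventually (\<lambda>x. phat (y + x *\<^sub>R b) \<bullet> b / x < \<kappa>) (at 0)" by (rule order_tendstoD(2)[OF lim \<kappa>])
  then obtain d where d: "0 < d" "\<And>x. x \<noteq> 0 \<Longrightarrow> \<bar>x\<bar> < d \<Longrightarrow> phat (y + x *\<^sub>R b) \<bullet> b / x < \<kappa>"
    unfolding eventually_at by (auto simp: dist_real_def)
  define x where "x = min (d / 2) (min 1 (1 / \<delta>))"
  have x: "0 < x" "x < d" "x \<le> 1" "\<delta> * x \<le> 1" 
  proof -
    show "0 < x" "x < d" "x \<le> 1" using d(1) \<delta>(1) by (auto simp: x_def)
    have "x \<le> 1 / \<delta>" by (auto simp: x_def)
    then show "\<delta> * x \<le> 1" using \<delta>(1) by (simp add: field_simps)
  qed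
  define t where "t = sgn \<beta> * (\<delta> * x)"
  have t2: "t\<^sup>2 = (\<delta> * x)\<^sup>2" using \<beta> by (simp add: t_def power_mult_distrib sgn_if)
  have c1: "0 \<le> 1 - cos t" by simp
  have c2: "1 - cos t \<le> (\<delta> * x)\<^sup>2 / 2"
  proof -
    have "cos t = 1 - 2 * (sin (t/2))\<^sup>2" using cos_double_sin[of "t/2"] by simp
    moreover have "(sin (t/2))\<^sup>2 \<le> (t/2)\<^sup>2" using abs_sin_x_le_abs_x[of "t/2"] by (rule abs_le_square_iff[THEN iffD1])
    ultimately show ?thesis using t2 by (simp add: power_divide)
  qed
  have s: "\<bar>\<beta>\<bar> * (\<delta> * x / 2) \<le> sin t * \<beta>"
  proof -
    have "\<delta> * x / 2 \<le> sin (\<delta> * x)" using x \<delta>(1) pi_gt3 by (intro sin_ge_half) auto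
    then have "\<bar>\<beta>\<bar> * (\<delta> * x / 2) \<le> \<bar>\<beta>\<bar> * sin (\<delta> * x)" by (intro mult_left_mono) auto
    also have "\<dots> = sin t * \<beta>" using \<beta> by (auto simp: t_def sgn_if abs_if)
    finally show ?thesis .
  qed
  have yb: "y + x *\<^sub>R b \<noteq> 0"
  proof
    assume "y + x *\<^sub>R b = 0"
    then have "(y + x *\<^sub>R b) \<bullet> phat y = 0" by simp
    then show False using phat(2)[OF y0] rho0_pos[OF y0] b0 by (simp add: inner_add_left)
  qed
  have a1: "- ((\<delta> * x)\<^sup>2 / 2 * \<bar>\<alpha>\<bar>) \<le> (cos t - 1) * \<alpha>"
  proof -
    have "\<bar>(cos t - 1) * \<alpha>\<bar> \<le> (\<delta> * x)\<^sup>2 / 2 * \<bar>\<alpha>\<bar>"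
      unfolding abs_mult using c1 c2 by (intro mult_right_mono) auto
    then show ?thesis by linarith
  qed
  have a2: "- ((\<delta> * x)\<^sup>2 / 2 * \<bar>\<gamma>\<bar>) \<le> x * ((cos t - 1) * \<gamma>)"
  proof -
    have "\<bar>x * ((cos t - 1) * \<gamma>)\<bar> \<le> 1 * ((\<delta> * x)\<^sup>2 / 2 * \<bar>\<gamma>\<bar>)"
      unfolding abs_mult using c1 c2 x by (intro mult_mono mult_right_mono) auto
    then show ?thesis by linarith
  qed
  have a3: "x * (\<bar>\<beta>\<bar> * (\<delta> * x / 2)) \<le> x * (sin t * \<beta>)" using s x by (intro mult_left_mono) auto
  have e1: "x * (\<bar>\<beta>\<bar> * (\<delta> * x / 2)) + - ((\<delta> * x)\<^sup>2 / 2 * \<bar>\<alpha>\<bar>) + - ((\<delta> * x)\<^sup>2 / 2 * \<bar>\<gamma>\<bar>) = x * x * \<kappa>"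
    by (simp add: \<kappa>_def power2_eq_square field_simps)
  have e2: "(cos t - 1) * \<alpha> + x * ((cos t - 1) * \<gamma>) + x * (sin t * \<beta>) = (cos t - 1) * \<alpha> + x * ((cos t - 1) * \<gamma> + sin t * \<beta>)"
    by (simp add: distrib_left)
  have "x * x * \<kappa> \<le> (cos t - 1) * \<alpha> + x * ((cos t - 1) * \<gamma> + sin t * \<beta>)"
    unfolding e1[symmetric] e2[symmetric] using add_mono[OF add_mono[OF a1 a2] a3] by (simp add: add_ac)
  also have "\<dots> \<le> x * (phat (y + x *\<^sub>R b) \<bullet> b)" using lower[of t x] upper[OF yb] by linarith
  finally have "x * \<kappa> \<le> phat (y + x *\<^sub>R b) \<bullet> b" using x(1) by (simp add: mult.assoc)
  then have "\<kappa> \<le> phat (y + x *\<^sub>R b) \<bullet> b / x" using x(1) by (simp add: pos_le_divide_eq mult.commute)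
  then show False using d(2)[of x] x by simp
qed

text \<open>The components are exchanged one at a time by \<open>H0_norm_component\<close>.\<close>

lemma H0_norms:
  fixes a b :: "'n::finite state"
  assumes "\<And>i. norm (a $ i) = norm (b $ i)"
  shows "H0 a = H0 b"
proof -
  have "H0 (\<chi> i. if i \<in> S then b $ i else a $ i) = H0 a" if "finite S" for S
    using that
  proof (induction S)
    case empty
    then show ?case by simp
  next
    case (insert k S)
    have "H0 (\<chi> i. if i \<in> insert k S then b $ i else a $ i) = H0 (\<chi> i. if i \<in> S then b $ i else a $ i)"
      using insert by (intro H0_norm_component[of _ k]) (auto simp: assms vec_eq_iff)
    then show ?case using insert by simp
  qed
  from this[of UNIV] show ?thesis by simp
qed

section \<open>Reduction of \<open>H\<close> and \<open>\<rho>\<close> to \<open>H0\<close> and \<open>rho0\<close>\<close>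

lemma prod_Basis_cart:
  fixes x :: "real^'n::finite"
  shows "(\<Prod>b\<in>Basis. x \<bullet> b) = (\<Prod>i\<in>UNIV. x $ i)"
proof -
  have B: "(Basis :: (real^'n) set) = range (\<lambda>i. axis i (1::real))" by (auto simp: Basis_vec_def)
  have inj: "inj (\<lambda>i::'n. axis i (1::real))" by (auto simp: inj_on_def axis_eq_axis)
  show ?thesis unfolding B by (subst prod.reindex[OF inj]) (simp add: inner_axis)
qed

interpretation lborel_factors: product_sigma_finite "\<lambda>_. lborel :: real measure"
  by unfold_locales

lemma cart_measurable:
  "(\<lambda>\<theta>. (\<chi> i. \<theta> i) :: real^'n::finite) \<in> borel_measurable (\<Pi>\<^sub>M i\<in>UNIV. lborel)"
proof -
  have "(\<lambda>\<theta>. ((\<chi> i. \<theta> i) :: real^'n) \<bullet> b) \<in> borel_measurable (\<Pi>\<^sub>M i\<in>UNIV. lborel)" if b: "b \<in> Basis" for b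
  proof -
    obtain i where b: "b = axis i 1" using b by (auto simp: Basis_vec_def)
    have "(\<lambda>\<theta>. \<theta> i) \<in> (\<Pi>\<^sub>M i\<in>(UNIV::'n set). lborel) \<rightarrow>\<^sub>M (lborel :: real measure)" by (rule measurable_component_singleton) simp
    then show ?thesis by (simp add: b inner_axis)
  qed
  then show ?thesis by (subst borel_measurable_euclidean_space) auto
qed

text \<open>\<open>H_norm\<close> integrates over a box of Cartesian vectors, whereas
  \<open>torus\<close> is a product measure on functions. The two Lebesgue measures are matched on
  boxes.\<close>

lemma lborel_cart:
  "distr (\<Pi>\<^sub>M i\<in>UNIV. lborel) borel (\<lambda>\<theta>. \<chi> i. \<theta> i) = (lborel :: (real^'n::finite) measure)"
proof (rule lborel_eqI[symmetric])
  fix l u :: "real^'n" assume lu: "\<And>b. b \<in> Basis \<Longrightarrow> l \<bullet> b \<le> u \<bullet> b"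
  have le: "l $ i \<le> u $ i" for i using lu[of "axis i 1"] by (auto simp: Basis_vec_def inner_axis)
  have "(\<lambda>\<theta>. (\<chi> i. \<theta> i) :: real^'n) -` box l u \<inter> space (\<Pi>\<^sub>M i\<in>UNIV. lborel) = PiE UNIV (\<lambda>i. {l $ i<..<u $ i})"
    by (auto simp: mem_box_cart space_PiM PiE_iff)
  then have "emeasure (distr (\<Pi>\<^sub>M i\<in>UNIV. lborel) borel (\<lambda>\<theta>. (\<chi> i. \<theta> i) :: real^'n)) (box l u)
    = emeasure (\<Pi>\<^sub>M i\<in>(UNIV::'n set). lborel) (PiE UNIV (\<lambda>i. {l $ i<..<u $ i}))"
    by (subst emeasure_distr[OF cart_measurable]) auto
  also have "\<dots> = (\<Prod>i\<in>UNIV. emeasure lborel {l $ i<..<u $ i})"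
    by (rule lborel_factors.emeasure_PiM) auto
  also have "\<dots> = ennreal (\<Prod>i\<in>UNIV. u $ i - l $ i)"
    using le by (simp add: prod_ennreal)
  also have "\<dots> = ennreal (\<Prod>b\<in>Basis. (u - l) \<bullet> b)" by (simp add: prod_Basis_cart)
  finally show "emeasure (distr (\<Pi>\<^sub>M i\<in>UNIV. lborel) borel (\<lambda>\<theta>. (\<chi> i. \<theta> i) :: real^'n)) (box l u) = ennreal (\<Prod>b\<in>Basis. (u - l) \<bullet> b)" .
qed simp

lemma emeasure_lborel_cart:
  assumes "\<And>i. A i \<in> sets borel"
  shows "emeasure lborel {\<phi>::real^'n::finite. \<forall>i. \<phi> $ i \<in> A i} = (\<Prod>i\<in>UNIV. emeasure lborel (A i))"
    and "{\<phi>::real^'n. \<forall>i. \<phi> $ i \<in> A i} \<in> sets borel"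
proof -
  have "{\<phi>::real^'n. \<forall>i. \<phi> $ i \<in> A i} = (\<Inter>i. (\<lambda>\<phi>. \<phi> $ i) -` A i)" by auto
  moreover have "(\<lambda>\<phi>::real^'n. \<phi> $ i) -` A i \<in> sets borel" for i
    using measurable_sets[of "\<lambda>\<phi>::real^'n. \<phi> $ i" borel borel "A i"] assms
    by (auto intro!: borel_measurable_continuous_onI continuous_intros)
  ultimately show m: "{\<phi>::real^'n. \<forall>i. \<phi> $ i \<in> A i} \<in> sets borel" by (auto intro!: sets.finite_INT)
  have "(\<lambda>\<theta>. (\<chi> i. \<theta> i) :: real^'n) -` {\<phi>. \<forall>i. \<phi> $ i \<in> A i} \<inter> space (\<Pi>\<^sub>M i\<in>UNIV. lborel) = PiE UNIV A"
    by (auto simp: space_PiM PiE_iff)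
  then have "emeasure lborel {\<phi>::real^'n. \<forall>i. \<phi> $ i \<in> A i} = emeasure (\<Pi>\<^sub>M i\<in>(UNIV::'n set). lborel) (PiE UNIV A)"
    by (subst lborel_cart[symmetric], subst emeasure_distr[OF cart_measurable]) (auto simp: m)
  also have "\<dots> = (\<Prod>i\<in>UNIV. emeasure lborel (A i))"
    using assms by (intro lborel_factors.emeasure_PiM) auto
  finally show "emeasure lborel {\<phi>::real^'n. \<forall>i. \<phi> $ i \<in> A i} = (\<Prod>i\<in>UNIV. emeasure lborel (A i))" .
qed

definition tcube :: "(real^'n::finite) set" where
  "tcube = cbox 0 (\<chi> i. 2*pi)"

lemma tcube_eq: "tcube = {\<phi>::real^'n::finite. \<forall>i. \<phi> $ i \<in> {0..2*pi}}"
  by (auto simp: tcube_def mem_box_cart)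

lemma emeasure_tcube: "emeasure lborel (tcube :: (real^'n::finite) set) = ennreal ((2*pi) ^ CARD('n))"
  unfolding tcube_eq by (subst emeasure_lborel_cart) (auto simp: prod_ennreal ennreal_power)

lemma proj_measurable:
  "(\<lambda>\<phi> i. (\<phi> :: real^'n::finite) $ i) \<in> uniform_measure lborel tcube \<rightarrow>\<^sub>M torus"
  unfolding torus_def
  by (rule measurable_PiM_single') (auto intro!: borel_measurable_continuous_onI continuous_intros simp: space_PiM)

lemma torus_eq_cube:
  "distr (uniform_measure lborel tcube) torus (\<lambda>\<phi> i. (\<phi> :: real^'n::finite) $ i) = torus"
proof -
  have "distr (uniform_measure lborel tcube) torus (\<lambda>\<phi> i. (\<phi> :: real^'n::finite) $ i) = (\<Pi>\<^sub>M i\<in>UNIV. unif)"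
  proof (rule torus_factors.PiM_eqI)
    fix A :: "'n \<Rightarrow> real set" assume "\<And>i. i \<in> UNIV \<Longrightarrow> A i \<in> sets unif"
    then have A: "A i \<in> sets borel" for i by simp
    have P: "PiE UNIV A \<in> sets torus" unfolding torus_def using A by (intro sets_PiM_I_finite) auto
    have "emeasure (distr (uniform_measure lborel tcube) torus (\<lambda>\<phi> i. (\<phi> :: real^'n) $ i)) (PiE UNIV A)
      = emeasure (uniform_measure lborel tcube) {\<phi>::real^'n. \<forall>i. \<phi> $ i \<in> A i}"
      by (subst emeasure_distr[OF proj_measurable P]) (auto intro!: arg_cong2[where f = emeasure] simp: PiE_iff)
    also have "\<dots> = emeasure lborel (tcube \<inter> {\<phi>::real^'n. \<forall>i. \<phi> $ i \<in> A i}) / emeasure lborel (tcube :: (real^'n) set)"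
      using emeasure_lborel_cart(2)[of A] A by (intro emeasure_uniform_measure) (auto simp: tcube_def)
    also have "tcube \<inter> {\<phi>::real^'n. \<forall>i. \<phi> $ i \<in> A i} = {\<phi>. \<forall>i. \<phi> $ i \<in> {0..2*pi} \<inter> A i}"
      by (auto simp: tcube_eq)
    also have "emeasure lborel \<dots> = (\<Prod>i\<in>UNIV. emeasure lborel ({0..2*pi} \<inter> A i))"
      using A by (intro emeasure_lborel_cart) auto
    also have "\<dots> / emeasure lborel (tcube :: (real^'n) set) = (\<Prod>i\<in>UNIV. emeasure lborel ({0..2*pi} \<inter> A i)) * ennreal (1 / (2*pi)) ^ CARD('n)"
    proof -
      have "inverse (ennreal ((2*pi) ^ CARD('n))) = ennreal (1 / (2*pi)) ^ CARD('n)"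
        by (subst inverse_ennreal, simp, subst ennreal_power) (auto simp: power_one_over inverse_eq_divide)
      then show ?thesis unfolding emeasure_tcube divide_ennreal_def by simp
    qed
    also have "\<dots> = (\<Prod>i\<in>UNIV. emeasure lborel ({0..2*pi} \<inter> A i) * ennreal (1 / (2*pi)))"
      by (simp add: prod.distrib)
    also have "\<dots> = (\<Prod>i\<in>UNIV. emeasure unif (A i))"
      unfolding unif_def using A by (intro prod.cong refl) (simp add: emeasure_uniform_measure divide_ennreal_def inverse_ennreal inverse_eq_divide)
    finally show "emeasure (distr (uniform_measure lborel tcube) torus (\<lambda>\<phi> i. (\<phi> :: real^'n) $ i)) (PiE UNIV A) = (\<Prod>i\<in>UNIV. emeasure unif (A i))" .
  qed (auto simp: torus_def)
  then show ?thesis by (simp add: torus_def)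
qed

lemma integral_torus_cube:
  fixes F :: "('n::finite \<Rightarrow> real) \<Rightarrow> real"
  assumes F: "F \<in> borel_measurable torus" and c: "continuous_on UNIV (\<lambda>\<phi>::real^'n. F (\<lambda>i. \<phi> $ i))"
  shows "(\<integral>\<theta>. F \<theta> \<partial>torus) = integral tcube (\<lambda>\<phi>::real^'n. F (\<lambda>i. \<phi> $ i)) / (2*pi) ^ CARD('n)"
proof -
  let ?G = "\<lambda>\<phi>::real^'n. F (\<lambda>i. \<phi> $ i)"
  let ?c = "(2*pi) ^ CARD('n)"
  have [measurable]: "?G \<in> borel_measurable borel" "tcube \<in> sets (borel :: (real^'n) measure)"
    by (auto intro: borel_measurable_continuous_onI c simp: tcube_def)
  have d: "uniform_measure lborel tcube = density lborel (\<lambda>x::real^'n. ennreal (indicator tcube x / ?c))"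
    unfolding uniform_measure_def emeasure_tcube
    by (intro arg_cong2[where f = density] refl ext) (auto simp: divide_ennreal[symmetric] split: split_indicator)
  have "(\<integral>\<theta>. F \<theta> \<partial>torus) = (\<integral>\<phi>. ?G \<phi> \<partial>uniform_measure lborel tcube)"
    by (subst torus_eq_cube[symmetric], subst integral_distr[OF proj_measurable F]) simp
  also have "\<dots> = (\<integral>\<phi>. (indicator tcube \<phi> / ?c) *\<^sub>R ?G \<phi> \<partial>lborel)"
    unfolding d by (subst integral_density) auto
  also have "\<dots> = (\<integral>\<phi>. (indicator tcube \<phi> *\<^sub>R ?G \<phi>) / ?c \<partial>lborel)" by simp
  also have "\<dots> = (\<integral>\<phi>. indicator tcube \<phi> *\<^sub>R ?G \<phi> \<partial>lborel) / ?c" by (rule integral_divide_zero)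
  also have "set_integrable lborel tcube ?G"
    unfolding tcube_def set_integrable_def by (intro borel_integrable_compact continuous_on_subset[OF c]) auto
  then have "(\<integral>\<phi>. indicator tcube \<phi> *\<^sub>R ?G \<phi> \<partial>lborel) = integral tcube ?G"
    using set_borel_integral_eq_integral(2) unfolding set_lebesgue_integral_def by blast
  finally show ?thesis .
qed

text \<open>The amplitude \<open>z\<^sub>i\<close> of \<open>p\<close> is the norm of the component \<open>i\<close> of \<open>Lam \<omega> p\<close>; \<open>Li\<close> is the inverse of \<open>Lam\<close> and
  \<open>Lx\<close> the transpose of \<open>Li\<close>.\<close>

definition Lam :: "real^'n \<Rightarrow> 'n::finite state \<Rightarrow> 'n state" where
  "Lam \<omega> p = (\<chi> i. (snd (p $ i), fst (p $ i) / \<omega> $ i))"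

definition Li :: "real^'n \<Rightarrow> 'n::finite state \<Rightarrow> 'n state" where
  "Li \<omega> a = (\<chi> i. (\<omega> $ i * snd (a $ i), fst (a $ i)))"

definition Lx :: "real^'n \<Rightarrow> 'n::finite state \<Rightarrow> 'n state" where
  "Lx \<omega> x = (\<chi> i. (snd (x $ i), \<omega> $ i * fst (x $ i)))"

lemma inner_Lx: "Lx \<omega> x \<bullet> a = x \<bullet> Li \<omega> a"
  by (auto simp: inner_vec_def Lx_def Li_def inner_prod_def intro!: sum.cong)

lemma linear_Lx: "linear (Lx \<omega>)"
  by (rule linearI) (auto simp: Lx_def vec_eq_iff prod_eq_iff algebra_simps)

lemma linear_Li: "linear (Li \<omega>)"
  by (rule linearI) (auto simp: Li_def vec_eq_iff prod_eq_iff algebra_simps)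

context
  fixes \<omega> :: "real^'n::finite"
  assumes \<omega>: "\<And>i. 0 < \<omega> $ i"
begin

lemma \<omega>_nz: "\<omega> $ i \<noteq> 0"
  using \<omega>[of i] by simp

lemma Li_Lam: "Li \<omega> (Lam \<omega> p) = p" "Lam \<omega> (Li \<omega> a) = a"
  by (auto simp: Li_def Lam_def vec_eq_iff prod_eq_iff \<omega>_nz)

lemma Lx_eq_0: "Lx \<omega> x = 0 \<longleftrightarrow> x = 0"
  by (auto simp: Lx_def vec_eq_iff prod_eq_iff \<omega>_nz)

lemma H_norm_eq: "H_norm \<omega> p = H0 (Lam \<omega> p)"
proof -
  \<comment> \<open>Turning each component of \<open>Lam \<omega> p\<close> to the first axis keeps
    \<open>H0\<close> and produces exactly the integrand with
    \<open>z\<^sub>i cos \<phi>\<^sub>i\<close>.\<close>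
  define a :: "'n state" where "a = (\<chi> i. (amplitude \<omega> p i, 0))"
  have "norm (Lam \<omega> p $ i) = norm (a $ i)" for i
    by (simp add: Lam_def a_def norm_prod_def amplitude_def power_divide)
  then have "H0 (Lam \<omega> p) = H0 a" by (rule H0_norms)
  also have "\<dots> = integral tcube (\<lambda>\<phi>::real^'n. \<bar>a \<bullet> Et (\<lambda>i. \<phi> $ i)\<bar>) / (2*pi) ^ CARD('n)"
    unfolding H0_def
    by (rule integral_torus_cube) (auto simp: inner_Et a_def cs_def intro!: continuous_intros)
  also have "\<dots> = H_norm \<omega> p"
    by (simp add: H_norm_def tcube_def inner_Et a_def cs_def)
  finally show ?thesis by simp
qed

lemma rho_eq: "rho \<omega> x = rho0 (Lx \<omega> x)"
proof -
  have "{a. H0 a \<le> 1} = Lam \<omega> ` {p. H_norm \<omega> p \<le> 1}"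
    unfolding H_norm_eq using Li_Lam by (auto simp: image_iff) metis
  then have "rho0 (Lx \<omega> x) = (SUP p\<in>{p. H_norm \<omega> p \<le> 1}. Lx \<omega> x \<bullet> Lam \<omega> p)"
    unfolding rho0_def by (simp add: image_image)
  then show ?thesis unfolding rho_def by (simp add: inner_Lx Li_Lam)
qed

lemma bounded_linear_Lx: "bounded_linear (Lx \<omega>)"
  using linear_Lx linear_conv_bounded_linear by blast

lemma bounded_linear_Li: "bounded_linear (Li \<omega>)"
  using linear_Li linear_conv_bounded_linear by blast

lemma grad_rho:
  assumes "x \<noteq> 0" shows "grad (rho \<omega>) x = Li \<omega> (phat (Lx \<omega> x))"
proof -
  have "(rho0 has_derivative (\<lambda>h. h \<bullet> phat (Lx \<omega> x))) (at (Lx \<omega> x))"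
    using GDERIV_rho0[of "Lx \<omega> x"] assms by (simp add: Lx_eq_0 gderiv_def)
  from has_derivative_compose[OF bounded_linear_imp_has_derivative[OF bounded_linear_Lx] this]
  have g: "GDERIV (rho \<omega>) x :> Li \<omega> (phat (Lx \<omega> x))"
    unfolding gderiv_def rho_eq[abs_def] inner_Lx .
  show ?thesis unfolding grad_def
  proof (rule the_equality)
    show "GDERIV (rho \<omega>) x :> Li \<omega> (phat (Lx \<omega> x))" by (rule g)
    fix D assume "GDERIV (rho \<omega>) x :> D"
    then have "(\<lambda>h. h \<bullet> D) = (\<lambda>h. h \<bullet> Li \<omega> (phat (Lx \<omega> x)))"
      using g has_derivative_unique unfolding gderiv_def by blast
    then show "D = Li \<omega> (phat (Lx \<omega> x))" using vector_eq_ldot by metis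
  qed
qed

lemma grad_rho_has_derivative:
  assumes x: "x \<noteq> 0" and D: "(phat has_derivative D) (at (Lx \<omega> x))"
  shows "(grad (rho \<omega>) has_derivative (\<lambda>v. Li \<omega> (D (Lx \<omega> v)))) (at x)"
proof -
  have "((\<lambda>x. Li \<omega> (phat (Lx \<omega> x))) has_derivative (\<lambda>v. Li \<omega> (D (Lx \<omega> v)))) (at x)"
    by (intro bounded_linear.has_derivative[OF bounded_linear_Li]
          has_derivative_compose[OF bounded_linear_imp_has_derivative[OF bounded_linear_Lx] D])
  then show ?thesis
    by (rule has_derivative_transform_within_open[of _ _ _ _ "- {0}"]) (use x in \<open>auto simp: grad_rho\<close>)
qed

lemma hessian_rho:
  assumes x: "x \<noteq> 0"
  obtains D where "(phat has_derivative D) (at (Lx \<omega> x))" "hessian (rho \<omega>) x = (\<lambda>v. Li \<omega> (D (Lx \<omega> v)))"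
proof -
  obtain D where D: "(phat has_derivative D) (at (Lx \<omega> x))"
    using phat_differentiable[of "Lx \<omega> x"] x unfolding differentiable_def Lx_eq_0 by blast
  have "hessian (rho \<omega>) x = (\<lambda>v. Li \<omega> (D (Lx \<omega> v)))"
    unfolding hessian_def using frechet_derivative_at[OF grad_rho_has_derivative[OF x D]] by simp
  then show ?thesis using that D by blast
qed

lemma grad_rho_differentiable:
  "x \<noteq> 0 \<Longrightarrow> (grad (rho \<omega>) has_derivative hessian (rho \<omega>) x) (at x)"
  using hessian_rho grad_rho_has_derivative by metis

lemma rho_zero [simp]: "rho \<omega> 0 = 0"
  by (simp add: rho_eq linear_0[OF linear_Lx])

lemma rho_pos: "x \<noteq> 0 \<Longrightarrow> 0 < rho \<omega> x"
  by (simp add: rho_eq rho0_pos Lx_eq_0)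

lemma rho_scale: "0 \<le> c \<Longrightarrow> rho \<omega> (c *\<^sub>R x) = c * rho \<omega> x"
  by (simp add: rho_eq linear_scale[OF linear_Lx] rho0_scale)

lemma rho_continuous: "continuous_on A (rho \<omega>)"
  unfolding rho_eq[abs_def]
  by (rule continuous_on_compose2[OF rho0_continuous[of UNIV] linear_continuous_on[OF bounded_linear_Lx]]) auto

text \<open>Homogeneity of degree zero: in polar coordinates the gradient depends on \<phi>
  alone.\<close>

lemma grad_rho_scale: "0 < c \<Longrightarrow> x \<noteq> 0 \<Longrightarrow> grad (rho \<omega>) (c *\<^sub>R x) = grad (rho \<omega>) x"
  by (simp add: grad_rho linear_scale[OF linear_Lx] phat_scale Lx_eq_0)

lemma compact_rho_sphere: "compact {x. rho \<omega> x = 1}"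
proof -
  have "bounded {x. rho \<omega> x = 1}"
  proof -
    have "\<exists>m\<in>sphere (0::'n state) 1. \<forall>a\<in>sphere (0::'n state) 1. rho \<omega> m \<le> rho \<omega> a"
    proof (rule continuous_attains_inf)
      show "sphere (0::'n state) 1 \<noteq> {}" by (simp add: sphere_eq_empty)
    qed (auto intro: rho_continuous)
    then obtain m :: "'n state" where m: "m \<in> sphere 0 1" "\<forall>a\<in>sphere (0::'n state) 1. rho \<omega> m \<le> rho \<omega> a" by blast
    have mp: "0 < rho \<omega> m" using m(1) by (intro rho_pos) auto
    have "norm x \<le> 1 / rho \<omega> m" if "rho \<omega> x = 1" for x
    proof -
      have "x \<noteq> 0" using that by auto
      then have "rho \<omega> m \<le> rho \<omega> ((1 / norm x) *\<^sub>R x)" using m(2) by simp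
      then show ?thesis using \<open>x \<noteq> 0\<close> that mp by (simp add: rho_scale field_simps)
    qed
    then show ?thesis by (intro boundedI) auto
  qed
  moreover have "closed {x. rho \<omega> x = 1}"
    by (intro closed_Collect_eq rho_continuous continuous_intros)
  ultimately show ?thesis by (simp add: compact_eq_bounded_closed)
qed

text \<open>In the coordinates of \<open>Lx\<close> all components of \<open>osc_B\<close> are (1,
  0), and the rotation condition of \<open>hessian_pos\<close> says that component i of the
  maximizer has a nonzero second entry. This component has the direction of
  \<open>Lx \<omega> x $ i\<close>, whose second entry is the position times the frequency.\<close>

lemma hessian_rho_pos:
  assumes x: "x \<noteq> 0" and B: "grad (rho \<omega>) x \<bullet> osc_B = 0" and xi: "fst (x $ i) \<noteq> 0"
  shows "hessian (rho \<omega>) x osc_B \<bullet> osc_B \<noteq> 0"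
proof -
  obtain D where D: "(phat has_derivative D) (at (Lx \<omega> x))" "hessian (rho \<omega>) x = (\<lambda>v. Li \<omega> (D (Lx \<omega> v)))"
    using hessian_rho[OF x] by blast
  define b where "b = Lx \<omega> osc_B"
  have b: "b $ j = (1, 0)" for j by (simp add: b_def Lx_def osc_B_def)
  have L0: "Lx \<omega> x \<noteq> 0" using x by (simp add: Lx_eq_0)
  have "hessian (rho \<omega>) x osc_B \<bullet> osc_B = D b \<bullet> b"
    by (simp add: D(2) b_def inner_commute[of _ osc_B] inner_Lx[symmetric]) (simp add: inner_commute)
  moreover have "D b \<bullet> b \<noteq> 0"
  proof (rule hessian_pos[OF L0 D(1)])
    show "b \<bullet> phat (Lx \<omega> x) = 0" using B x by (simp add: grad_rho b_def inner_Lx inner_commute)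
    have "sgn (phat (Lx \<omega> x) $ i) = sgn (Lx \<omega> x $ i)"
      using sgn_Gam[of "phat (Lx \<omega> x)" i] Gam_phat[OF L0] rho0_pos[OF L0] by (simp add: sgn_scaleR)
    then have "snd (sgn (phat (Lx \<omega> x) $ i)) = snd (sgn (Lx \<omega> x $ i))" by simp
    moreover have "snd (Lx \<omega> x $ i) \<noteq> 0" using xi \<omega>_nz[of i] by (simp add: Lx_def)
    moreover have "Lx \<omega> x $ i \<noteq> 0" using calculation(2) by (metis snd_zero)
    ultimately have "snd (phat (Lx \<omega> x) $ i) \<noteq> 0" by (auto simp: sgn_div_norm)
    then show "b $ i \<bullet> rot90 (phat (Lx \<omega> x) $ i) \<noteq> 0" by (simp add: b rot90_def)
  qed
  ultimately show ?thesis by simp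
qed

lemma grad_rho_continuous: "continuous_on (- {0}) (grad (rho \<omega>))"
  using grad_rho_differentiable has_derivative_continuous
  by (intro continuous_at_imp_continuous_on) blast

end

section \<open>Motions on \<open>\<sigma>\<close>\<close>

lemma osc_A_linear: "bounded_linear (osc_A \<omega>)"
  by (rule linear_conv_bounded_linear[THEN iffD1], rule linearI)
     (auto simp: osc_A_def vec_eq_iff prod_eq_iff algebra_simps)

lemma osc_B_nth [simp]: "osc_B $ i = (0, 1)"
  by (simp add: osc_B_def)

text \<open>A curve on the zero set of \<open>\<langle>\<partial>\<rho>/\<partial>x, B\<rangle>\<close> driven by the primitive \<open>w\<close> of a control bounded by
  \<open>1/R\<close>; nothing is assumed about the differentiability of \<open>w\<close>.\<close>

definition driven :: "real^'n \<Rightarrow> real \<Rightarrow> (real \<Rightarrow> 'n::finite state) \<Rightarrow> (real \<Rightarrow> real) \<Rightarrow> bool" where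
  "driven \<omega> R \<psi> w \<longleftrightarrow>
     (\<forall>t\<ge>0. \<psi> t \<in> sigma \<omega>) \<and> w 0 = 0 \<and> (\<forall>s\<ge>0. \<forall>t\<ge>0. \<bar>w t - w s\<bar> \<le> \<bar>t - s\<bar> / R) \<and>
     continuous_on {0..} \<psi> \<and> (\<forall>t\<ge>0. \<psi> t = \<psi> 0 + integral {0..t} (\<lambda>s. osc_A \<omega> (\<psi> s)) + w t *\<^sub>R osc_B)"

lemma integral_has_vector_derivative_ray:
  fixes f :: "real \<Rightarrow> 'a::banach"
  assumes "continuous_on {0..} f" "0 \<le> s"
  shows "((\<lambda>t. integral {0..t} f) has_vector_derivative f s) (at s within {0..})"
proof -
  have "((\<lambda>t. integral {0..t} f) has_vector_derivative f s) (at s within {0..s + 1})"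
    using assms by (intro integral_has_vector_derivative continuous_on_subset[OF assms(1)]) auto
  moreover have "at s within {0..s + 1} = at s within {0..}"
    using assms(2) by (intro at_within_nhd[of s "{s - 1<..<s + 1}"]) auto
  ultimately show ?thesis by simp
qed

lemma at_within_ray_nontrivial: "0 \<le> (s::real) \<Longrightarrow> at s within {0..} \<noteq> bot"
proof -
  assume s: "0 \<le> s"
  have "at_right s \<le> at s within {0..}" using s by (intro at_le) auto
  then show ?thesis by (metis bot.extremum_uniqueI trivial_limit_at_right_real)
qed

context
  fixes \<omega> :: "real^'n::finite" and R :: real and \<psi> :: "real \<Rightarrow> 'n state" and w :: "real \<Rightarrow> real"
  assumes \<omega>: "\<And>i. 0 < \<omega> $ i" and R: "0 < R" and driven: "driven \<omega> R \<psi> w"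
begin

interpretation A: bounded_linear "osc_A \<omega>"
  by (rule osc_A_linear)

lemma driven_cont: "continuous_on {0..} \<psi>"
  and driven_lip: "0 \<le> s \<Longrightarrow> 0 \<le> t \<Longrightarrow> \<bar>w t - w s\<bar> \<le> \<bar>t - s\<bar> / R"
  and driven_eq: "0 \<le> t \<Longrightarrow> \<psi> t = \<psi> 0 + integral {0..t} (\<lambda>s. osc_A \<omega> (\<psi> s)) + w t *\<^sub>R osc_B"
  and driven_sphere: "0 \<le> t \<Longrightarrow> rho \<omega> (\<psi> t) = 1"
  and driven_perp: "0 \<le> t \<Longrightarrow> grad (rho \<omega>) (\<psi> t) \<bullet> osc_B = 0"
  and driven_zero: "w 0 = 0"
  using driven unfolding driven_def sigma_def by blast+

lemma driven_nonzero: "0 \<le> t \<Longrightarrow> \<psi> t \<noteq> 0"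
  using driven_sphere[of t] rho_zero[of \<omega>, OF \<omega>] by auto

lemma driven_drift_continuous: "continuous_on {0..} (\<lambda>s. osc_A \<omega> (\<psi> s))"
  by (rule A.continuous_on[OF driven_cont])

lemma driven_tendsto:
  assumes "0 \<le> s" shows "(\<psi> \<longlongrightarrow> \<psi> s) (at s within {0..})"
  using driven_cont assms unfolding continuous_on_def by auto

lemma driven_drift_derivative:
  assumes s: "0 \<le> s"
  defines "v \<equiv> \<lambda>t. integral {0..t} (\<lambda>s. osc_A \<omega> (\<psi> s))"
  shows "((\<lambda>t. (1 / (t - s)) *\<^sub>R (v t - v s)) \<longlongrightarrow> osc_A \<omega> (\<psi> s)) (at s within {0..})"
proof (rule Lim_null[THEN iffD2], rule tendsto_norm_zero_cancel)
  let ?d = "osc_A \<omega> (\<psi> s)"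
  have "((\<lambda>t. norm (v t - v s - (t - s) *\<^sub>R ?d) / norm (t - s)) \<longlongrightarrow> 0) (at s within {0..})"
    using integral_has_vector_derivative_ray[OF driven_drift_continuous s]
    unfolding v_def has_vector_derivative_def has_derivative_iff_norm by blast
  then show "((\<lambda>t. norm ((1 / (t - s)) *\<^sub>R (v t - v s) - ?d)) \<longlongrightarrow> 0) (at s within {0..})"
  proof (rule Lim_transform_eventually)
    show "eventually (\<lambda>t. norm (v t - v s - (t - s) *\<^sub>R ?d) / norm (t - s) = norm ((1 / (t - s)) *\<^sub>R (v t - v s) - ?d)) (at s within {0..})"
      unfolding eventually_at_filter
    proof (rule always_eventually, intro allI impI)
      fix t assume ts: "t \<noteq> s"
      have "norm (v t - v s - (t - s) *\<^sub>R ?d) / norm (t - s) = norm ((1 / (t - s)) *\<^sub>R (v t - v s - (t - s) *\<^sub>R ?d))"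
        by simp
      also have "(1 / (t - s)) *\<^sub>R (v t - v s - (t - s) *\<^sub>R ?d) = (1 / (t - s)) *\<^sub>R (v t - v s) - ?d"
        using ts by (simp add: scaleR_diff_right)
      finally show "norm (v t - v s - (t - s) *\<^sub>R ?d) / norm (t - s) = norm ((1 / (t - s)) *\<^sub>R (v t - v s) - ?d)" .
    qed
  qed
qed

text \<open>The constraint \<open>\<langle>\<partial>\<rho>/\<partial>x, B\<rangle> = 0\<close>, differentiated along the curve, determines the control.\<close>

lemma driven_control:
  assumes s: "0 \<le> s" and H: "hessian (rho \<omega>) (\<psi> s) osc_B \<bullet> osc_B \<noteq> 0"
  shows "((\<lambda>t. (w t - w s) / (t - s)) \<longlongrightarrow> f_fun \<omega> (\<psi> s)) (at s within {0..})"
proof -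
  let ?F = "at s within {0..}"
  let ?g = "grad (rho \<omega>)"
  define q where "q = \<psi> s"
  define Hq where "Hq = hessian (rho \<omega>) q"
  define v where "v = (\<lambda>t. integral {0..t} (\<lambda>s. osc_A \<omega> (\<psi> s)))"
  define \<beta> where "\<beta> = Hq osc_B \<bullet> osc_B"
  have \<beta>: "\<beta> \<noteq> 0" using H by (simp add: \<beta>_def Hq_def q_def)
  have q0: "q \<noteq> 0" using driven_nonzero[OF s] by (simp add: q_def)
  have D: "(?g has_derivative Hq) (at q)" unfolding Hq_def using grad_rho_differentiable[OF \<omega> q0] .
  interpret Hq: bounded_linear Hq using has_derivative_bounded_linear[OF D] .
  have vlim: "((\<lambda>t. (1 / (t - s)) *\<^sub>R (v t - v s)) \<longlongrightarrow> osc_A \<omega> q) ?F"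
    unfolding v_def q_def by (rule driven_drift_derivative[OF s])
  have ev: "eventually (\<lambda>t. t \<in> {0..} \<and> t \<noteq> s) ?F" by (simp add: eventually_at_filter)
  have diff: "\<psi> t - q = (v t - v s) + (w t - w s) *\<^sub>R osc_B" if "0 \<le> t" for t
    using driven_eq[OF that] driven_eq[OF s] by (simp add: q_def v_def scaleR_diff_left)
  have "((\<lambda>t. norm ((1 / (t - s)) *\<^sub>R (v t - v s))) \<longlongrightarrow> norm (osc_A \<omega> q)) ?F" by (intro tendsto_intros vlim)
  then have vb: "eventually (\<lambda>t. norm ((1 / (t - s)) *\<^sub>R (v t - v s)) < norm (osc_A \<omega> q) + 1) ?F"
    by (rule order_tendstoD) simp
  define K where "K = norm (osc_A \<omega> q) + 1 + norm (osc_B :: 'n state) / R"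
  have K: "eventually (\<lambda>t. norm (\<psi> t - q) \<le> K * \<bar>t - s\<bar>) ?F"
    using vb ev
  proof eventually_elim
    case (elim t)
    have "norm (v t - v s) \<le> (norm (osc_A \<omega> q) + 1) * \<bar>t - s\<bar>"
      using elim by (simp add: pos_divide_less_eq less_imp_le)
    moreover have "norm ((w t - w s) *\<^sub>R (osc_B :: 'n state)) \<le> (\<bar>t - s\<bar> / R) * norm (osc_B :: 'n state)"
      using mult_right_mono[OF driven_lip[OF s, of t], of "norm (osc_B :: 'n state)"] elim by simp
    moreover have "norm (\<psi> t - q) \<le> norm (v t - v s) + norm ((w t - w s) *\<^sub>R (osc_B :: 'n state))"
      using diff[of t] elim norm_triangle_ineq[of "v t - v s" "(w t - w s) *\<^sub>R (osc_B :: 'n state)"] by simp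
    ultimately show ?case by (simp add: K_def algebra_simps)
  qed
  define E where "E x = norm (?g x - ?g q - Hq (x - q)) / norm (x - q)" for x
  have "(E \<longlongrightarrow> 0) (at q)" using D unfolding has_derivative_iff_norm E_def by blast
  then have "isCont E q" unfolding isCont_def by (simp add: E_def)
  then have Elim: "((\<lambda>t. E (\<psi> t)) \<longlongrightarrow> 0) ?F"
    using isCont_tendsto_compose[OF \<open>isCont E q\<close> driven_tendsto[OF s, folded q_def]] by (simp add: E_def)
  \<comment> \<open>The constraint holds at t and at s, so the linear part tested with
    \<open>osc_B\<close> equals minus the remainder of the gradient. That is o(|t - s|), because the
    curve moves at most at a linear rate.\<close>
  have small: "((\<lambda>t. (Hq (\<psi> t - q) \<bullet> osc_B) / (t - s)) \<longlongrightarrow> 0) ?F"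
  proof (rule tendsto_0_le[of "\<lambda>t. E (\<psi> t) * (K * norm (osc_B :: 'n state))" _ _ 1])
    show "((\<lambda>t. E (\<psi> t) * (K * norm (osc_B :: 'n state))) \<longlongrightarrow> 0) ?F"
      using tendsto_mult_right[OF Elim, of "K * norm (osc_B :: 'n state)"] by (simp add: tendsto_mult_left_zero Elim)
    show "eventually (\<lambda>t. norm ((Hq (\<psi> t - q) \<bullet> osc_B) / (t - s)) \<le> norm (E (\<psi> t) * (K * norm (osc_B :: 'n state))) * 1) ?F"
      using K ev
    proof eventually_elim
      case (elim t)
      have "(?g (\<psi> t) - ?g q) \<bullet> osc_B = 0"
        using driven_perp[of t] driven_perp[OF s] elim by (simp add: inner_diff_left q_def)
      then have "\<bar>Hq (\<psi> t - q) \<bullet> osc_B\<bar> = \<bar>(?g (\<psi> t) - ?g q - Hq (\<psi> t - q)) \<bullet> osc_B\<bar>"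
        by (simp add: inner_diff_left)
      also have "\<dots> \<le> norm (?g (\<psi> t) - ?g q - Hq (\<psi> t - q)) * norm (osc_B :: 'n state)" by (rule Cauchy_Schwarz_ineq2)
      also have "norm (?g (\<psi> t) - ?g q - Hq (\<psi> t - q)) = E (\<psi> t) * norm (\<psi> t - q)"
        by (cases "\<psi> t = q") (auto simp: E_def Hq.zero)
      also have "\<dots> * norm (osc_B :: 'n state) \<le> (E (\<psi> t) * (K * \<bar>t - s\<bar>)) * norm (osc_B :: 'n state)"
        using elim by (intro mult_right_mono mult_left_mono) (auto simp: E_def)
      finally have "\<bar>Hq (\<psi> t - q) \<bullet> osc_B\<bar> / \<bar>t - s\<bar> \<le> E (\<psi> t) * (K * norm (osc_B :: 'n state))"
        using elim by (simp add: pos_divide_le_eq mult_ac)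
      then show ?case by simp
    qed
  qed
  have lim: "((\<lambda>t. ((Hq (\<psi> t - q) \<bullet> osc_B) / (t - s) - Hq ((1 / (t - s)) *\<^sub>R (v t - v s)) \<bullet> osc_B) / \<beta>) \<longlongrightarrow> (0 - Hq (osc_A \<omega> q) \<bullet> osc_B) / \<beta>) ?F"
    by (intro tendsto_intros small Hq.tendsto vlim \<beta>)
  have fe: "(0 - Hq (osc_A \<omega> q) \<bullet> osc_B) / \<beta> = f_fun \<omega> (\<psi> s)"
    by (simp add: f_fun_def \<beta>_def Hq_def q_def)
  have eve: "eventually (\<lambda>t. ((Hq (\<psi> t - q) \<bullet> osc_B) / (t - s) - Hq ((1 / (t - s)) *\<^sub>R (v t - v s)) \<bullet> osc_B) / \<beta> = (w t - w s) / (t - s)) ?F"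
    using ev
  proof eventually_elim
    case (elim t)
    have "Hq (\<psi> t - q) \<bullet> osc_B = Hq (v t - v s) \<bullet> osc_B + (w t - w s) * \<beta>"
      using diff[of t] elim by (simp add: Hq.add Hq.scaleR inner_add_left \<beta>_def)
    moreover have "Hq ((1 / (t - s)) *\<^sub>R (v t - v s)) \<bullet> osc_B = (Hq (v t - v s) \<bullet> osc_B) / (t - s)"
      by (simp add: Hq.scaleR)
    ultimately show ?case using \<beta> by (simp add: add_divide_distrib)
  qed
  show ?thesis using Lim_transform_eventually[OF lim eve] unfolding fe .
qed

lemma driven_f_bound:
  assumes s: "0 \<le> s"
  shows "\<bar>f_fun \<omega> (\<psi> s)\<bar> \<le> 1 / R"
proof (cases "hessian (rho \<omega>) (\<psi> s) osc_B \<bullet> osc_B = 0")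
  \<comment> \<open>Division by zero makes \<open>f_fun\<close> equal to 0 here.\<close>
  case True
  then show ?thesis using R by (simp add: f_fun_def)
next
  case False
  have ev: "eventually (\<lambda>t. t \<in> {0..} \<and> t \<noteq> s) (at s within {0..})" by (simp add: eventually_at_filter)
  show ?thesis
  proof (rule tendsto_upperbound[OF tendsto_rabs[OF driven_control[OF s False]]])
    show "eventually (\<lambda>t. \<bar>(w t - w s) / (t - s)\<bar> \<le> 1 / R) (at s within {0..})"
      using ev
    proof eventually_elim
      case (elim t)
      then show ?case using driven_lip[OF s, of t] by (simp add: pos_divide_le_eq)
    qed
    show "at s within {0..} \<noteq> bot" by (rule at_within_ray_nontrivial[OF s])
  qed
qed

text \<open>\<open>osc_B\<close> has no position entries, so positions are differentiable whatever
  the control does.\<close>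

lemma driven_position:
  assumes s: "0 \<le> s"
  shows "((\<lambda>t. (fst (\<psi> t $ i) - fst (\<psi> s $ i)) / (t - s)) \<longlongrightarrow> snd (\<psi> s $ i)) (at s within {0..})"
proof -
  define v where "v = (\<lambda>t. integral {0..t} (\<lambda>s. osc_A \<omega> (\<psi> s)))"
  have lim: "((\<lambda>t. fst (((1 / (t - s)) *\<^sub>R (v t - v s)) $ i)) \<longlongrightarrow> fst (osc_A \<omega> (\<psi> s) $ i)) (at s within {0..})"
    unfolding v_def by (intro tendsto_fst tendsto_vec_nth driven_drift_derivative[OF s])
  have fe: "fst (osc_A \<omega> (\<psi> s) $ i) = snd (\<psi> s $ i)" by (simp add: osc_A_def)
  have ev: "eventually (\<lambda>t. t \<in> {0..} \<and> t \<noteq> s) (at s within {0..})" by (simp add: eventually_at_filter)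
  have eve: "eventually (\<lambda>t. fst (((1 / (t - s)) *\<^sub>R (v t - v s)) $ i) = (fst (\<psi> t $ i) - fst (\<psi> s $ i)) / (t - s)) (at s within {0..})"
    using ev
  proof eventually_elim
    case (elim t)
    have "\<psi> t - \<psi> s = (v t - v s) + (w t - w s) *\<^sub>R osc_B"
      using driven_eq[of t] driven_eq[OF s] elim by (simp add: v_def scaleR_diff_left)
    then have "fst ((\<psi> t - \<psi> s) $ i) = fst ((v t - v s) $ i)" by simp
    then show ?case by simp
  qed
  show ?thesis using Lim_transform_eventually[OF lim eve] unfolding fe .
qed

text \<open>At an accumulation point of such times the positions vanish by continuity. The
  difference quotients along these times make the velocities vanish too, so the curve would pass
  through 0, off the unit sphere of \<rho>. Finiteness is what the fundamental theorem below
  tolerates.\<close>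

lemma driven_exceptional_finite: "finite {s \<in> {0..b}. \<forall>i. fst (\<psi> s $ i) = 0}"
proof (rule ccontr)
  define Z where "Z = {s \<in> {0..b}. \<forall>i. fst (\<psi> s $ i) = 0}"
  assume "infinite {s \<in> {0..b}. \<forall>i. fst (\<psi> s $ i) = 0}"
  then have "infinite Z" "Z \<subseteq> {0..b}" by (auto simp: Z_def)
  then obtain s where s: "s \<in> {0..b}" "s islimpt Z"
    using compact_eq_Bolzano_Weierstrass[of "{0..b}"] compact_Icc[of 0 b] by blast
  then have s0: "0 \<le> s" by simp
  have nt: "at s within Z \<noteq> bot" using s(2) by (simp add: trivial_limit_within)
  have sub: "at s within Z \<le> at s within {0..}" by (rule at_le) (auto simp: Z_def)
  have evZ: "eventually (\<lambda>t. t \<in> Z) (at s within Z)" by (simp add: eventually_at_filter)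
  have x0: "fst (\<psi> s $ i) = 0" for i
  proof -
    have "((\<lambda>t. fst (\<psi> t $ i)) \<longlongrightarrow> fst (\<psi> s $ i)) (at s within Z)"
      using tendsto_mono[OF sub driven_tendsto[OF s0]] by (intro tendsto_fst tendsto_vec_nth)
    moreover have "((\<lambda>t. fst (\<psi> t $ i)) \<longlongrightarrow> 0) (at s within Z)"
      by (rule tendsto_eventually) (use evZ in eventually_elim, simp add: Z_def)
    ultimately show ?thesis using tendsto_unique[OF nt] by blast
  qed
  have "snd (\<psi> s $ i) = 0" for i
  proof -
    have "((\<lambda>t. (fst (\<psi> t $ i) - fst (\<psi> s $ i)) / (t - s)) \<longlongrightarrow> snd (\<psi> s $ i)) (at s within Z)"
      by (rule tendsto_mono[OF sub driven_position[OF s0]])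
    moreover have "((\<lambda>t. (fst (\<psi> t $ i) - fst (\<psi> s $ i)) / (t - s)) \<longlongrightarrow> 0) (at s within Z)"
      by (rule tendsto_eventually) (use evZ in eventually_elim, simp add: Z_def x0)
    ultimately show ?thesis using tendsto_unique[OF nt] by blast
  qed
  then have "\<psi> s = 0" using x0 by (simp add: vec_eq_iff prod_eq_iff)
  then show False using driven_nonzero[OF s0] by simp
qed

text \<open>\<open>w\<close> is continuous and has derivative f off the exceptional times, so the
  fundamental theorem yields the integrability of f together with its integral; the bound 1/R
  upgrades this to absolute integrability.\<close>

lemma driven_sigma_motion: "sigma_motion \<omega> \<psi>"
  unfolding sigma_motion_def ac_solution_def
proof (intro conjI allI impI)
  fix t :: real assume t: "0 \<le> t"
  show "\<psi> t \<in> sigma \<omega>" using driven t unfolding driven_def by blast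
  have wcont: "continuous_on {0..t} w"
  proof (rule lipschitz_on_continuous_on[of "1 / R"], rule lipschitz_onI)
    show "dist (w x) (w y) \<le> 1 / R * dist x y" if "x \<in> {0..t}" "y \<in> {0..t}" for x y
      using driven_lip[of x y] that by (simp add: dist_real_def abs_minus_commute)
  qed (use R in simp)
  have "((\<lambda>s. f_fun \<omega> (\<psi> s)) has_integral (w t - w 0)) {0..t}"
  proof (rule fundamental_theorem_of_calculus_interior_strong[OF driven_exceptional_finite[of t] t _ wcont])
    fix s assume s: "s \<in> {0<..<t} - {s \<in> {0..t}. \<forall>i. fst (\<psi> s $ i) = 0}"
    then obtain i where i: "fst (\<psi> s $ i) \<noteq> 0" by auto
    have s0: "0 \<le> s" using s by simp
    have "((\<lambda>t. (w t - w s) / (t - s)) \<longlongrightarrow> f_fun \<omega> (\<psi> s)) (at s within {0..})"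
      by (intro driven_control[OF s0] hessian_rho_pos[OF \<omega> driven_nonzero[OF s0] driven_perp[OF s0] i])
    moreover have "at s within {0..} = at s" using s by (intro at_within_interior) (auto simp: interior_real_atLeast)
    ultimately have "(w has_real_derivative f_fun \<omega> (\<psi> s)) (at s)" by (simp add: has_field_derivative_iff)
    then show "(w has_vector_derivative f_fun \<omega> (\<psi> s)) (at s)" by (simp add: has_real_derivative_iff_has_vector_derivative)
  qed
  then have f: "(\<lambda>s. f_fun \<omega> (\<psi> s)) integrable_on {0..t}" "integral {0..t} (\<lambda>s. f_fun \<omega> (\<psi> s)) = w t"
    using driven_zero by (auto simp: integral_unique)
  have fa: "(\<lambda>s. f_fun \<omega> (\<psi> s)) absolutely_integrable_on {0..t}"
    by (rule absolutely_integrable_integrable_bound[OF _ f(1), of "\<lambda>_. 1 / R"]) (auto intro: driven_f_bound)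
  have fb: "(\<lambda>s. f_fun \<omega> (\<psi> s) *\<^sub>R (osc_B :: 'n state)) absolutely_integrable_on {0..t}"
    using absolutely_integrable_linear[OF fa bounded_linear_scaleR_left[of "osc_B :: 'n state"]] by (simp add: comp_def)
  have Aa: "(\<lambda>s. osc_A \<omega> (\<psi> s)) absolutely_integrable_on {0..t}"
    by (intro absolutely_integrable_continuous_real continuous_on_subset[OF driven_drift_continuous]) auto
  show "(\<lambda>t. osc_A \<omega> (\<psi> t) + f_fun \<omega> (\<psi> t) *\<^sub>R osc_B) absolutely_integrable_on {0..t}"
    by (rule set_integral_add(1)[OF Aa fb])
  have "integral {0..t} (\<lambda>t. osc_A \<omega> (\<psi> t) + f_fun \<omega> (\<psi> t) *\<^sub>R osc_B) =
      integral {0..t} (\<lambda>t. osc_A \<omega> (\<psi> t)) + integral {0..t} (\<lambda>t. f_fun \<omega> (\<psi> t) *\<^sub>R osc_B)"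
    using set_lebesgue_integral_eq_integral(1)[OF Aa] set_lebesgue_integral_eq_integral(1)[OF fb] by (rule integral_add)
  also have "integral {0..t} (\<lambda>t. f_fun \<omega> (\<psi> t) *\<^sub>R osc_B) = w t *\<^sub>R (osc_B :: 'n state)"
    using integral_linear[OF f(1) bounded_linear_scaleR_left[of "osc_B :: 'n state"]] f(2) by (simp add: comp_def)
  finally show "\<psi> t = \<psi> 0 + integral {0..t} (\<lambda>t. osc_A \<omega> (\<psi> t) + f_fun \<omega> (\<psi> t) *\<^sub>R osc_B)"
    using driven_eq[OF t] by (simp add: add.assoc)
qed

end

section \<open>Limits of controlled motions\<close>

lemma basic_control_le: "v \<in> basic_control \<omega> x \<Longrightarrow> \<bar>v\<bar> \<le> 1"
  by (auto simp: basic_control_def sign_set_def sgn_if abs_le_iff split: if_splits)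

lemma continuous_on_ray:
  fixes f :: "real \<Rightarrow> 'a::topological_space"
  assumes "\<And>b. continuous_on {0..b} f"
  shows "continuous_on {0..} f"
  unfolding continuous_on_def
proof
  fix x :: real assume x: "x \<in> {0..}"
  have "(f \<longlongrightarrow> f x) (at x within {0..x + 1})" using assms[of "x + 1"] x unfolding continuous_on_def by auto
  moreover have "at x within {0..x + 1} = at x within {0..}"
    using x by (intro at_within_nhd[of x "{x - 1<..<x + 1}"]) auto
  ultimately show "(f \<longlongrightarrow> f x) (at x within {0..})" by simp
qed

text \<open>A diagonal subsequence converges at the rational times, and the common Lipschitz
  constant extends this to all times. Pointwise convergence is enough, since limits of integrals are
  taken by dominated convergence.\<close>

lemma equi_lipschitz_convergent:
  fixes f :: "nat \<Rightarrow> real \<Rightarrow> 'a::euclidean_space"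
  assumes M: "\<And>n s. 0 \<le> s \<Longrightarrow> norm (f n s) \<le> M"
    and C: "\<And>n s t. 0 \<le> s \<Longrightarrow> 0 \<le> t \<Longrightarrow> norm (f n t - f n s) \<le> C * \<bar>t - s\<bar>"
  obtains \<kappa> g where "strict_mono (\<kappa> :: nat \<Rightarrow> nat)" "\<And>s. 0 \<le> s \<Longrightarrow> (\<lambda>n. f (\<kappa> n) s) \<longlonglongrightarrow> g s"
proof -
  obtain \<kappa> where \<kappa>: "strict_mono (\<kappa> :: nat \<Rightarrow> nat)" "\<And>q. q \<in> {q \<in> \<rat>. 0 \<le> q} \<Longrightarrow> \<exists>l. (\<lambda>n. f (\<kappa> n) q) \<longlonglongrightarrow> l"
    by (rule function_convergent_subsequence[of "{q \<in> \<rat>. 0 \<le> q}" f M]) (use M countable_rat in \<open>auto intro: countable_subset\<close>)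
  have "\<exists>l. (\<lambda>n. f (\<kappa> n) s) \<longlonglongrightarrow> l" if s: "0 \<le> s" for s
  proof -
    have "Cauchy (\<lambda>n. f (\<kappa> n) s)"
    proof (rule metric_CauchyI)
      fix e :: real assume e: "0 < e"
      define k where "k = \<bar>C\<bar> + 1"
      have k: "0 < k" by (simp add: k_def)
      define \<delta> where "\<delta> = e / (4 * k)"
      have \<delta>: "0 < \<delta>" using e k by (simp add: \<delta>_def)
      obtain q where q: "q \<in> \<rat>" "s < q" "q < s + \<delta>" using Rats_dense_in_real[of s "s + \<delta>"] \<delta> by auto
      have near: "dist (f (\<kappa> n) s) (f (\<kappa> n) q) \<le> e / 4" for n
      proof -
        have "norm (f (\<kappa> n) s - f (\<kappa> n) q) \<le> C * \<bar>s - q\<bar>" using C[of q s "\<kappa> n"] q s by simp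
        also have "\<dots> \<le> k * \<delta>" using q by (intro mult_mono) (auto simp: k_def)
        also have "\<dots> = e / 4" using k by (simp add: \<delta>_def)
        finally show ?thesis by (simp add: dist_norm)
      qed
      have "Cauchy (\<lambda>n. f (\<kappa> n) q)" using \<kappa>(2)[of q] q s LIMSEQ_imp_Cauchy by auto
      then obtain N where N: "\<And>m n. m \<ge> N \<Longrightarrow> n \<ge> N \<Longrightarrow> dist (f (\<kappa> m) q) (f (\<kappa> n) q) < e / 2"
        using metric_CauchyD[of "\<lambda>n. f (\<kappa> n) q" "e / 2"] e by auto
      show "\<exists>N. \<forall>m\<ge>N. \<forall>n\<ge>N. dist (f (\<kappa> m) s) (f (\<kappa> n) s) < e"
      proof (intro exI allI impI)
        fix m n assume mn: "N \<le> m" "N \<le> n"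
        have "dist (f (\<kappa> m) s) (f (\<kappa> n) s) \<le> dist (f (\<kappa> m) s) (f (\<kappa> m) q) + dist (f (\<kappa> m) q) (f (\<kappa> n) q) + dist (f (\<kappa> n) q) (f (\<kappa> n) s)"
          using dist_triangle[of "f (\<kappa> m) s" "f (\<kappa> n) s" "f (\<kappa> m) q"] dist_triangle[of "f (\<kappa> m) q" "f (\<kappa> n) s" "f (\<kappa> n) q"] by linarith
        also have "\<dots> < e" using near[of m] near[of n] N[OF mn] by (simp add: dist_commute)
        finally show "dist (f (\<kappa> m) s) (f (\<kappa> n) s) < e" .
      qed
    qed
    then show ?thesis using Cauchy_convergent convergent_def by blast
  qed
  then obtain g where "\<And>s. 0 \<le> s \<Longrightarrow> (\<lambda>n. f (\<kappa> n) s) \<longlonglongrightarrow> g s" by metis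
  then show ?thesis using that \<kappa>(1) by blast
qed

context
  fixes \<omega> :: "real^'n::finite" and r :: "real \<Rightarrow> real" and \<phi> :: "real \<Rightarrow> 'n state"
  assumes \<omega>: "\<And>i. 0 < \<omega> $ i" and polar: "polar_motion \<omega> r \<phi>"
begin

interpretation A: bounded_linear "osc_A \<omega>"
  by (rule osc_A_linear)

text \<open>The rate at which r decreases, with the gradient taken at \<phi> instead of r \<phi>,
  which \<open>gain_eq\<close> permits.\<close>

definition gain :: "real \<Rightarrow> real" where
  "gain t = \<bar>grad (rho \<omega>) (\<phi> t) \<bullet> osc_B\<bar>"

lemma polar_r_pos: "0 \<le> t \<Longrightarrow> 0 < r t"
  and polar_sphere: "0 \<le> t \<Longrightarrow> rho \<omega> (\<phi> t) = 1"
  using polar unfolding polar_motion_def by blast+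

lemma polar_nonzero: "0 \<le> t \<Longrightarrow> \<phi> t \<noteq> 0"
  using polar_sphere[of t] rho_zero[of \<omega>, OF \<omega>] by auto

lemma gain_eq: "0 \<le> t \<Longrightarrow> \<bar>grad (rho \<omega>) (r t *\<^sub>R \<phi> t) \<bullet> osc_B\<bar> = gain t"
  by (simp add: gain_def grad_rho_scale[OF \<omega> polar_r_pos polar_nonzero])

lemma gain_nonneg: "0 \<le> gain t"
  by (simp add: gain_def)

lemma r_integral:
  assumes "0 \<le> t" shows "gain integrable_on {0..t}" "r t = r 0 - integral {0..t} gain"
proof -
  have "(\<lambda>t. - \<bar>grad (rho \<omega>) (r t *\<^sub>R \<phi> t) \<bullet> osc_B\<bar>) absolutely_integrable_on {0..t}"
    and e: "r t = r 0 + integral {0..t} (\<lambda>t. - \<bar>grad (rho \<omega>) (r t *\<^sub>R \<phi> t) \<bullet> osc_B\<bar>)"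
    using polar assms unfolding polar_motion_def ac_solution_def by blast+
  then have "(\<lambda>t. - \<bar>grad (rho \<omega>) (r t *\<^sub>R \<phi> t) \<bullet> osc_B\<bar>) integrable_on {0..t}"
    using set_lebesgue_integral_eq_integral(1) by blast
  then have "(\<lambda>t. - gain t) integrable_on {0..t}"
    by (rule integrable_eq) (simp add: gain_eq)
  then show g: "gain integrable_on {0..t}" using integrable_neg by fastforce
  have "integral {0..t} (\<lambda>t. - \<bar>grad (rho \<omega>) (r t *\<^sub>R \<phi> t) \<bullet> osc_B\<bar>) = integral {0..t} (\<lambda>t. - gain t)"
    by (rule integral_cong) (simp add: gain_eq)
  then show "r t = r 0 - integral {0..t} gain" using e by (simp add: integral_neg)
qed

lemma r_diff:
  assumes "0 \<le> s" "s \<le> t" shows "gain integrable_on {s..t}" "integral {s..t} gain = r s - r t"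
proof -
  have t: "0 \<le> t" using assms by simp
  show "gain integrable_on {s..t}"
    by (rule integrable_on_subinterval[OF r_integral(1)[OF t]]) (use assms in auto)
  have "integral {0..s} gain + integral {s..t} gain = integral {0..t} gain"
    by (rule Henstock_Kurzweil_Integration.integral_combine[OF assms r_integral(1)[OF t]])
  then show "integral {s..t} gain = r s - r t" using r_integral(2)[OF t] r_integral(2)[OF assms(1)] by simp
qed

lemma r_antimono: "0 \<le> s \<Longrightarrow> s \<le> t \<Longrightarrow> r t \<le> r s"
  using r_diff[of s t] integral_nonneg[of gain "{s..t}"] gain_nonneg by fastforce

lemma r_limit:
  obtains R where "0 \<le> R" "(r \<longlongrightarrow> R) at_top" "\<And>t. 0 \<le> t \<Longrightarrow> R \<le> r t"
proof -
  define R where "R = Inf (r ` {0..})"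
  have bdd: "bdd_below (r ` {0..})" using polar_r_pos by (intro bdd_belowI[of _ 0]) (auto intro: less_imp_le)
  have le: "R \<le> r t" if "0 \<le> t" for t unfolding R_def using that bdd by (intro cInf_lower) auto
  have "0 \<le> R" unfolding R_def using polar_r_pos by (intro cInf_greatest) (auto intro: less_imp_le)
  moreover have "(r \<longlongrightarrow> R) at_top"
  proof (rule order_tendstoI)
    fix a assume "a < R"
    then show "eventually (\<lambda>t. a < r t) at_top"
      by (intro eventually_mono[OF eventually_ge_at_top[of 0]]) (use le less_le_trans in blast)
  next
    fix a assume "R < a"
    then obtain s where s: "0 \<le> s" "r s < a" unfolding R_def using cInf_lessD[of "r ` {0..}" a] by auto
    show "eventually (\<lambda>t. r t < a) at_top"
      using eventually_ge_at_top[of s] by eventually_elim (use s r_antimono le_less_trans in blast)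
  qed
  ultimately show ?thesis using that le by blast
qed

lemma sphere_bound: obtains M where "0 < M" "\<And>x. rho \<omega> x = 1 \<Longrightarrow> norm x \<le> M"
    "\<And>x. rho \<omega> x = 1 \<Longrightarrow> \<bar>grad (rho \<omega>) x \<bullet> osc_B\<bar> \<le> M"
proof -
  let ?S = "{x. rho \<omega> x = 1}"
  have c: "compact ?S" by (rule compact_rho_sphere[OF \<omega>])
  have "?S \<subseteq> - {0}" using rho_zero[of \<omega>, OF \<omega>] by auto
  then have "compact ((\<lambda>x. grad (rho \<omega>) x \<bullet> osc_B) ` ?S)"
    by (intro compact_continuous_image c continuous_intros continuous_on_subset[OF grad_rho_continuous[OF \<omega>]])
  then obtain M1 where "\<forall>y\<in>(\<lambda>x. grad (rho \<omega>) x \<bullet> osc_B) ` ?S. norm y \<le> M1"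
    using compact_imp_bounded bounded_iff by blast
  then have M1: "\<bar>grad (rho \<omega>) x \<bullet> osc_B\<bar> \<le> M1" if "rho \<omega> x = 1" for x
    using that by simp
  obtain M2 where M2: "\<And>x. rho \<omega> x = 1 \<Longrightarrow> norm x \<le> M2"
    using compact_imp_bounded[OF c] unfolding bounded_iff by blast
  show ?thesis
  proof (rule that[of "\<bar>M1\<bar> + \<bar>M2\<bar> + 1"])
    show "norm x \<le> \<bar>M1\<bar> + \<bar>M2\<bar> + 1" if "rho \<omega> x = 1" for x using M2[OF that] by simp
    show "\<bar>grad (rho \<omega>) x \<bullet> osc_B\<bar> \<le> \<bar>M1\<bar> + \<bar>M2\<bar> + 1" if "rho \<omega> x = 1" for x using M1[OF that] by simp
  qed simp
qed

lemma r_continuous: "continuous_on {0..} r"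
proof -
  have "continuous_on {0..b} r" for b
  proof (cases "0 \<le> b")
    case True
    have "continuous_on {0..b} (\<lambda>t. r 0 - integral {0..t} gain)"
      by (intro continuous_intros indefinite_integral_continuous_1 r_integral(1)[OF True])
    moreover have "r 0 - integral {0..x} gain = r x" if "x \<in> {0..b}" for x
      using r_integral(2)[of x] that by simp
    ultimately show ?thesis by (rule continuous_on_eq)
  qed simp
  then show ?thesis by (rule continuous_on_ray)
qed

definition velocity :: "(real \<Rightarrow> real) \<Rightarrow> real \<Rightarrow> 'n state" where
  "velocity u t = osc_A \<omega> (\<phi> t) + (1 / r t) *\<^sub>R (u t *\<^sub>R osc_B + gain t *\<^sub>R \<phi> t)"

lemma polar_control:
  "\<exists>u. \<forall>t\<ge>0. \<bar>u t\<bar> \<le> 1 \<and> velocity u integrable_on {0..t} \<and> \<phi> t = \<phi> 0 + integral {0..t} (velocity u)"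
proof -
  obtain u where u: "\<forall>t\<ge>0. u t \<in> basic_control \<omega> (r t *\<^sub>R \<phi> t)"
    and ac: "ac_solution \<phi> (\<lambda>t. osc_A \<omega> (\<phi> t) +
          (1 / r t) *\<^sub>R (u t *\<^sub>R osc_B + \<bar>grad (rho \<omega>) (r t *\<^sub>R \<phi> t) \<bullet> osc_B\<bar> *\<^sub>R \<phi> t))"
    using polar unfolding polar_motion_def by blast
  have e: "velocity u s = osc_A \<omega> (\<phi> s) +
          (1 / r s) *\<^sub>R (u s *\<^sub>R osc_B + \<bar>grad (rho \<omega>) (r s *\<^sub>R \<phi> s) \<bullet> osc_B\<bar> *\<^sub>R \<phi> s)" if "0 \<le> s" for s
    by (simp add: velocity_def gain_eq[OF that])
  show ?thesis
  proof (intro exI[of _ u] allI impI conjI)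
    fix t :: real assume t: "0 \<le> t"
    have "u t \<in> basic_control \<omega> (r t *\<^sub>R \<phi> t)" using u t by blast
    then show "\<bar>u t\<bar> \<le> 1" by (rule basic_control_le)
    have "(\<lambda>t. osc_A \<omega> (\<phi> t) + (1 / r t) *\<^sub>R (u t *\<^sub>R osc_B + \<bar>grad (rho \<omega>) (r t *\<^sub>R \<phi> t) \<bullet> osc_B\<bar> *\<^sub>R \<phi> t)) integrable_on {0..t}"
      using ac t set_lebesgue_integral_eq_integral(1) unfolding ac_solution_def by blast
    then show "velocity u integrable_on {0..t}" by (rule integrable_eq) (simp add: e)
    have "integral {0..t} (velocity u) = integral {0..t} (\<lambda>t. osc_A \<omega> (\<phi> t) + (1 / r t) *\<^sub>R (u t *\<^sub>R osc_B + \<bar>grad (rho \<omega>) (r t *\<^sub>R \<phi> t) \<bullet> osc_B\<bar> *\<^sub>R \<phi> t))"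
      by (rule integral_cong) (simp add: e)
    moreover have "\<phi> t = \<phi> 0 + integral {0..t} (\<lambda>t. osc_A \<omega> (\<phi> t) + (1 / r t) *\<^sub>R (u t *\<^sub>R osc_B + \<bar>grad (rho \<omega>) (r t *\<^sub>R \<phi> t) \<bullet> osc_B\<bar> *\<^sub>R \<phi> t))"
      using ac t unfolding ac_solution_def by blast
    ultimately show "\<phi> t = \<phi> 0 + integral {0..t} (velocity u)" by (simp only:)
  qed
qed

lemma \<phi>_continuous: "continuous_on {0..} \<phi>"
proof -
  obtain u where "\<forall>t\<ge>0. \<bar>u t\<bar> \<le> 1 \<and> velocity u integrable_on {0..t} \<and> \<phi> t = \<phi> 0 + integral {0..t} (velocity u)"
    using polar_control by blast
  then have u: "\<And>t. 0 \<le> t \<Longrightarrow> velocity u integrable_on {0..t}" "\<And>t. 0 \<le> t \<Longrightarrow> \<phi> t = \<phi> 0 + integral {0..t} (velocity u)"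
    by blast+
  have "continuous_on {0..b} \<phi>" for b
  proof (cases "0 \<le> b")
    case True
    have "continuous_on {0..b} (\<lambda>t. \<phi> 0 + integral {0..t} (velocity u))"
      by (intro continuous_intros indefinite_integral_continuous_1 u(1)[OF True])
    moreover have "\<phi> 0 + integral {0..x} (velocity u) = \<phi> x" if "x \<in> {0..b}" for x
      using u(2)[of x] that by simp
    ultimately show ?thesis by (rule continuous_on_eq)
  qed simp
  then show ?thesis by (rule continuous_on_ray)
qed

lemma drift_continuous: "continuous_on {0..} (\<lambda>s. osc_A \<omega> (\<phi> s))"
  by (rule A.continuous_on[OF \<phi>_continuous])

lemma gain_continuous: "continuous_on {0..} gain"
  unfolding gain_def
  by (intro continuous_intros continuous_on_compose2[OF grad_rho_continuous[OF \<omega>] \<phi>_continuous])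
     (auto simp: polar_nonzero)

definition radial :: "real \<Rightarrow> 'n state" where
  "radial t = (gain t / r t) *\<^sub>R \<phi> t"

lemma radial_continuous: "continuous_on {0..} radial"
  unfolding radial_def
  by (intro continuous_intros gain_continuous r_continuous \<phi>_continuous) (use polar_r_pos in force)

text \<open>W is the primitive of u / r. Its integrability is not assumed but deduced: the velocity
  is integrable, and the drift and radial terms subtracted from it are continuous.\<close>

lemma polar_primitive:
  obtains W where "\<And>t. 0 \<le> t \<Longrightarrow> \<phi> t = \<phi> 0 + integral {0..t} (\<lambda>s. osc_A \<omega> (\<phi> s)) + W t *\<^sub>R osc_B + integral {0..t} radial"
    "\<And>R s t. 0 < R \<Longrightarrow> (\<And>t. 0 \<le> t \<Longrightarrow> R \<le> r t) \<Longrightarrow> 0 \<le> s \<Longrightarrow> s \<le> t \<Longrightarrow> \<bar>W t - W s\<bar> \<le> (t - s) / R"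
proof -
  obtain u where "\<forall>t\<ge>0. \<bar>u t\<bar> \<le> 1 \<and> velocity u integrable_on {0..t} \<and> \<phi> t = \<phi> 0 + integral {0..t} (velocity u)"
    using polar_control by blast
  then have u: "\<And>t. 0 \<le> t \<Longrightarrow> \<bar>u t\<bar> \<le> 1" "\<And>t. 0 \<le> t \<Longrightarrow> velocity u integrable_on {0..t}"
    "\<And>t. 0 \<le> t \<Longrightarrow> \<phi> t = \<phi> 0 + integral {0..t} (velocity u)"
    by blast+
  define U where "U t = u t / r t" for t
  have dI: "(\<lambda>s. osc_A \<omega> (\<phi> s)) integrable_on {0..t}" "radial integrable_on {0..t}" for t
    by (auto intro!: integrable_continuous_real continuous_on_subset[OF drift_continuous] continuous_on_subset[OF radial_continuous])
  have Ueq: "U s *\<^sub>R osc_B = velocity u s - osc_A \<omega> (\<phi> s) - radial s" for s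
    by (simp add: velocity_def U_def radial_def scaleR_add_right)
  have UB: "(\<lambda>s. U s *\<^sub>R (osc_B :: 'n state)) integrable_on {0..t}" if "0 \<le> t" for t
    unfolding Ueq by (intro integrable_diff u(2) dI that)
  have UI: "U integrable_on {0..t}" if t: "0 \<le> t" for t
  proof -
    \<comment> \<open>Any index serves: every component of \<open>osc_B\<close> is (0, 1), so this
      functional recovers the coefficient.\<close>
    have "bounded_linear (\<lambda>x::'n state. snd (x $ undefined))"
      by (rule bounded_linear_compose[OF bounded_linear_snd bounded_linear_vec_nth])
    from integrable_linear[OF UB[OF t] this] show ?thesis by (simp add: comp_def)
  qed
  define W where "W t = integral {0..t} U" for t
  show ?thesis
  proof (rule that[of W])
    fix t :: real assume t: "0 \<le> t"
    have "integral {0..t} (velocity u) = integral {0..t} (\<lambda>s. osc_A \<omega> (\<phi> s) + U s *\<^sub>R osc_B + radial s)"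
      by (simp add: Ueq)
    also have "\<dots> = integral {0..t} (\<lambda>s. osc_A \<omega> (\<phi> s)) + integral {0..t} (\<lambda>s. U s *\<^sub>R osc_B) + integral {0..t} radial"
      by (subst integral_add[OF integrable_add[OF dI(1) UB[OF t]] dI(2)], subst integral_add[OF dI(1) UB[OF t]]) simp
    also have "integral {0..t} (\<lambda>s. U s *\<^sub>R (osc_B :: 'n state)) = W t *\<^sub>R osc_B"
      using integral_linear[OF UI[OF t] bounded_linear_scaleR_left[of "osc_B :: 'n state"]] by (simp add: comp_def W_def)
    finally show "\<phi> t = \<phi> 0 + integral {0..t} (\<lambda>s. osc_A \<omega> (\<phi> s)) + W t *\<^sub>R osc_B + integral {0..t} radial"
      using u(3)[OF t] by (simp add: add.assoc)
  next
    fix R s t :: real assume R: "0 < R" "\<And>t. 0 \<le> t \<Longrightarrow> R \<le> r t" and st: "0 \<le> s" "s \<le> t"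
    have t: "0 \<le> t" using st by simp
    have "W s + integral {s..t} U = W t"
      unfolding W_def by (rule Henstock_Kurzweil_Integration.integral_combine[OF st UI[OF t]])
    moreover have "norm (integral {s..t} U) \<le> integral {s..t} (\<lambda>_. 1 / R)"
    proof (rule Henstock_Kurzweil_Integration.integral_norm_bound_integral)
      show "U integrable_on {s..t}" by (rule integrable_on_subinterval[OF UI[OF t]]) (use st in auto)
      show "norm (U x) \<le> 1 / R" if "x \<in> {s..t}" for x
      proof -
        have "0 \<le> x" using that st by simp
        then show ?thesis using u(1)[of x] R(2)[of x] R(1) by (simp add: U_def abs_divide frac_le)
      qed
    qed (rule integrable_const_ivl)
    moreover have "integral {s..t} (\<lambda>_. 1 / R) = (t - s) / R" using st by simp
    ultimately have "norm (integral {s..t} U) \<le> (t - s) / R" "integral {s..t} U = W t - W s" by linarith+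
    then show "\<bar>W t - W s\<bar> \<le> (t - s) / R" by simp
  qed
qed

text \<open>Translates of \<phi> are equi-Lipschitz, so a subsequence converges. Over a fixed window
  the integral of \<open>gain\<close> is the drop of r, which tends to 0. This gives the constraint
  on the limit curve and removes the radial term, leaving the drift and a Lipschitz multiple of
  \<open>osc_B\<close>.\<close>

lemma polar_limit:
  assumes R: "0 < R" "\<And>t. 0 \<le> t \<Longrightarrow> R \<le> r t" "(r \<longlongrightarrow> R) at_top"
    and T: "\<And>n. 0 \<le> T n" "filterlim T at_top sequentially"
  obtains \<kappa> \<psi> w where "strict_mono (\<kappa> :: nat \<Rightarrow> nat)" "driven \<omega> R \<psi> w" "\<And>s. 0 \<le> s \<Longrightarrow> (\<lambda>n. \<phi> (T (\<kappa> n) + s)) \<longlonglongrightarrow> \<psi> s"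
proof -
  obtain M where M: "0 < M" "\<And>x. rho \<omega> x = 1 \<Longrightarrow> norm x \<le> M" "\<And>x. rho \<omega> x = 1 \<Longrightarrow> \<bar>grad (rho \<omega>) x \<bullet> osc_B\<bar> \<le> M"
    using sphere_bound by blast
  obtain KA where KA: "0 < KA" "\<And>x. norm (osc_A \<omega> x) \<le> norm x * KA" using A.pos_bounded by blast
  obtain W where W: "\<And>t. 0 \<le> t \<Longrightarrow> \<phi> t = \<phi> 0 + integral {0..t} (\<lambda>s. osc_A \<omega> (\<phi> s)) + W t *\<^sub>R osc_B + integral {0..t} radial"
    "\<And>s t. 0 \<le> s \<Longrightarrow> s \<le> t \<Longrightarrow> \<bar>W t - W s\<bar> \<le> (t - s) / R"
    using polar_primitive R(1,2) by metis
  have dI: "(\<lambda>s. osc_A \<omega> (\<phi> s)) integrable_on {a..b}" "radial integrable_on {a..b}" if "0 \<le> a" for a b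
    using that by (auto intro!: integrable_continuous_real continuous_on_subset[OF drift_continuous] continuous_on_subset[OF radial_continuous])
  have phi_diff: "\<phi> t - \<phi> s = integral {s..t} (\<lambda>s. osc_A \<omega> (\<phi> s)) + (W t - W s) *\<^sub>R osc_B + integral {s..t} radial"
    if "0 \<le> s" "s \<le> t" for s t
  proof -
    have "integral {0..s} (\<lambda>s. osc_A \<omega> (\<phi> s)) + integral {s..t} (\<lambda>s. osc_A \<omega> (\<phi> s)) = integral {0..t} (\<lambda>s. osc_A \<omega> (\<phi> s))"
      "integral {0..s} radial + integral {s..t} radial = integral {0..t} radial"
      using that by (intro Henstock_Kurzweil_Integration.integral_combine dI; simp)+
    then show ?thesis using W(1)[of s] W(1)[of t] that by (simp add: scaleR_diff_left algebra_simps)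
  qed
  have A_le: "norm (osc_A \<omega> (\<phi> s)) \<le> M * KA" if "0 \<le> s" for s
    using order_trans[OF KA(2) mult_right_mono[OF M(2)[OF polar_sphere[OF that]]]] KA(1) by simp
  have drift_le: "norm (integral {s..t} (\<lambda>s. osc_A \<omega> (\<phi> s))) \<le> M * KA * (t - s)" if "0 \<le> s" "s \<le> t" for s t
    using that A_le by (intro integral_bound continuous_on_subset[OF drift_continuous]) auto
  have radial_le: "norm (integral {s..t} radial) \<le> M / R * (r s - r t)" if "0 \<le> s" "s \<le> t" for s t
  proof -
    have "norm (integral {s..t} radial) \<le> integral {s..t} (\<lambda>x. M / R * gain x)"
    proof (rule Henstock_Kurzweil_Integration.integral_norm_bound_integral)
      show "radial integrable_on {s..t}" by (rule dI(2)[OF that(1)])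
      show "(\<lambda>x. M / R * gain x) integrable_on {s..t}" using r_diff(1)[OF that] by (rule integrable_on_mult_right)
      show "norm (radial x) \<le> M / R * gain x" if "x \<in> {s..t}" for x
      proof -
        have x: "0 \<le> x" using that \<open>0 \<le> s\<close> by simp
        have "norm (radial x) = gain x * (norm (\<phi> x) / r x)"
          using polar_r_pos[OF x] gain_nonneg[of x] by (simp add: radial_def)
        also have "\<dots> \<le> gain x * (M / R)"
          using M(2)[OF polar_sphere[OF x]] R(1) R(2)[OF x] gain_nonneg M(1) by (intro mult_left_mono frac_le) auto
        finally show ?thesis by (simp add: mult.commute)
      qed
    qed
    also have "\<dots> = M / R * integral {s..t} gain" by simp
    finally show ?thesis using r_diff(2)[OF that] by simp
  qed
  have r_lip: "r s - r t \<le> M * (t - s)" if "0 \<le> s" "s \<le> t" for s t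
  proof -
    have "integral {s..t} gain \<le> integral {s..t} (\<lambda>_. M)"
      using that M(3)[OF polar_sphere] by (intro integral_le r_diff(1)) (auto simp: gain_def)
    then show ?thesis using that r_diff(2)[OF that] by (simp add: mult.commute)
  qed
  \<comment> \<open>The contributions of the drift, of the control divided by r, and of the radial
    term.\<close>
  define C where "C = M * KA + norm (osc_B :: 'n state) / R + M / R * M"
  have lip0: "norm (\<phi> t - \<phi> s) \<le> C * (t - s)" if st: "0 \<le> s" "s \<le> t" for s t
  proof -
    have "norm (\<phi> t - \<phi> s) \<le> norm (integral {s..t} (\<lambda>s. osc_A \<omega> (\<phi> s))) + norm ((W t - W s) *\<^sub>R (osc_B :: 'n state)) + norm (integral {s..t} radial)"
      unfolding phi_diff[OF st] by (rule norm_triangle_le[OF add_right_mono[OF norm_triangle_ineq]])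
    moreover have "norm ((W t - W s) *\<^sub>R (osc_B :: 'n state)) \<le> (t - s) / R * norm (osc_B :: 'n state)"
      using mult_right_mono[OF W(2)[OF st], of "norm (osc_B :: 'n state)"] by simp
    moreover have "norm (integral {s..t} radial) \<le> M / R * (M * (t - s))"
      using radial_le[OF st] mult_left_mono[OF r_lip[OF st], of "M / R"] M(1) R(1) by simp
    moreover have "C * (t - s) = M * KA * (t - s) + (t - s) / R * norm (osc_B :: 'n state) + M / R * (M * (t - s))"
      using R(1) by (simp add: C_def field_simps)
    ultimately show ?thesis using drift_le[OF st] by linarith
  qed
  have lip: "norm (\<phi> t - \<phi> s) \<le> C * \<bar>t - s\<bar>" if "0 \<le> s" "0 \<le> t" for s t
    using lip0[of s t] lip0[of t s] that by (cases "s \<le> t") (auto simp: norm_minus_commute)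
  obtain \<kappa> \<psi> where \<kappa>: "strict_mono (\<kappa> :: nat \<Rightarrow> nat)" and \<psi>: "\<And>s. 0 \<le> s \<Longrightarrow> (\<lambda>n. \<phi> (T (\<kappa> n) + s)) \<longlonglongrightarrow> \<psi> s"
  proof (rule equi_lipschitz_convergent[of "\<lambda>n s. \<phi> (T n + s)" M C])
    show "norm (\<phi> (T n + s)) \<le> M" if "0 \<le> s" for n s using M(2) polar_sphere T(1)[of n] that by simp
    show "norm (\<phi> (T n + t) - \<phi> (T n + s)) \<le> C * \<bar>t - s\<bar>" if "0 \<le> s" "0 \<le> t" for n s t
      using lip[of "T n + s" "T n + t"] T(1)[of n] that by simp
  qed blast
  define \<tau> where "\<tau> n = T (\<kappa> n)" for n
  have \<tau>0: "0 \<le> \<tau> n" for n by (simp add: \<tau>_def T)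
  have \<tau>lim: "filterlim \<tau> at_top sequentially"
    unfolding \<tau>_def by (rule filterlim_compose[OF T(2) filterlim_subseq[OF \<kappa>]])
  have \<psi>: "(\<lambda>n. \<phi> (\<tau> n + s)) \<longlonglongrightarrow> \<psi> s" if "0 \<le> s" for s using \<psi>[OF that] by (simp add: \<tau>_def)
  have \<psi>sphere: "rho \<omega> (\<psi> s) = 1" if s: "0 \<le> s" for s
  proof -
    have "(\<lambda>n. rho \<omega> (\<phi> (\<tau> n + s))) \<longlonglongrightarrow> rho \<omega> (\<psi> s)"
      using rho_continuous[OF \<omega>, of UNIV] \<psi>[OF s]
      by (intro isCont_tendsto_compose[where g = "rho \<omega>"]) (auto simp: continuous_on_eq_continuous_at)
    moreover have "(\<lambda>n. rho \<omega> (\<phi> (\<tau> n + s))) = (\<lambda>n. 1)" using polar_sphere \<tau>0 s by auto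
    ultimately show ?thesis by (metis LIMSEQ_unique tendsto_const)
  qed
  have \<psi>0: "\<psi> s \<noteq> 0" if "0 \<le> s" for s using \<psi>sphere[OF that] rho_zero[of \<omega>, OF \<omega>] by auto
  have \<psi>lip: "norm (\<psi> t - \<psi> s) \<le> C * \<bar>t - s\<bar>" if "0 \<le> s" "0 \<le> t" for s t
  proof (rule LIMSEQ_le_const2)
    show "(\<lambda>n. norm (\<phi> (\<tau> n + t) - \<phi> (\<tau> n + s))) \<longlonglongrightarrow> norm (\<psi> t - \<psi> s)" by (intro tendsto_intros \<psi> that)
    show "\<exists>N. \<forall>n\<ge>N. norm (\<phi> (\<tau> n + t) - \<phi> (\<tau> n + s)) \<le> C * \<bar>t - s\<bar>"
    proof (intro exI allI impI)
      show "norm (\<phi> (\<tau> n + t) - \<phi> (\<tau> n + s)) \<le> C * \<bar>t - s\<bar>" for n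
        using lip[of "\<tau> n + s" "\<tau> n + t"] \<tau>0[of n] that by simp
    qed
  qed
  have C0: "0 \<le> C" using M(1) KA(1) R(1) by (simp add: C_def)
  have \<psi>cont: "continuous_on {0..} \<psi>"
    by (rule lipschitz_on_continuous_on[of C], rule lipschitz_onI) (use \<psi>lip C0 in \<open>auto simp: dist_norm abs_minus_commute norm_minus_commute\<close>)
  have shift: "integral {\<tau> n..\<tau> n + s} h = integral {0..s} (\<lambda>x. h (\<tau> n + x))" if "continuous_on {0..} h" for n s and h :: "real \<Rightarrow> 'c::euclidean_space"
  proof -
    have "integral {0..s} (h \<circ> (\<lambda>x. x + \<tau> n)) = integral {0 + \<tau> n..s + \<tau> n} h"
      by (rule integral_shift, rule continuous_on_subset[OF that]) (use \<tau>0[of n] in auto)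
    then show ?thesis by (simp add: comp_def add.commute)
  qed
  have r_lim: "(\<lambda>n. r (\<tau> n) - r (\<tau> n + s)) \<longlonglongrightarrow> 0" if "0 \<le> s" for s
  proof -
    have "(\<lambda>n. r (\<tau> n)) \<longlonglongrightarrow> R" by (rule filterlim_compose[OF R(3) \<tau>lim])
    moreover have "filterlim (\<lambda>n. \<tau> n + s) at_top sequentially"
      using filterlim_tendsto_add_at_top[OF tendsto_const \<tau>lim, of s] by (simp add: add.commute)
    then have "(\<lambda>n. r (\<tau> n + s)) \<longlonglongrightarrow> R" by (rule filterlim_compose[OF R(3)])
    ultimately have "(\<lambda>n. r (\<tau> n) - r (\<tau> n + s)) \<longlonglongrightarrow> R - R" by (rule tendsto_diff)
    then show ?thesis by simp
  qed
  have cshift: "continuous_on {0..s} (\<lambda>x. h (\<tau> n + x))" if "continuous_on {0..} h" for n s and h :: "real \<Rightarrow> 'c::euclidean_space"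
    by (rule continuous_on_compose2[OF that]) (use \<tau>0[of n] in \<open>auto intro!: continuous_intros\<close>)
  have drift_lim: "(\<lambda>n. integral {\<tau> n..\<tau> n + s} (\<lambda>x. osc_A \<omega> (\<phi> x))) \<longlonglongrightarrow> integral {0..s} (\<lambda>x. osc_A \<omega> (\<psi> x))" for s
    unfolding shift[OF drift_continuous]
  proof (rule dominated_convergence(2)[where h = "\<lambda>_. M * KA"])
    show "(\<lambda>x. osc_A \<omega> (\<phi> (\<tau> n + x))) integrable_on {0..s}" for n
      by (intro integrable_continuous_real cshift drift_continuous)
    show "norm (osc_A \<omega> (\<phi> (\<tau> n + x))) \<le> M * KA" if "x \<in> {0..s}" for n x using A_le[of "\<tau> n + x"] \<tau>0[of n] that by simp
    show "(\<lambda>n. osc_A \<omega> (\<phi> (\<tau> n + x))) \<longlonglongrightarrow> osc_A \<omega> (\<psi> x)" if "x \<in> {0..s}" for x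
      using that by (intro A.tendsto \<psi>) auto
  qed (rule integrable_const_ivl)
  have gain_lim: "(\<lambda>n. integral {\<tau> n..\<tau> n + s} gain) \<longlonglongrightarrow> integral {0..s} (\<lambda>x. \<bar>grad (rho \<omega>) (\<psi> x) \<bullet> osc_B\<bar>)" for s
    unfolding shift[OF gain_continuous]
  proof (rule dominated_convergence(2)[where h = "\<lambda>_. M"])
    show "(\<lambda>x. gain (\<tau> n + x)) integrable_on {0..s}" for n
      by (intro integrable_continuous_real cshift gain_continuous)
    show "norm (gain (\<tau> n + x)) \<le> M" if "x \<in> {0..s}" for n x
      using M(3)[OF polar_sphere[of "\<tau> n + x"]] \<tau>0[of n] that by (simp add: gain_def)
    show "(\<lambda>n. gain (\<tau> n + x)) \<longlonglongrightarrow> \<bar>grad (rho \<omega>) (\<psi> x) \<bullet> osc_B\<bar>" if "x \<in> {0..s}" for x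
    proof -
      have "isCont (grad (rho \<omega>)) (\<psi> x)"
        using has_derivative_continuous[OF grad_rho_differentiable[OF \<omega> \<psi>0[of x]]] that by simp
      then show ?thesis unfolding gain_def
        using that by (intro tendsto_intros isCont_tendsto_compose[where g = "grad (rho \<omega>)"] \<psi>) auto
    qed
  qed (rule integrable_const_ivl)
  have gcont: "continuous_on {0..} (\<lambda>x. \<bar>grad (rho \<omega>) (\<psi> x) \<bullet> osc_B\<bar>)"
    by (intro continuous_intros continuous_on_compose2[OF grad_rho_continuous[OF \<omega>] \<psi>cont]) (auto simp: \<psi>0)
  have perp: "grad (rho \<omega>) (\<psi> s) \<bullet> osc_B = 0" if s: "0 \<le> s" for s
  proof -
    \<comment> \<open>The window has length s + 1 rather than s, so that it is nondegenerate for s =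
      0. A continuous nonnegative function with integral zero vanishes on it.\<close>
    have "(\<lambda>n. integral {\<tau> n..\<tau> n + (s + 1)} gain) = (\<lambda>n. r (\<tau> n) - r (\<tau> n + (s + 1)))"
    proof
      show "integral {\<tau> n..\<tau> n + (s + 1)} gain = r (\<tau> n) - r (\<tau> n + (s + 1))" for n
        using r_diff(2)[of "\<tau> n" "\<tau> n + (s + 1)"] \<tau>0[of n] s by simp
    qed
    then have "integral {0..s + 1} (\<lambda>x. \<bar>grad (rho \<omega>) (\<psi> x) \<bullet> osc_B\<bar>) = 0"
      using gain_lim[of "s + 1"] r_lim[of "s + 1"] s LIMSEQ_unique by force
    moreover have "continuous_on {0..s + 1} (\<lambda>x. \<bar>grad (rho \<omega>) (\<psi> x) \<bullet> osc_B\<bar>)"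
      by (rule continuous_on_subset[OF gcont]) auto
    ultimately have "\<forall>x\<in>{0..s + 1}. \<bar>grad (rho \<omega>) (\<psi> x) \<bullet> osc_B\<bar> = 0"
      using integral_eq_0_iff[of 0 "s + 1" "\<lambda>x. \<bar>grad (rho \<omega>) (\<psi> x) \<bullet> osc_B\<bar>"] s by simp
    then show ?thesis using s by auto
  qed
  \<comment> \<open>The part of the limit curve that the drift leaves over; it is the limit of the
    increments of W times \<open>osc_B\<close>.\<close>
  define b where "b s = \<psi> s - \<psi> 0 - integral {0..s} (\<lambda>x. osc_A \<omega> (\<psi> x))" for s
  have WB: "(\<lambda>n. (W (\<tau> n + s) - W (\<tau> n)) *\<^sub>R osc_B) \<longlonglongrightarrow> b s" if s: "0 \<le> s" for s
  proof -
    have rl: "(\<lambda>n. integral {\<tau> n..\<tau> n + s} radial) \<longlonglongrightarrow> 0"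
    proof (rule tendsto_0_le[OF r_lim[OF s], of _ "M / R"])
      show "eventually (\<lambda>n. norm (integral {\<tau> n..\<tau> n + s} radial) \<le> norm (r (\<tau> n) - r (\<tau> n + s)) * (M / R)) sequentially"
      proof (rule always_eventually, rule allI)
        fix n
        have "norm (integral {\<tau> n..\<tau> n + s} radial) \<le> M / R * (r (\<tau> n) - r (\<tau> n + s))"
          using radial_le[of "\<tau> n" "\<tau> n + s"] \<tau>0 s by simp
        also have "\<dots> \<le> M / R * norm (r (\<tau> n) - r (\<tau> n + s))" using M(1) R(1) by (intro mult_left_mono) auto
        finally show "norm (integral {\<tau> n..\<tau> n + s} radial) \<le> norm (r (\<tau> n) - r (\<tau> n + s)) * (M / R)" by (simp add: mult.commute)
      qed
    qed
    have "(\<lambda>n. \<phi> (\<tau> n + s) - \<phi> (\<tau> n + 0) - integral {\<tau> n..\<tau> n + s} (\<lambda>x. osc_A \<omega> (\<phi> x)) - integral {\<tau> n..\<tau> n + s} radial) \<longlonglongrightarrow>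
        \<psi> s - \<psi> 0 - integral {0..s} (\<lambda>x. osc_A \<omega> (\<psi> x)) - 0"
      by (intro tendsto_diff \<psi> drift_lim rl s) simp
    moreover have "\<phi> (\<tau> n + s) - \<phi> (\<tau> n + 0) - integral {\<tau> n..\<tau> n + s} (\<lambda>x. osc_A \<omega> (\<phi> x)) - integral {\<tau> n..\<tau> n + s} radial
        = (W (\<tau> n + s) - W (\<tau> n)) *\<^sub>R osc_B" for n
      using phi_diff[of "\<tau> n" "\<tau> n + s"] \<tau>0[of n] s by simp
    ultimately show ?thesis by (simp add: b_def)
  qed
  define w where "w s = snd (b s $ undefined)" for s
  have Wlim: "(\<lambda>n. W (\<tau> n + s) - W (\<tau> n)) \<longlonglongrightarrow> w s" if "0 \<le> s" for s
    using tendsto_snd[OF tendsto_vec_nth[OF WB[OF that], of undefined]] by (simp add: w_def)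
  have bw: "b s = w s *\<^sub>R osc_B" if "0 \<le> s" for s
    using LIMSEQ_unique[OF WB[OF that] tendsto_scaleR[OF Wlim[OF that] tendsto_const]] .
  have wlip0: "\<bar>w t - w s\<bar> \<le> (t - s) / R" if st: "0 \<le> s" "s \<le> t" for s t
  proof (rule LIMSEQ_le_const2)
    show "(\<lambda>n. \<bar>(W (\<tau> n + t) - W (\<tau> n)) - (W (\<tau> n + s) - W (\<tau> n))\<bar>) \<longlonglongrightarrow> \<bar>w t - w s\<bar>"
      using st by (intro tendsto_rabs tendsto_diff[OF Wlim Wlim]) auto
    show "\<exists>N. \<forall>n\<ge>N. \<bar>(W (\<tau> n + t) - W (\<tau> n)) - (W (\<tau> n + s) - W (\<tau> n))\<bar> \<le> (t - s) / R"
    proof (intro exI allI impI)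
      show "\<bar>(W (\<tau> n + t) - W (\<tau> n)) - (W (\<tau> n + s) - W (\<tau> n))\<bar> \<le> (t - s) / R" for n
        using W(2)[of "\<tau> n + s" "\<tau> n + t"] \<tau>0[of n] st by simp
    qed
  qed
  have "driven \<omega> R \<psi> w"
    unfolding driven_def sigma_def
  proof (intro conjI allI impI)
    show "\<psi> t \<in> {\<phi>. rho \<omega> \<phi> = 1 \<and> grad (rho \<omega>) \<phi> \<bullet> osc_B = 0}" if "0 \<le> t" for t
      using \<psi>sphere perp that by simp
    show "w 0 = 0" by (simp add: w_def b_def)
    show "\<bar>w t - w s\<bar> \<le> \<bar>t - s\<bar> / R" if "0 \<le> s" "0 \<le> t" for s t
      using wlip0[of s t] wlip0[of t s] that by (cases "s \<le> t") (auto simp: abs_minus_commute)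
    show "continuous_on {0..} \<psi>" by (rule \<psi>cont)
    show "\<psi> t = \<psi> 0 + integral {0..t} (\<lambda>s. osc_A \<omega> (\<psi> s)) + w t *\<^sub>R osc_B" if "0 \<le> t" for t
      using bw[OF that] by (simp add: b_def algebra_simps)
  qed
  then show ?thesis using that \<kappa> \<psi> by (simp add: \<tau>_def)
qed

text \<open>Without continuity of f, a bound along a limit curve does not pass to its limit points.
  Instead each limit point of \<phi> is made the initial point of a limit curve of its own, and
  \<open>driven_f_bound\<close> is used at time 0.\<close>

lemma polar_limit_small_f:
  assumes R: "0 < R" "\<And>t. 0 \<le> t \<Longrightarrow> R \<le> r t" "(r \<longlongrightarrow> R) at_top" and y: "y \<in> omega_limit \<phi>"
  shows "\<bar>f_fun \<omega> y\<bar> \<le> 1 / R"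
proof -
  obtain T :: "nat \<Rightarrow> real" where T: "filterlim T at_top sequentially" "(\<lambda>k. \<phi> (T k)) \<longlonglongrightarrow> y"
    using y unfolding omega_limit_def by blast
  obtain N where N: "\<And>n. n \<ge> N \<Longrightarrow> 0 \<le> T n"
    using T(1) unfolding filterlim_at_top eventually_sequentially by blast
  define S where "S n = T (n + N)" for n
  have S: "\<And>n. 0 \<le> S n" "filterlim S at_top sequentially" "(\<lambda>k. \<phi> (S k)) \<longlonglongrightarrow> y"
    using N filterlim_compose[OF T(1) filterlim_add_const_nat_at_top] LIMSEQ_ignore_initial_segment[OF T(2), of N]
    by (auto simp: S_def[abs_def])
  obtain \<kappa> \<psi> w where \<kappa>: "strict_mono (\<kappa> :: nat \<Rightarrow> nat)" "driven \<omega> R \<psi> w" "\<And>s. 0 \<le> s \<Longrightarrow> (\<lambda>n. \<phi> (S (\<kappa> n) + s)) \<longlonglongrightarrow> \<psi> s"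
    using polar_limit[OF R S(1,2)] by blast
  have "(\<lambda>n. \<phi> (S (\<kappa> n))) \<longlonglongrightarrow> y" using LIMSEQ_subseq_LIMSEQ[OF S(3) \<kappa>(1)] by (simp add: comp_def)
  then have "\<psi> 0 = y" using \<kappa>(3)[of 0] LIMSEQ_unique by auto
  then show ?thesis using driven_f_bound[OF \<omega> R(1) \<kappa>(2), of 0] by simp
qed

end

section \<open>Limit sets and the comparison with \<open>mu\<close>\<close>

lemma omega_limit_nonempty:
  fixes g :: "real \<Rightarrow> 'a::metric_space"
  assumes "compact S" "\<And>t. 0 \<le> t \<Longrightarrow> g t \<in> S"
  shows "omega_limit g \<noteq> {}"
proof -
  have "\<forall>n::nat. g (real n) \<in> S" using assms(2) by simp
  then obtain l \<kappa> where "l \<in> S" "strict_mono (\<kappa> :: nat \<Rightarrow> nat)" "((\<lambda>n. g (real n)) \<circ> \<kappa>) \<longlonglongrightarrow> l"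
    using assms(1) unfolding compact_def by metis
  moreover have "filterlim (\<lambda>n. real (\<kappa> n)) at_top sequentially"
    by (rule filterlim_compose[OF filterlim_real_sequentially filterlim_subseq]) fact
  ultimately have "l \<in> omega_limit g"
    unfolding omega_limit_def comp_def by (intro CollectI exI[of _ "\<lambda>n. real (\<kappa> n)"]) simp
  then show ?thesis by blast
qed

text \<open>A diagonal choice: for each k only convergence at the single time \<tau> (k + N) is
  needed, so pointwise convergence of the translates suffices.\<close>

lemma omega_limit_translates:
  fixes \<phi> \<psi> :: "real \<Rightarrow> 'a::metric_space"
  assumes T: "filterlim T at_top (sequentially :: nat filter)" and lim: "\<And>s. 0 \<le> s \<Longrightarrow> (\<lambda>n. \<phi> (T n + s)) \<longlonglongrightarrow> \<psi> s"
  shows "omega_limit \<psi> \<subseteq> omega_limit \<phi>"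
proof
  fix y assume "y \<in> omega_limit \<psi>"
  then obtain \<tau> :: "nat \<Rightarrow> real" where \<tau>: "filterlim \<tau> at_top sequentially" "(\<lambda>k. \<psi> (\<tau> k)) \<longlonglongrightarrow> y"
    unfolding omega_limit_def by blast
  obtain N where N: "\<And>n. n \<ge> N \<Longrightarrow> 0 \<le> \<tau> n"
    using \<tau>(1) unfolding filterlim_at_top eventually_sequentially by blast
  have "\<exists>n. real k \<le> T n \<and> dist (\<phi> (T n + \<tau> (k + N))) (\<psi> (\<tau> (k + N))) < inverse (real (Suc k))" for k
  proof -
    have "eventually (\<lambda>n. real k \<le> T n) sequentially" using T unfolding filterlim_at_top by blast
    moreover have "eventually (\<lambda>n. dist (\<phi> (T n + \<tau> (k + N))) (\<psi> (\<tau> (k + N))) < inverse (real (Suc k))) sequentially"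
      using lim[OF N[of "k + N"]] by (intro tendstoD) auto
    ultimately have "eventually (\<lambda>n. real k \<le> T n \<and> dist (\<phi> (T n + \<tau> (k + N))) (\<psi> (\<tau> (k + N))) < inverse (real (Suc k))) sequentially"
      by (rule eventually_conj)
    then show ?thesis by (auto simp: eventually_sequentially)
  qed
  then obtain n where n: "\<And>k. real k \<le> T (n k)" "\<And>k. dist (\<phi> (T (n k) + \<tau> (k + N))) (\<psi> (\<tau> (k + N))) < inverse (real (Suc k))"
    by metis
  define S where "S k = T (n k) + \<tau> (k + N)" for k
  have "filterlim S at_top sequentially"
  proof (rule filterlim_at_top_mono[OF filterlim_real_sequentially])
    show "eventually (\<lambda>k. real k \<le> S k) sequentially"
      by (rule always_eventually, rule allI) (use n(1) N in \<open>simp add: S_def add_increasing2\<close>)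
  qed
  moreover have "(\<lambda>k. \<phi> (S k)) \<longlonglongrightarrow> y"
  proof (rule metric_LIMSEQ_I)
    fix e :: real assume e: "0 < e"
    have "eventually (\<lambda>k. dist (\<psi> (\<tau> (k + N))) y < e / 2) sequentially"
      using tendstoD[OF LIMSEQ_ignore_initial_segment[OF \<tau>(2), of N], of "e / 2"] e by simp
    moreover have "eventually (\<lambda>k. inverse (real (Suc k)) < e / 2) sequentially"
      using order_tendstoD(2)[OF LIMSEQ_inverse_real_of_nat, of "e / 2"] e by simp
    ultimately have "eventually (\<lambda>k. dist (\<phi> (S k)) y < e) sequentially"
    proof eventually_elim
      case (elim k)
      have "dist (\<phi> (S k)) y \<le> dist (\<phi> (S k)) (\<psi> (\<tau> (k + N))) + dist (\<psi> (\<tau> (k + N))) y" by (rule dist_triangle)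
      then show ?case using n(2)[of k] elim unfolding S_def by linarith
    qed
    then show "\<exists>M. \<forall>k\<ge>M. dist (\<phi> (S k)) y < e" by (simp add: eventually_sequentially)
  qed
  ultimately show "y \<in> omega_limit \<phi>" unfolding omega_limit_def by blast
qed

text \<open>The supremum over an empty limit set would be minus infinity; compactness of the unit
  sphere of \<rho> excludes this. Nonnegativity is what makes \<open>inverse\<close> order-reversing
  here.\<close>

lemma mu_nonneg:
  assumes \<omega>: "\<And>i. 0 < \<omega> $ i"
  shows "0 \<le> mu \<omega>"
  unfolding mu_def
proof (rule INF_greatest)
  fix K assume "K \<in> sigma_attractors \<omega>"
  then obtain \<phi> where \<phi>: "K = omega_limit \<phi>" "sigma_motion \<omega> \<phi>" unfolding sigma_attractors_def by blast
  have "\<phi> t \<in> {x. rho \<omega> x = 1}" if "0 \<le> t" for t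
    using \<phi>(2) that unfolding sigma_motion_def sigma_def by blast
  then have "K \<noteq> {}" unfolding \<phi>(1) using omega_limit_nonempty[OF compact_rho_sphere[OF \<omega>]] by blast
  then obtain y where "y \<in> K" by blast
  then have "ereal \<bar>f_fun \<omega> y\<bar> \<le> (SUP \<phi>\<in>K. ereal \<bar>f_fun \<omega> \<phi>\<bar>)" by (rule SUP_upper)
  then show "0 \<le> (SUP \<phi>\<in>K. ereal \<bar>f_fun \<omega> \<phi>\<bar>)" by (rule order_trans[rotated]) simp
qed

text \<open>The witness is R times the initial point of a limit curve: it lies on the sphere \<rho>
  = R, and the same curve is a motion on \<sigma> that tests the infimum in
  \<open>mu\<close>.\<close>

lemma control_attractor_dichotomy:
  fixes \<omega> :: "real^'n::finite"
  assumes \<omega>: "\<And>i. 0 < \<omega> $ i" and K: "K \<in> control_attractors \<omega>" "K \<noteq> {0}"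
  shows "\<exists>x\<in>K. ereal (rho \<omega> x) \<le> inverse (mu \<omega>)"
proof -
  obtain r \<phi> where polar: "polar_motion \<omega> r \<phi>" and Keq: "K = omega_limit (\<lambda>t. r t *\<^sub>R \<phi> t)"
    using K(1) unfolding control_attractors_def by blast
  obtain R where R: "0 \<le> R" "(r \<longlongrightarrow> R) at_top" "\<And>t. 0 \<le> t \<Longrightarrow> R \<le> r t"
    using r_limit[OF \<omega> polar] by blast
  obtain M where M: "\<And>x. rho \<omega> x = 1 \<Longrightarrow> norm x \<le> M" using sphere_bound[OF \<omega> polar] by metis
  have "R \<noteq> 0"
  proof
    assume "R = 0"
    have lim: "((\<lambda>t. r t *\<^sub>R \<phi> t) \<longlongrightarrow> 0) at_top"
    proof (rule tendsto_0_le[OF R(2)[unfolded \<open>R = 0\<close>], of _ M])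
      show "eventually (\<lambda>t. norm (r t *\<^sub>R \<phi> t) \<le> norm (r t) * M) at_top"
        using eventually_ge_at_top[of 0]
        by eventually_elim (simp add: M polar_sphere[OF \<omega> polar] mult_left_mono)
    qed
    have "y = 0" if yK: "y \<in> K" for y
    proof -
      obtain \<tau> :: "nat \<Rightarrow> real" where \<tau>: "filterlim \<tau> at_top sequentially" "(\<lambda>k. r (\<tau> k) *\<^sub>R \<phi> (\<tau> k)) \<longlonglongrightarrow> y"
        using yK unfolding Keq omega_limit_def by blast
      then show ?thesis using LIMSEQ_unique[OF \<tau>(2) filterlim_compose[OF lim \<tau>(1)]] by simp
    qed
    moreover have "0 \<in> K" unfolding Keq omega_limit_def
      using filterlim_real_sequentially filterlim_compose[OF lim filterlim_real_sequentially] by blast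
    ultimately have "K = {0}" by blast
    then show False using K(2) by simp
  qed
  then have R0: "0 < R" using R(1) by simp
  obtain \<kappa> \<psi> w where \<kappa>: "strict_mono (\<kappa> :: nat \<Rightarrow> nat)" "driven \<omega> R \<psi> w" "\<And>s. 0 \<le> s \<Longrightarrow> (\<lambda>n. \<phi> (real (\<kappa> n) + s)) \<longlonglongrightarrow> \<psi> s"
    using polar_limit[OF \<omega> polar R0 R(3) R(2), of real] filterlim_real_sequentially by auto
  have \<kappa>top: "filterlim (\<lambda>n. real (\<kappa> n)) at_top sequentially"
    by (rule filterlim_compose[OF filterlim_real_sequentially filterlim_subseq[OF \<kappa>(1)]])
  have small: "\<bar>f_fun \<omega> y\<bar> \<le> 1 / R" if "y \<in> omega_limit \<psi>" for y
  proof (rule polar_limit_small_f[OF \<omega> polar R0 R(3) R(2)])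
    show "y \<in> omega_limit \<phi>" using omega_limit_translates[of "\<lambda>n. real (\<kappa> n)" \<phi> \<psi>] \<kappa>top \<kappa>(3) that by blast
  qed
  have "sigma_motion \<omega> \<psi>" by (rule driven_sigma_motion[OF \<omega> R0 \<kappa>(2)])
  then have "mu \<omega> \<le> (SUP y\<in>omega_limit \<psi>. ereal \<bar>f_fun \<omega> y\<bar>)"
    unfolding mu_def sigma_attractors_def by (intro INF_lower) blast
  also have "\<dots> \<le> ereal (1 / R)" using small by (intro SUP_least) simp
  finally have "inverse (ereal (1 / R)) \<le> inverse (mu \<omega>)"
    using mu_nonneg[OF \<omega>] by (intro ereal_inverse_antimono) auto
  then have mu: "ereal R \<le> inverse (mu \<omega>)" using R0 by simp
  have "(\<lambda>n. r (real (\<kappa> n)) *\<^sub>R \<phi> (real (\<kappa> n))) \<longlonglongrightarrow> R *\<^sub>R \<psi> 0"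
    using \<kappa>(3)[of 0] by (intro tendsto_scaleR filterlim_compose[OF R(2) \<kappa>top]) simp
  then have "R *\<^sub>R \<psi> 0 \<in> K" unfolding Keq omega_limit_def using \<kappa>top by blast
  moreover have "rho \<omega> (R *\<^sub>R \<psi> 0) = R"
    using driven_sphere[OF \<omega> R0 \<kappa>(2), of 0] R0 by (simp add: rho_scale[OF \<omega>])
  ultimately show ?thesis using mu by metis
qed

theorem theorem8:
  fixes \<omega> :: "real^'n::finite"
  assumes "\<forall>i. 0 < \<omega> $ i"
    and "\<forall>i j. i \<noteq> j \<longrightarrow> \<omega> $ i \<noteq> \<omega> $ j"
  shows "\<not> (\<exists>K. minimal_attractor \<omega> K \<and> K \<noteq> {0} \<and> K \<subseteq> outer_domain \<omega>)"
proof
  assume "\<exists>K. minimal_attractor \<omega> K \<and> K \<noteq> {0} \<and> K \<subseteq> outer_domain \<omega>"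
  then obtain K where K: "K \<in> control_attractors \<omega>" "K \<noteq> {0}" "K \<subseteq> outer_domain \<omega>"
    unfolding minimal_attractor_def by blast
  have "\<exists>x\<in>K. ereal (rho \<omega> x) \<le> inverse (mu \<omega>)"
    using assms(1) by (intro control_attractor_dichotomy K(1,2)) blast
  then show False using K(3) unfolding outer_domain_def by (auto simp: not_le[symmetric])
qed

end
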